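(* Let $(\mathcal{C},\mathbb{E},\mathfrak{s})$ be an $R$-linear extriangulated category and let $(F^\bullet,\delta_\sharp)$ be a covariant connected sequence of functors on it. Assume that there exists $m\in\mathbb{Z}$ such that either $((F^n)_{n>m},\delta_\sharp)$ or $((F^n)_{n<m},\delta_\sharp)$ is a partial $\delta$-functor. Then for all $A,C\in\mathcal{C}$ the subsets $$\{\delta\in\mathbb{E}(C,A)\mid x_*\delta\text{ is }F^\bullet\text{-acyclic for every inflation }x\text{ from }A\}$$ and $$\{\delta\in\mathbb{E}(C,A)\mid y^*\delta\text{ is }F^\bullet\text{-acyclic for every deflation }y\text{ to }C\}$$ of $\mathbb{E}(C,A)$ are equal. Denoting this subset by $\mathbb{F}(C,A)$, $\mathbb{F}\subseteq\mathbb{E}$ is a closed sub-bifunctor, and the resulting extriangulated category $(\mathcal{C},\mathbb{F},\mathfrak{s}|_{\mathbb{F}})$ is the largest relative theory on which $(F^\bullet,\delta_\sharp)$ becomes a $\delta$-functor (that is, $(F^\bullet,\delta_\sharp)$, with connecting morphisms restricted to extensions in $\mathbb{F}$, is a $\delta$-functor on $(\mathcal{C},\mathbb{F},\mathfrak{s}|_{\mathbb{F}})$, and every closed sub-bifunctor $\mathbb{F}'\subseteq\mathbb{E}$ such that it is a $\delta$-functor on $(\mathcal{C},\mathbb{F}',\mathfrak{s}|_{\mathbb{F}'})$ satisfies $\mathbb{F}'\subseteq\mathbb{F}$).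
   Context: $R$ is a commutative ring with $1$; $\mathcal{C}$ is an essentially small additive $R$-linear category. Extriangulated categories: let $\mathbb{E}\colon\mathcal{C}^{\mathrm{op}}\times\mathcal{C}\to\mathrm{Mod}\,R$ be an $R$-bilinear functor. An element $\delta\in\mathbb{E}(C,A)$ is called an extension; for $a\colon A\to A'$ and $c\colon C'\to C$ put $a_*\delta=\mathbb{E}(C,a)(\delta)$ and $c^*\delta=\mathbb{E}(c,A)(\delta)$. A morphism of extensions from $\delta\in\mathbb{E}(C,A)$ to $\delta'\in\mathbb{E}(C',A')$ is a pair $(a\colon A\to A',\,c\colon C\to C')$ with $a_*\delta=c^*\delta'$. The extension $\delta\oplus\delta'\in\mathbb{E}(C\oplus C',A\oplus A')$ is the one with diagonal components $\delta,\delta'$ and zero off-diagonal components. Sequences $A\xrightarrow{x}B\xrightarrow{y}C$ and $A\xrightarrow{x'}B'\xrightarrow{y'}C$ are equivalent if there is an isomorphism $b\colon B\to B'$ with $bx=x'$, $y'b=y$; the class is written $[A\xrightarrow{x}B\xrightarrow{y}C]$. An additive realization $\mathfrak{s}$ assigns to each $\delta\in\mathbb{E}(C,A)$ such a class $\mathfrak{s}(\delta)=[A\xrightarrow{x}B\xrightarrow{y}C]$ so that: for each morphism $(a,c)\colon\delta\to\delta'$ with $\mathfrak{s}(\delta')=[A'\xrightarrow{x'}B'\xrightarrow{y'}C']$ there is $b\colon B\to B'$ with $bx=x'a$, $y'b=cy$; $\mathfrak{s}(0)=[A\to A\oplus C\to C]$ (canonical maps); and $\mathfrak{s}(\delta\oplus\delta')=\mathfrak{s}(\delta)\oplus\mathfrak{s}(\delta')$.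 The triple $(\mathcal{C},\mathbb{E},\mathfrak{s})$ is an ($R$-linear) extriangulated category if moreover: (ET3) if $\mathfrak{s}(\delta)=[A\xrightarrow{x}B\xrightarrow{y}C]$, $\mathfrak{s}(\delta')=[A'\xrightarrow{x'}B'\xrightarrow{y'}C']$ and $bx=x'a$, then there is $c$ with $cy=y'b$ and $a_*\delta=c^*\delta'$; (ET3)$^{\mathrm{op}}$ the dual; (ET4) if $\delta\in\mathbb{E}(D,A)$ and $\delta'\in\mathbb{E}(F,B)$ are realized by $A\xrightarrow{f}B\xrightarrow{f'}D$ and $B\xrightarrow{g}C\xrightarrow{g'}F$, then there are an object $E$, morphisms $d\colon D\to E$, $e\colon E\to F$, $h=gf$, $h'\colon C\to E$ with $h'g=df'$, $eh'=g'$, and $\delta''\in\mathbb{E}(E,A)$ realized by $A\xrightarrow{h}C\xrightarrow{h'}E$, such that $D\xrightarrow{d}E\xrightarrow{e}F$ realizes $f'_*\delta'$, $d^*\delta''=\delta$ and $f_*\delta''=e^*\delta'$; (ET4)$^{\mathrm{op}}$ the dual. If $\mathfrak{s}(\delta)=[A\xrightarrow{x}B\xrightarrow{y}C]$ one writes $A\xrightarrow{x}B\xrightarrow{y}C\overset{\delta}{\dashrightarrow}$ and calls it an $\mathfrak{s}$-triangle; $x$ is an inflation, $y$ a deflation, $A\to B\to C$ a conflation. A sub-bifunctor $\mathbb{F}\subseteq\mathbb{E}$ is closed if $(\mathcal{C},\mathbb{F},\mathfrak{s}|_{\mathbb{F}})$ is again an extriangulated category; it is then called a relative theory (relative extriangulated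 structure). $\mathrm{Mod}\,\mathcal{C}$ is the category of $R$-linear functors $\mathcal{C}^{\mathrm{op}}\to\mathrm{Mod}\,R$. A covariant connected sequence of functors $(F^\bullet,\delta_\sharp)$ is a sequence of $R$-bilinear functors $F^n\colon\mathcal{C}^{\mathrm{op}}\times\mathcal{C}\to\mathrm{Mod}\,R$ ($n\in\mathbb{Z}$) with morphisms $\delta_\sharp\colon F^n(-,C)\to F^{n+1}(-,A)$ in $\mathrm{Mod}\,\mathcal{C}$ for all $\delta\in\mathbb{E}(C,A)$, $n\in\mathbb{Z}$, natural with respect to morphisms of extensions (for $(a,c)\colon\delta\to\delta'$: $F^{n+1}(-,a)\circ\delta_\sharp=\delta'_\sharp\circ F^n(-,c)$). For an $\mathfrak{s}$-triangle $A\xrightarrow{x}B\xrightarrow{y}C\overset{\delta}{\dashrightarrow}$ there is the complex $$\cdots\xrightarrow{\delta_\sharp}F^n(-,A)\xrightarrow{x_*}F^n(-,B)\xrightarrow{y_*}F^n(-,C)\xrightarrow{\delta_\sharp}F^{n+1}(-,A)\to\cdots,$$ depending up to isomorphism only on $\delta$. The extension $\delta$ is $F^\bullet$-acyclic if this complex is acyclic; $(F^\bullet,\delta_\sharp)$ is a $\delta$-functor if every extension is $F^\bullet$-acyclic. The truncated sequence $((F^n)_{n>m},\delta_\sharp)$ (resp. $((F^n)_{n<m},\delta_\sharp)$) is a partial $\delta$-functor if for every $\mathfrak{s}$-triangle the part of this complex involving only the $F^n$ with $n>m$ (resp. $n<m$) is exact except possibly at its end term. *)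

theory Defs
  imports "HOL-Algebra.Module" "HOL-Algebra.AbelCoset"
begin

section \<open>Linear and additive categories\<close>

definition linear_map ::
    "'r ring \<Rightarrow> ('r, 'a) module \<Rightarrow> ('r, 'b) module \<Rightarrow> ('a \<Rightarrow> 'b) \<Rightarrow> bool" where
  "linear_map R M N f \<longleftrightarrow> f \<in> hom (add_monoid M) (add_monoid N) \<and>
     (\<forall>r\<in>carrier R. \<forall>x\<in>carrier M. f (r \<odot>\<^bsub>M\<^esub> x) = r \<odot>\<^bsub>N\<^esub> f x)"

text \<open>Composition is written in applicative order: \<open>g \<cdot> f\<close> is \<open>f\<close> followed by \<open>g\<close>.\<close>

record ('r, 'o, 'm) lin_category =
  Obj :: "'o set"
  Hom :: "'o \<Rightarrow> 'o \<Rightarrow> ('r, 'm) module"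
  ident :: "'o \<Rightarrow> 'm"
  Comp :: "'m \<Rightarrow> 'm \<Rightarrow> 'm" (infixr "\<cdot>\<index>" 75)

abbreviation Mor :: "('r, 'o, 'm) lin_category \<Rightarrow> 'o \<Rightarrow> 'o \<Rightarrow> 'm set" where
  "Mor \<C> A B \<equiv> carrier (Hom \<C> A B)"

text \<open>Hom-sets are pairwise disjoint, so that a morphism determines its source and target.\<close>

locale linear_category = cring R
  for R :: "'r ring" +
  fixes \<C> :: "('r, 'o, 'm) lin_category" (structure)
  assumes Hom_module: "\<lbrakk>A \<in> Obj \<C>; B \<in> Obj \<C>\<rbrakk> \<Longrightarrow> module R (Hom \<C> A B)"
    and Hom_disjoint:
      "\<lbrakk>A \<in> Obj \<C>; B \<in> Obj \<C>; A' \<in> Obj \<C>; B' \<in> Obj \<C>; f \<in> Mor \<C> A B; f \<in> Mor \<C> A' B'\<rbrakk>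
        \<Longrightarrow> A = A' \<and> B = B'"
    and ident_closed: "A \<in> Obj \<C> \<Longrightarrow> ident \<C> A \<in> Mor \<C> A A"
    and comp_closed:
      "\<lbrakk>A \<in> Obj \<C>; B \<in> Obj \<C>; D \<in> Obj \<C>; f \<in> Mor \<C> A B; g \<in> Mor \<C> B D\<rbrakk> \<Longrightarrow> g \<cdot> f \<in> Mor \<C> A D"
    and comp_ident_right: "\<lbrakk>A \<in> Obj \<C>; B \<in> Obj \<C>; f \<in> Mor \<C> A B\<rbrakk> \<Longrightarrow> f \<cdot> ident \<C> A = f"
    and comp_ident_left: "\<lbrakk>A \<in> Obj \<C>; B \<in> Obj \<C>; f \<in> Mor \<C> A B\<rbrakk> \<Longrightarrow> ident \<C> B \<cdot> f = f"
    and comp_assoc: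
      "\<lbrakk>A \<in> Obj \<C>; B \<in> Obj \<C>; D \<in> Obj \<C>; D' \<in> Obj \<C>;
        f \<in> Mor \<C> A B; g \<in> Mor \<C> B D; h \<in> Mor \<C> D D'\<rbrakk> \<Longrightarrow> (h \<cdot> g) \<cdot> f = h \<cdot> (g \<cdot> f)"
    and comp_linear_left:
      "\<lbrakk>A \<in> Obj \<C>; B \<in> Obj \<C>; D \<in> Obj \<C>; f \<in> Mor \<C> A B\<rbrakk>
        \<Longrightarrow> linear_map R (Hom \<C> B D) (Hom \<C> A D) (\<lambda>g. g \<cdot> f)"
    and comp_linear_right:
      "\<lbrakk>A \<in> Obj \<C>; B \<in> Obj \<C>; D \<in> Obj \<C>; g \<in> Mor \<C> B D\<rbrakk>
        \<Longrightarrow> linear_map R (Hom \<C> A B) (Hom \<C> A D) (\<lambda>f. g \<cdot> f)"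

definition zero_object :: "('r, 'o, 'm) lin_category \<Rightarrow> 'o \<Rightarrow> bool" where
  "zero_object \<C> Z \<longleftrightarrow> Z \<in> Obj \<C> \<and>
     (\<forall>A\<in>Obj \<C>. (\<exists>!f. f \<in> Mor \<C> Z A) \<and> (\<exists>!f. f \<in> Mor \<C> A Z))"

definition biproduct ::
    "('r, 'o, 'm) lin_category \<Rightarrow> 'o \<Rightarrow> 'o \<Rightarrow> 'o \<Rightarrow> 'm \<Rightarrow> 'm \<Rightarrow> 'm \<Rightarrow> 'm \<Rightarrow> bool" where
  "biproduct \<C> A B S i\<^sub>1 i\<^sub>2 p\<^sub>1 p\<^sub>2 \<longleftrightarrow>
     A \<in> Obj \<C> \<and> B \<in> Obj \<C> \<and> S \<in> Obj \<C> \<and>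
     i\<^sub>1 \<in> Mor \<C> A S \<and> i\<^sub>2 \<in> Mor \<C> B S \<and> p\<^sub>1 \<in> Mor \<C> S A \<and> p\<^sub>2 \<in> Mor \<C> S B \<and>
     p\<^sub>1 \<cdot>\<^bsub>\<C>\<^esub> i\<^sub>1 = ident \<C> A \<and> p\<^sub>2 \<cdot>\<^bsub>\<C>\<^esub> i\<^sub>2 = ident \<C> B \<and>
     p\<^sub>2 \<cdot>\<^bsub>\<C>\<^esub> i\<^sub>1 = \<zero>\<^bsub>Hom \<C> A B\<^esub> \<and> p\<^sub>1 \<cdot>\<^bsub>\<C>\<^esub> i\<^sub>2 = \<zero>\<^bsub>Hom \<C> B A\<^esub> \<and>
     (i\<^sub>1 \<cdot>\<^bsub>\<C>\<^esub> p\<^sub>1) \<oplus>\<^bsub>Hom \<C> S S\<^esub> (i\<^sub>2 \<cdot>\<^bsub>\<C>\<^esub> p\<^sub>2) = ident \<C> S"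

locale additive_category = linear_category +
  assumes ex_zero_object: "\<exists>Z. zero_object \<C> Z"
    and ex_biproduct:
      "\<lbrakk>A \<in> Obj \<C>; B \<in> Obj \<C>\<rbrakk> \<Longrightarrow> \<exists>S i\<^sub>1 i\<^sub>2 p\<^sub>1 p\<^sub>2. biproduct \<C> A B S i\<^sub>1 i\<^sub>2 p\<^sub>1 p\<^sub>2"

definition iso_mor :: "('r, 'o, 'm) lin_category \<Rightarrow> 'o \<Rightarrow> 'o \<Rightarrow> 'm \<Rightarrow> bool" where
  "iso_mor \<C> A B f \<longleftrightarrow> f \<in> Mor \<C> A B \<and>
     (\<exists>g\<in>Mor \<C> B A. g \<cdot>\<^bsub>\<C>\<^esub> f = ident \<C> A \<and> f \<cdot>\<^bsub>\<C>\<^esub> g = ident \<C> B)"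


section \<open>Bilinear functors to modules\<close>

text \<open>A functor \<open>G\<close> from \<open>\<C>\<^sup>o\<^sup>p \<times> \<C>\<close> to \<open>R\<close>-modules has values \<open>obj_map G C A\<close> and actions
  \<open>mor_map G c a\<close>; the first argument is the contravariant one.\<close>

record ('r, 'o, 'm, 'v) bifunctor =
  obj_map :: "'o \<Rightarrow> 'o \<Rightarrow> ('r, 'v) module"
  mor_map :: "'m \<Rightarrow> 'm \<Rightarrow> 'v \<Rightarrow> 'v"

locale bilinear_functor = linear_category R \<C>
  for R :: "'r ring" and \<C> :: "('r, 'o, 'm) lin_category" (structure) +
  fixes G :: "('r, 'o, 'm, 'v) bifunctor"
  assumes obj_module: "\<lbrakk>C \<in> Obj \<C>; A \<in> Obj \<C>\<rbrakk> \<Longrightarrow> module R (obj_map G C A)"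
    and mor_linear:
      "\<lbrakk>C \<in> Obj \<C>; C' \<in> Obj \<C>; A \<in> Obj \<C>; A' \<in> Obj \<C>; c \<in> Mor \<C> C' C; a \<in> Mor \<C> A A'\<rbrakk>
        \<Longrightarrow> linear_map R (obj_map G C A) (obj_map G C' A') (mor_map G c a)"
    and mor_ident:
      "\<lbrakk>C \<in> Obj \<C>; A \<in> Obj \<C>; v \<in> carrier (obj_map G C A)\<rbrakk>
        \<Longrightarrow> mor_map G (ident \<C> C) (ident \<C> A) v = v"
    and mor_comp:
      "\<lbrakk>C \<in> Obj \<C>; C' \<in> Obj \<C>; C'' \<in> Obj \<C>; A \<in> Obj \<C>; A' \<in> Obj \<C>; A'' \<in> Obj \<C>;
        c \<in> Mor \<C> C' C; c' \<in> Mor \<C> C'' C'; a \<in> Mor \<C> A A'; a' \<in> Mor \<C> A' A'';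
        v \<in> carrier (obj_map G C A)\<rbrakk>
        \<Longrightarrow> mor_map G (c \<cdot> c') (a' \<cdot> a) v = mor_map G c' a' (mor_map G c a v)"
    and linear_contra:
      "\<lbrakk>C \<in> Obj \<C>; C' \<in> Obj \<C>; A \<in> Obj \<C>; A' \<in> Obj \<C>; a \<in> Mor \<C> A A';
        v \<in> carrier (obj_map G C A)\<rbrakk>
        \<Longrightarrow> linear_map R (Hom \<C> C' C) (obj_map G C' A') (\<lambda>c. mor_map G c a v)"
    and linear_co:
      "\<lbrakk>C \<in> Obj \<C>; C' \<in> Obj \<C>; A \<in> Obj \<C>; A' \<in> Obj \<C>; c \<in> Mor \<C> C' C;
        v \<in> carrier (obj_map G C A)\<rbrakk>
        \<Longrightarrow> linear_map R (Hom \<C> A A') (obj_map G C' A') (\<lambda>a. mor_map G c a v)"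

text \<open>\<open>push \<C> G C a\<close> is \<open>a\<^sub>* = G(C, a)\<close>, and \<open>pull \<C> G A c\<close> is \<open>c\<^sup>* = G(c, A)\<close>.\<close>

definition push ::
    "('r, 'o, 'm) lin_category \<Rightarrow> ('r, 'o, 'm, 'v) bifunctor \<Rightarrow> 'o \<Rightarrow> 'm \<Rightarrow> 'v \<Rightarrow> 'v" where
  "push \<C> G C a = mor_map G (ident \<C> C) a"

definition pull ::
    "('r, 'o, 'm) lin_category \<Rightarrow> ('r, 'o, 'm, 'v) bifunctor \<Rightarrow> 'o \<Rightarrow> 'm \<Rightarrow> 'v \<Rightarrow> 'v" where
  "pull \<C> G A c = mor_map G c (ident \<C> A)"


section \<open>Extensions and realizations\<close>

definition ext_morphism ::
    "('r, 'o, 'm) lin_category \<Rightarrow> ('r, 'o, 'm, 'e) bifunctor \<Rightarrow>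
     'o \<Rightarrow> 'o \<Rightarrow> 'e \<Rightarrow> 'o \<Rightarrow> 'o \<Rightarrow> 'e \<Rightarrow> 'm \<Rightarrow> 'm \<Rightarrow> bool" where
  "ext_morphism \<C> E C A \<delta> C' A' \<delta>' a c \<longleftrightarrow>
     a \<in> Mor \<C> A A' \<and> c \<in> Mor \<C> C C' \<and> push \<C> E C a \<delta> = pull \<C> E A' c \<delta>'"

text \<open>A sequence \<open>A \<rightarrow> B \<rightarrow> C\<close> with fixed end terms is encoded as the triple \<open>(B, x, y)\<close>;
  no condition on \<open>y \<cdot> x\<close> is imposed.\<close>

definition sequences :: "('r, 'o, 'm) lin_category \<Rightarrow> 'o \<Rightarrow> 'o \<Rightarrow> ('o \<times> 'm \<times> 'm) set" where
  "sequences \<C> A C = {(B, x, y). B \<in> Obj \<C> \<and> x \<in> Mor \<C> A B \<and> y \<in> Mor \<C> B C}"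

definition seq_class ::
    "('r, 'o, 'm) lin_category \<Rightarrow> 'o \<Rightarrow> 'o \<Rightarrow> 'o \<times> 'm \<times> 'm \<Rightarrow> ('o \<times> 'm \<times> 'm) set" where
  "seq_class \<C> A C = (\<lambda>(B, x, y). {(B', x', y') \<in> sequences \<C> A C.
     \<exists>b. iso_mor \<C> B B' b \<and> b \<cdot>\<^bsub>\<C>\<^esub> x = x' \<and> y' \<cdot>\<^bsub>\<C>\<^esub> b = y})"

text \<open>A realization maps \<open>\<delta> \<in> E(C, A)\<close> to an equivalence class of sequences \<open>A \<rightarrow> B \<rightarrow> C\<close>; as an
  element does not determine \<open>C\<close> and \<open>A\<close>, these are arguments: \<open>s C A \<delta>\<close>.\<close>

type_synonym ('o, 'm, 'e) realization = "'o \<Rightarrow> 'o \<Rightarrow> 'e \<Rightarrow> ('o \<times> 'm \<times> 'm) set"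

definition s_triangle ::
    "('r, 'o, 'm) lin_category \<Rightarrow> ('r, 'o, 'm, 'e) bifunctor \<Rightarrow> ('o, 'm, 'e) realization \<Rightarrow>
     'o \<Rightarrow> 'o \<Rightarrow> 'o \<Rightarrow> 'm \<Rightarrow> 'm \<Rightarrow> 'e \<Rightarrow> bool" where
  "s_triangle \<C> E s A B C x y \<delta> \<longleftrightarrow>
     A \<in> Obj \<C> \<and> C \<in> Obj \<C> \<and> \<delta> \<in> carrier (obj_map E C A) \<and> (B, x, y) \<in> s C A \<delta>"

text \<open>\<open>\<epsilon> \<in> E(SC, SA)\<close> has diagonal components \<open>\<delta>\<close>, \<open>\<delta>'\<close> and zero off-diagonal components, where
  \<open>i\<^sub>1, i\<^sub>2\<close> are the injections of \<open>SC = C \<oplus> C'\<close> and \<open>p\<^sub>1, p\<^sub>2\<close> the projections of \<open>SA = A \<oplus> A'\<close>.\<close>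

definition ext_sum ::
    "('r, 'o, 'm, 'e) bifunctor \<Rightarrow> 'o \<Rightarrow> 'o \<Rightarrow> 'e \<Rightarrow> 'o \<Rightarrow> 'o \<Rightarrow> 'e \<Rightarrow>
     'o \<Rightarrow> 'm \<Rightarrow> 'm \<Rightarrow> 'o \<Rightarrow> 'm \<Rightarrow> 'm \<Rightarrow> 'e \<Rightarrow> bool" where
  "ext_sum E C A \<delta> C' A' \<delta>' SC i\<^sub>1 i\<^sub>2 SA p\<^sub>1 p\<^sub>2 \<epsilon> \<longleftrightarrow>
     \<epsilon> \<in> carrier (obj_map E SC SA) \<and>
     mor_map E i\<^sub>1 p\<^sub>1 \<epsilon> = \<delta> \<and> mor_map E i\<^sub>2 p\<^sub>2 \<epsilon> = \<delta>' \<and>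
     mor_map E i\<^sub>1 p\<^sub>2 \<epsilon> = \<zero>\<^bsub>obj_map E C A'\<^esub> \<and> mor_map E i\<^sub>2 p\<^sub>1 \<epsilon> = \<zero>\<^bsub>obj_map E C' A\<^esub>"

text \<open>In the last two axioms direct sums are taken along arbitrary biproducts rather than chosen ones.\<close>

locale additive_realization =
  additive_category R \<C> + bilinear_functor R \<C> E
  for R :: "'r ring" and \<C> :: "('r, 'o, 'm) lin_category" (structure)
    and E :: "('r, 'o, 'm, 'e) bifunctor" +
  fixes s :: "('o, 'm, 'e) realization"
  assumes realization_class:
      "\<lbrakk>A \<in> Obj \<C>; C \<in> Obj \<C>; \<delta> \<in> carrier (obj_map E C A)\<rbrakk>
        \<Longrightarrow> \<exists>t\<in>sequences \<C> A C. s C A \<delta> = seq_class \<C> A C t"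
    and realization_morphism:
      "\<lbrakk>s_triangle \<C> E s A B C x y \<delta>; s_triangle \<C> E s A' B' C' x' y' \<delta>';
        ext_morphism \<C> E C A \<delta> C' A' \<delta>' a c\<rbrakk>
        \<Longrightarrow> \<exists>b\<in>Mor \<C> B B'. b \<cdot> x = x' \<cdot> a \<and> y' \<cdot> b = c \<cdot> y"
    and realization_zero:
      "biproduct \<C> A C S i\<^sub>1 i\<^sub>2 p\<^sub>1 p\<^sub>2
        \<Longrightarrow> s C A \<zero>\<^bsub>obj_map E C A\<^esub> = seq_class \<C> A C (S, i\<^sub>1, p\<^sub>2)"
    and realization_sum:
      "\<lbrakk>s_triangle \<C> E s A B C x y \<delta>; s_triangle \<C> E s A' B' C' x' y' \<delta>';
        biproduct \<C> A A' SA iA iA' pA pA'; biproduct \<C> B B' SB iB iB' pB pB';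
        biproduct \<C> C C' SC iC iC' pC pC';
        ext_sum E C A \<delta> C' A' \<delta>' SC iC iC' SA pA pA' \<epsilon>\<rbrakk>
        \<Longrightarrow> s SC SA \<epsilon> = seq_class \<C> SA SC
              (SB, (iB \<cdot> x \<cdot> pA) \<oplus>\<^bsub>Hom \<C> SA SB\<^esub> (iB' \<cdot> x' \<cdot> pA'),
                   (iC \<cdot> y \<cdot> pB) \<oplus>\<^bsub>Hom \<C> SB SC\<^esub> (iC' \<cdot> y' \<cdot> pB'))"


section \<open>Extriangulated categories\<close>

locale extriangulated_category = additive_realization R \<C> E s
  for R :: "'r ring" and \<C> :: "('r, 'o, 'm) lin_category" (structure)
    and E :: "('r, 'o, 'm, 'e) bifunctor" and s :: "('o, 'm, 'e) realization" +
  assumes ET3: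
      "\<lbrakk>s_triangle \<C> E s A B C x y \<delta>; s_triangle \<C> E s A' B' C' x' y' \<delta>';
        a \<in> Mor \<C> A A'; b \<in> Mor \<C> B B'; b \<cdot> x = x' \<cdot> a\<rbrakk>
        \<Longrightarrow> \<exists>c\<in>Mor \<C> C C'. c \<cdot> y = y' \<cdot> b \<and> push \<C> E C a \<delta> = pull \<C> E A' c \<delta>'"
    and ET3_op:
      "\<lbrakk>s_triangle \<C> E s A B C x y \<delta>; s_triangle \<C> E s A' B' C' x' y' \<delta>';
        b \<in> Mor \<C> B B'; c \<in> Mor \<C> C C'; c \<cdot> y = y' \<cdot> b\<rbrakk>
        \<Longrightarrow> \<exists>a\<in>Mor \<C> A A'. b \<cdot> x = x' \<cdot> a \<and> push \<C> E C a \<delta> = pull \<C> E A' c \<delta>'"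
    and ET4:
      "\<lbrakk>s_triangle \<C> E s A B D f f' \<delta>; s_triangle \<C> E s B C F g g' \<delta>'\<rbrakk>
        \<Longrightarrow> \<exists>X\<in>Obj \<C>. \<exists>d\<in>Mor \<C> D X. \<exists>e\<in>Mor \<C> X F. \<exists>h'\<in>Mor \<C> C X.
              \<exists>\<delta>''\<in>carrier (obj_map E X A).
                h' \<cdot> g = d \<cdot> f' \<and> e \<cdot> h' = g' \<and>
                s_triangle \<C> E s A C X (g \<cdot> f) h' \<delta>'' \<and>
                s_triangle \<C> E s D X F d e (push \<C> E F f' \<delta>') \<and>
                pull \<C> E A d \<delta>'' = \<delta> \<and> push \<C> E X f \<delta>'' = pull \<C> E B e \<delta>'"
    and ET4_op:
      "\<lbrakk>s_triangle \<C> E s D B A f' f \<delta>; s_triangle \<C> E s F C B g' g \<delta>'\<rbrakk>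
        \<Longrightarrow> \<exists>X\<in>Obj \<C>. \<exists>d\<in>Mor \<C> X D. \<exists>e\<in>Mor \<C> F X. \<exists>h'\<in>Mor \<C> X C.
              \<exists>\<delta>''\<in>carrier (obj_map E A X).
                g \<cdot> h' = f' \<cdot> d \<and> h' \<cdot> e = g' \<and>
                s_triangle \<C> E s X C A h' (f \<cdot> g) \<delta>'' \<and>
                s_triangle \<C> E s F X D e d (pull \<C> E F f' \<delta>') \<and>
                push \<C> E A d \<delta>'' = \<delta> \<and> pull \<C> E X f \<delta>'' = push \<C> E B e \<delta>'"

definition inflation ::
    "('r, 'o, 'm) lin_category \<Rightarrow> ('r, 'o, 'm, 'e) bifunctor \<Rightarrow> ('o, 'm, 'e) realization \<Rightarrow>
     'o \<Rightarrow> 'o \<Rightarrow> 'm \<Rightarrow> bool" where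
  "inflation \<C> E s A B x \<longleftrightarrow> (\<exists>C y \<delta>. s_triangle \<C> E s A B C x y \<delta>)"

definition deflation ::
    "('r, 'o, 'm) lin_category \<Rightarrow> ('r, 'o, 'm, 'e) bifunctor \<Rightarrow> ('o, 'm, 'e) realization \<Rightarrow>
     'o \<Rightarrow> 'o \<Rightarrow> 'm \<Rightarrow> bool" where
  "deflation \<C> E s B C y \<longleftrightarrow> (\<exists>A x \<delta>. s_triangle \<C> E s A B C x y \<delta>)"


section \<open>Relative theories\<close>

definition sub_bifunctor ::
    "'r ring \<Rightarrow> ('r, 'o, 'm) lin_category \<Rightarrow> ('r, 'o, 'm, 'e) bifunctor \<Rightarrow>
     ('o \<Rightarrow> 'o \<Rightarrow> 'e set) \<Rightarrow> bool" where
  "sub_bifunctor R \<C> E H \<longleftrightarrow>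
     (\<forall>C\<in>Obj \<C>. \<forall>A\<in>Obj \<C>. submodule (H C A) R (obj_map E C A)) \<and>
     (\<forall>C\<in>Obj \<C>. \<forall>C'\<in>Obj \<C>. \<forall>A\<in>Obj \<C>. \<forall>A'\<in>Obj \<C>. \<forall>c\<in>Mor \<C> C' C. \<forall>a\<in>Mor \<C> A A'.
        \<forall>\<delta>\<in>H C A. mor_map E c a \<delta> \<in> H C' A')"

definition restrict_bifunctor ::
    "('r, 'o, 'm, 'e) bifunctor \<Rightarrow> ('o \<Rightarrow> 'o \<Rightarrow> 'e set) \<Rightarrow> ('r, 'o, 'm, 'e) bifunctor" where
  "restrict_bifunctor E H =
     \<lparr>obj_map = \<lambda>C A. (obj_map E C A)\<lparr>carrier := H C A\<rparr>, mor_map = mor_map E\<rparr>"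

text \<open>All conditions on a realization concern only extensions in the carriers of the bifunctor, so
  \<open>s\<close> used together with \<open>restrict_bifunctor E H\<close> is the restriction of \<open>s\<close> to \<open>H\<close>.\<close>

definition closed_sub_bifunctor ::
    "'r ring \<Rightarrow> ('r, 'o, 'm) lin_category \<Rightarrow> ('r, 'o, 'm, 'e) bifunctor \<Rightarrow>
     ('o, 'm, 'e) realization \<Rightarrow> ('o \<Rightarrow> 'o \<Rightarrow> 'e set) \<Rightarrow> bool" where
  "closed_sub_bifunctor R \<C> E s H \<longleftrightarrow>
     sub_bifunctor R \<C> E H \<and> extriangulated_category R \<C> (restrict_bifunctor E H) s"


section \<open>Connected sequences of functors\<close>

text \<open>\<open>conn n C A \<delta> X\<close> is the component at \<open>X\<close> of the connecting morphism
  \<open>F\<^sup>n(-, C) \<rightarrow> F\<^sup>n\<^sup>+\<^sup>1(-, A)\<close> of \<open>\<delta> \<in> E(C, A)\<close>.\<close>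

type_synonym ('o, 'e, 'v) connecting = "int \<Rightarrow> 'o \<Rightarrow> 'o \<Rightarrow> 'e \<Rightarrow> 'o \<Rightarrow> 'v \<Rightarrow> 'v"

locale connected_sequence =
  fixes R :: "'r ring" and \<C> :: "('r, 'o, 'm) lin_category" (structure)
    and E :: "('r, 'o, 'm, 'e) bifunctor"
    and F :: "int \<Rightarrow> ('r, 'o, 'm, 'v) bifunctor"
    and conn :: "('o, 'e, 'v) connecting"
  assumes F_bilinear: "bilinear_functor R \<C> (F n)"
    and conn_linear:
      "\<lbrakk>C \<in> Obj \<C>; A \<in> Obj \<C>; X \<in> Obj \<C>; \<delta> \<in> carrier (obj_map E C A)\<rbrakk>
        \<Longrightarrow> linear_map R (obj_map (F n) X C) (obj_map (F (n + 1)) X A) (conn n C A \<delta> X)"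
    and conn_natural:
      "\<lbrakk>C \<in> Obj \<C>; A \<in> Obj \<C>; X \<in> Obj \<C>; Y \<in> Obj \<C>; \<delta> \<in> carrier (obj_map E C A);
        u \<in> Mor \<C> Y X; v \<in> carrier (obj_map (F n) X C)\<rbrakk>
        \<Longrightarrow> conn n C A \<delta> Y (pull \<C> (F n) C u v) = pull \<C> (F (n + 1)) A u (conn n C A \<delta> X v)"
    and conn_ext_morphism:
      "\<lbrakk>C \<in> Obj \<C>; A \<in> Obj \<C>; C' \<in> Obj \<C>; A' \<in> Obj \<C>; X \<in> Obj \<C>;
        \<delta> \<in> carrier (obj_map E C A); \<delta>' \<in> carrier (obj_map E C' A');
        ext_morphism \<C> E C A \<delta> C' A' \<delta>' a c; v \<in> carrier (obj_map (F n) X C)\<rbrakk>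
        \<Longrightarrow> push \<C> (F (n + 1)) X a (conn n C A \<delta> X v) = conn n C' A' \<delta>' X (push \<C> (F n) X c v)"

text \<open>Exactness of the part of the complex
  \<open>\<cdots> \<rightarrow> F\<^sup>n(-, A) \<rightarrow> F\<^sup>n(-, B) \<rightarrow> F\<^sup>n(-, C) \<rightarrow> F\<^sup>n\<^sup>+\<^sup>1(-, A) \<rightarrow> \<cdots>\<close> that involves only degrees in the
  interval \<open>I\<close>, at all terms both of whose neighbours belong to this part. This leaves out exactly
  the end term: \<open>F\<^sup>m\<^sup>+\<^sup>1(-, A)\<close> for \<open>I = {m<..}\<close>, and \<open>F\<^sup>m\<^sup>-\<^sup>1(-, C)\<close> for \<open>I = {..<m}\<close>.\<close>

definition exact_in_degrees ::
    "('r, 'o, 'm) lin_category \<Rightarrow> (int \<Rightarrow> ('r, 'o, 'm, 'v) bifunctor) \<Rightarrow> ('o, 'e, 'v) connecting \<Rightarrow>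
     int set \<Rightarrow> 'o \<Rightarrow> 'o \<Rightarrow> 'o \<Rightarrow> 'm \<Rightarrow> 'm \<Rightarrow> 'e \<Rightarrow> bool" where
  "exact_in_degrees \<C> F conn I A B C x y \<delta> \<longleftrightarrow> (\<forall>X\<in>Obj \<C>. \<forall>n\<in>I.
     push \<C> (F n) X x ` carrier (obj_map (F n) X A) =
       a_kernel (obj_map (F n) X B) (obj_map (F n) X C) (push \<C> (F n) X y) \<and>
     (n + 1 \<in> I \<longrightarrow>
       push \<C> (F n) X y ` carrier (obj_map (F n) X B) =
         a_kernel (obj_map (F n) X C) (obj_map (F (n + 1)) X A) (conn n C A \<delta> X) \<and>
       conn n C A \<delta> X ` carrier (obj_map (F n) X C) =
         a_kernel (obj_map (F (n + 1)) X A) (obj_map (F (n + 1)) X B) (push \<C> (F (n + 1)) X x)))"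

definition acyclic_ext ::
    "('r, 'o, 'm) lin_category \<Rightarrow> ('r, 'o, 'm, 'e) bifunctor \<Rightarrow> ('o, 'm, 'e) realization \<Rightarrow>
     (int \<Rightarrow> ('r, 'o, 'm, 'v) bifunctor) \<Rightarrow> ('o, 'e, 'v) connecting \<Rightarrow> 'o \<Rightarrow> 'o \<Rightarrow> 'e \<Rightarrow> bool" where
  "acyclic_ext \<C> E s F conn C A \<delta> \<longleftrightarrow>
     (\<forall>B x y. s_triangle \<C> E s A B C x y \<delta> \<longrightarrow> exact_in_degrees \<C> F conn UNIV A B C x y \<delta>)"

definition delta_functor ::
    "'r ring \<Rightarrow> ('r, 'o, 'm) lin_category \<Rightarrow> ('r, 'o, 'm, 'e) bifunctor \<Rightarrow>
     ('o, 'm, 'e) realization \<Rightarrow> (int \<Rightarrow> ('r, 'o, 'm, 'v) bifunctor) \<Rightarrow>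
     ('o, 'e, 'v) connecting \<Rightarrow> bool" where
  "delta_functor R \<C> E s F conn \<longleftrightarrow> connected_sequence R \<C> E F conn \<and>
     (\<forall>C\<in>Obj \<C>. \<forall>A\<in>Obj \<C>. \<forall>\<delta>\<in>carrier (obj_map E C A). acyclic_ext \<C> E s F conn C A \<delta>)"

text \<open>That the restriction of \<open>(F, conn)\<close> to the degrees in \<open>I\<close> is a partial \<open>\<delta>\<close>-functor, for
  \<open>(F, conn)\<close> a connected sequence.\<close>

definition partial_delta_functor ::
    "('r, 'o, 'm) lin_category \<Rightarrow> ('r, 'o, 'm, 'e) bifunctor \<Rightarrow> ('o, 'm, 'e) realization \<Rightarrow>
     (int \<Rightarrow> ('r, 'o, 'm, 'v) bifunctor) \<Rightarrow> ('o, 'e, 'v) connecting \<Rightarrow> int set \<Rightarrow> bool" where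
  "partial_delta_functor \<C> E s F conn I \<longleftrightarrow>
     (\<forall>A B C x y \<delta>. s_triangle \<C> E s A B C x y \<delta> \<longrightarrow> exact_in_degrees \<C> F conn I A B C x y \<delta>)"

definition inflation_acyclic ::
    "('r, 'o, 'm) lin_category \<Rightarrow> ('r, 'o, 'm, 'e) bifunctor \<Rightarrow> ('o, 'm, 'e) realization \<Rightarrow>
     (int \<Rightarrow> ('r, 'o, 'm, 'v) bifunctor) \<Rightarrow> ('o, 'e, 'v) connecting \<Rightarrow> 'o \<Rightarrow> 'o \<Rightarrow> 'e set" where
  "inflation_acyclic \<C> E s F conn C A = {\<delta> \<in> carrier (obj_map E C A).
     \<forall>A' x. inflation \<C> E s A A' x \<longrightarrow> acyclic_ext \<C> E s F conn C A' (push \<C> E C x \<delta>)}"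

definition deflation_acyclic ::
    "('r, 'o, 'm) lin_category \<Rightarrow> ('r, 'o, 'm, 'e) bifunctor \<Rightarrow> ('o, 'm, 'e) realization \<Rightarrow>
     (int \<Rightarrow> ('r, 'o, 'm, 'v) bifunctor) \<Rightarrow> ('o, 'e, 'v) connecting \<Rightarrow> 'o \<Rightarrow> 'o \<Rightarrow> 'e set" where
  "deflation_acyclic \<C> E s F conn C A = {\<delta> \<in> carrier (obj_map E C A).
     \<forall>C' y. deflation \<C> E s C' C y \<longrightarrow> acyclic_ext \<C> E s F conn C' A (pull \<C> E A y \<delta>)}"

end

theory Submission
  imports Defs
begin

text \<open>
  Call the acyclic extensions the class \<open>K\<close>. It contains the split extensions, and it satisfies a
  three-out-of-four property: the long sequences of the four triangles of an octahedron form a braid, so if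
  three of the triangles are acyclic then the fourth is acyclic too (\<open>octahedron_exact\<close>). The rest of the
  argument happens inside the extriangulated category and uses only these two properties of \<open>K\<close>.

  Let the core of \<open>K\<close> consist of the extensions all of whose images under \<open>E(c, a)\<close> lie in \<open>K\<close>. Any
  sub-bifunctor contained in \<open>K\<close> is contained in the core, so the core is the only candidate for the
  largest relative theory.

  That the core can be tested on inflations alone, or on deflations alone, follows from homotopy pushouts
  and pullbacks. A pushforward \<open>a\<^sub>* \<delta>\<close>, realized by \<open>D \<rightarrow> X \<rightarrow> C\<close> with deflation \<open>e\<close>, sits in an octahedron
  with a split triangle, with \<open>\<delta>\<close> plus a trivial triangle, and with \<open>A \<rightarrow> B \<oplus> D \<rightarrow> X\<close>, whose extension is
  \<open>e\<^sup>* \<delta>\<close>. So \<open>a\<^sub>* \<delta>\<close> is in \<open>K\<close> if \<open>\<delta>\<close> and its pullbacks along deflations are (\<open>push_mem\<close>), and dually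
  pullbacks are controlled by pushforwards along inflations (\<open>pull_mem\<close>). Since inflations compose, control
  over pushforwards along inflations yields all pullbacks, and these yield all pushforwards.

  The core is closed because it is stable under composition of inflations and of deflations
  (\<open>core_octahedron_composite\<close>, \<open>core_octahedron_quotient\<close>): the pushforward of a composite extension is
  completed to an octahedron by the dual axiom, and the one face that is not visibly in \<open>K\<close> differs from a
  pushforward of a given extension by another pushforward of it. Stability under addition follows from
  stability under composition (\<open>core_add\<close>), as a sum is a pullback of the extension of a suitable composite.
\<close>


section \<open>Exact sequences of abelian groups and the braid\<close>

lemma linear_map_abelian_group_hom:
  assumes "module R M" "module R N" "linear_map R M N f"
  shows "abelian_group_hom M N f"
proof (rule abelian_group_homI)
  show M: "abelian_group M" and N: "abelian_group N"
    using assms(1,2) by (auto dest: module.axioms(2))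
  show "group_hom (add_monoid M) (add_monoid N) f"
    using assms(3) abelian_group.a_group[OF M] abelian_group.a_group[OF N]
    by (simp add: linear_map_def group_hom_def group_hom_axioms_def)
qed

definition exact_pair ::
    "('a, 'x) ring_scheme \<Rightarrow> ('b, 'y) ring_scheme \<Rightarrow> ('d, 'z) ring_scheme \<Rightarrow> ('a \<Rightarrow> 'b) \<Rightarrow> ('b \<Rightarrow> 'd) \<Rightarrow> bool" where
  "exact_pair L M N f g \<longleftrightarrow> f ` carrier L = a_kernel M N g"

lemma exact_pairI:
  assumes "\<And>l. l \<in> carrier L \<Longrightarrow> f l \<in> carrier M"
    and "\<And>l. l \<in> carrier L \<Longrightarrow> g (f l) = \<zero>\<^bsub>N\<^esub>"
    and "\<And>m. m \<in> carrier M \<Longrightarrow> g m = \<zero>\<^bsub>N\<^esub> \<Longrightarrow> \<exists>l\<in>carrier L. m = f l"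
  shows "exact_pair L M N f g"
  using assms unfolding exact_pair_def a_kernel_def' by (auto simp: image_iff)

lemma exact_pair_zero:
  assumes "exact_pair L M N f g" "l \<in> carrier L"
  shows "g (f l) = \<zero>\<^bsub>N\<^esub>"
  using assms unfolding exact_pair_def a_kernel_def' by blast

lemma exact_pair_lift:
  assumes "exact_pair L M N f g" "m \<in> carrier M" "g m = \<zero>\<^bsub>N\<^esub>"
  obtains l where "l \<in> carrier L" "m = f l"
  using assms unfolding exact_pair_def a_kernel_def' by blast

text \<open>Diagram chases subtract two elements with the same image. This form of exactness hides the
  subtraction: two elements with the same image differ by an element that comes from the left.\<close>

lemma exact_pair_fibre:
  assumes ex: "exact_pair L M N f g" and g: "abelian_group_hom M N g"
    and m: "m \<in> carrier M" "m' \<in> carrier M" and eq: "g m = g m'"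
    and f: "\<And>l. l \<in> carrier L \<Longrightarrow> f l \<in> carrier M"
  obtains l where "l \<in> carrier L" "m = m' \<oplus>\<^bsub>M\<^esub> f l"
proof -
  interpret abelian_group_hom M N g by (fact g)
  have "g (m \<ominus>\<^bsub>M\<^esub> m') = \<zero>\<^bsub>N\<^esub>"
    using m eq by (simp add: G.minus_eq H.r_neg)
  then obtain l where l: "l \<in> carrier L" "m \<ominus>\<^bsub>M\<^esub> m' = f l"
    using exact_pair_lift[OF ex] m by blast
  have "m = m' \<oplus>\<^bsub>M\<^esub> (m \<ominus>\<^bsub>M\<^esub> m')"
    using m by (simp add: G.minus_eq G.a_lcomm[of m'] G.r_neg)
  then show thesis using that l by metis
qed

text \<open>The next three lemmas are the braid lemma of Wall. A braid consists of groups
  \<open>Q\<^sub>i\<close>, \<open>P\<^sub>i\<close>, \<open>S\<^sub>i\<close> with maps \<open>p\<^sub>i: P\<^sub>i \<rightarrow> Q\<^sub>i\<close>, \<open>t\<^sub>i: S\<^sub>i \<rightarrow> Q\<^sub>i\<close>,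
  \<open>q\<^sub>i: Q\<^sub>i \<rightarrow> P\<^sub>i\<^sub>+\<^sub>1\<close>, \<open>r\<^sub>i: Q\<^sub>i \<rightarrow> S\<^sub>i\<^sub>+\<^sub>1\<close> such that the two ways from \<open>Q\<^sub>i\<close> to
  \<open>Q\<^sub>i\<^sub>+\<^sub>1\<close> agree. Four sequences run through it; each of them crosses every second \<open>Q\<^sub>i\<close>
  straight, as \<open>P\<^sub>i \<rightarrow> Q\<^sub>i \<rightarrow> P\<^sub>i\<^sub>+\<^sub>1\<close> or \<open>S\<^sub>i \<rightarrow> Q\<^sub>i \<rightarrow> S\<^sub>i\<^sub>+\<^sub>1\<close>, and changes sides at the others
  by a composite \<open>P\<^sub>i \<rightarrow> Q\<^sub>i \<rightarrow> S\<^sub>i\<^sub>+\<^sub>1\<close> or \<open>S\<^sub>i \<rightarrow> Q\<^sub>i \<rightarrow> P\<^sub>i\<^sub>+\<^sub>1\<close>. If three of the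
  sequences are exact, so is the fourth when it is a complex. Exactness has to be checked at
  three kinds of terms: a straight crossing, and the start and the end of a composite. Because the
  diagram is symmetric under exchanging \<open>P\<close> with \<open>S\<close> and under shifts, one chase for
  each kind of term suffices.\<close>

lemma braid_exact_at_crossing:
  assumes hom: "abelian_group_hom Q\<^sub>0 S\<^sub>1 r\<^sub>0" "abelian_group_hom S\<^sub>1 Q\<^sub>1 t\<^sub>1"
      "abelian_group_hom Q\<^sub>0 P\<^sub>1 q\<^sub>0" "abelian_group_hom P\<^sub>1 Q\<^sub>1 p\<^sub>1"
      "abelian_group_hom Q\<^sub>1 P\<^sub>2 q\<^sub>1" "abelian_group_hom Q\<^sub>1 S\<^sub>2 r\<^sub>1" 
      "abelian_group_hom P\<^sub>2 Q\<^sub>2 p\<^sub>2" "abelian_group_hom S\<^sub>2 Q\<^sub>2 t\<^sub>2"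
    and square: "\<And>v. v \<in> carrier Q\<^sub>0 \<Longrightarrow> p\<^sub>1 (q\<^sub>0 v) = t\<^sub>1 (r\<^sub>0 v)"
      "\<And>v. v \<in> carrier Q\<^sub>1 \<Longrightarrow> p\<^sub>2 (q\<^sub>1 v) = t\<^sub>2 (r\<^sub>1 v)"
    and comp: "\<And>v. v \<in> carrier P\<^sub>1 \<Longrightarrow> rp v = r\<^sub>1 (p\<^sub>1 v)"
      "\<And>v. v \<in> carrier S\<^sub>1 \<Longrightarrow> qt v = q\<^sub>1 (t\<^sub>1 v)"
    and complex: "\<And>v. v \<in> carrier P\<^sub>1 \<Longrightarrow> q\<^sub>1 (p\<^sub>1 v) = \<zero>\<^bsub>P\<^sub>2\<^esub>"
    and ex: "exact_pair P\<^sub>1 S\<^sub>2 Q\<^sub>2 rp t\<^sub>2" "exact_pair S\<^sub>1 Q\<^sub>1 S\<^sub>2 t\<^sub>1 r\<^sub>1"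
      "exact_pair Q\<^sub>0 S\<^sub>1 P\<^sub>2 r\<^sub>0 qt"
  shows "exact_pair P\<^sub>1 Q\<^sub>1 P\<^sub>2 p\<^sub>1 q\<^sub>1"
proof (rule exact_pairI)
  interpret r0: abelian_group_hom Q\<^sub>0 S\<^sub>1 r\<^sub>0 by fact
  interpret t1: abelian_group_hom S\<^sub>1 Q\<^sub>1 t\<^sub>1 by fact
  interpret q0: abelian_group_hom Q\<^sub>0 P\<^sub>1 q\<^sub>0 by fact
  interpret p1: abelian_group_hom P\<^sub>1 Q\<^sub>1 p\<^sub>1 by fact
  interpret q1: abelian_group_hom Q\<^sub>1 P\<^sub>2 q\<^sub>1 by fact
  interpret r1: abelian_group_hom Q\<^sub>1 S\<^sub>2 r\<^sub>1 by fact
  interpret p2: abelian_group_hom P\<^sub>2 Q\<^sub>2 p\<^sub>2 by fact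
  show "p\<^sub>1 v \<in> carrier Q\<^sub>1" if "v \<in> carrier P\<^sub>1" for v using that by simp
  show "q\<^sub>1 (p\<^sub>1 v) = \<zero>\<^bsub>P\<^sub>2\<^esub>" if "v \<in> carrier P\<^sub>1" for v using that by (rule complex)
  fix u assume u: "u \<in> carrier Q\<^sub>1" and qu: "q\<^sub>1 u = \<zero>\<^bsub>P\<^sub>2\<^esub>"
  have "t\<^sub>2 (r\<^sub>1 u) = \<zero>\<^bsub>Q\<^sub>2\<^esub>" using square(2)[OF u] qu by simp
  then obtain z where z: "z \<in> carrier P\<^sub>1" "r\<^sub>1 u = r\<^sub>1 (p\<^sub>1 z)"
    using exact_pair_lift[OF ex(1)] u comp by (metis r1.hom_closed)
  obtain y where y: "y \<in> carrier S\<^sub>1" "u = p\<^sub>1 z \<oplus>\<^bsub>Q\<^sub>1\<^esub> t\<^sub>1 y"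
    using exact_pair_fibre[OF ex(2) r1.is_abelian_group_hom u _ z(2)] z(1) by auto
  have "qt y = \<zero>\<^bsub>P\<^sub>2\<^esub>" using y z qu complex comp(2) by simp
  then obtain w where w: "w \<in> carrier Q\<^sub>0" "y = r\<^sub>0 w"
    using exact_pair_lift[OF ex(3)] y by blast
  have "u = p\<^sub>1 z \<oplus>\<^bsub>Q\<^sub>1\<^esub> p\<^sub>1 (q\<^sub>0 w)" using y(2) unfolding w(2) square(1)[OF w(1)] .
  then have "u = p\<^sub>1 (z \<oplus>\<^bsub>P\<^sub>1\<^esub> q\<^sub>0 w)" using w(1) z(1) by (simp only: p1.hom_add q0.hom_closed)
  moreover have "z \<oplus>\<^bsub>P\<^sub>1\<^esub> q\<^sub>0 w \<in> carrier P\<^sub>1" using z(1) w(1) by simp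
  ultimately show "\<exists>l\<in>carrier P\<^sub>1. u = p\<^sub>1 l" by (rule bexI)
qed

lemma braid_exact_before_composite:
  assumes hom: "abelian_group_hom S\<^sub>0 Q\<^sub>0 t\<^sub>0" "abelian_group_hom Q\<^sub>0 P\<^sub>1 q\<^sub>0"
      "abelian_group_hom Q\<^sub>0 S\<^sub>1 r\<^sub>0" "abelian_group_hom P\<^sub>1 Q\<^sub>1 p\<^sub>1" "abelian_group_hom S\<^sub>1 Q\<^sub>1 t\<^sub>1"
      "abelian_group_hom Q\<^sub>1 P\<^sub>2 q\<^sub>1" "abelian_group_hom Q\<^sub>1 S\<^sub>2 r\<^sub>1"
    and square: "\<And>v. v \<in> carrier Q\<^sub>0 \<Longrightarrow> p\<^sub>1 (q\<^sub>0 v) = t\<^sub>1 (r\<^sub>0 v)"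
    and comp: "\<And>v. v \<in> carrier P\<^sub>1 \<Longrightarrow> rp v = r\<^sub>1 (p\<^sub>1 v)"
      "\<And>v. v \<in> carrier S\<^sub>1 \<Longrightarrow> qt v = q\<^sub>1 (t\<^sub>1 v)"
      "\<And>v. v \<in> carrier S\<^sub>0 \<Longrightarrow> qt' v = q\<^sub>0 (t\<^sub>0 v)"
    and complex: "\<And>v. v \<in> carrier P\<^sub>1 \<Longrightarrow> q\<^sub>1 (p\<^sub>1 v) = \<zero>\<^bsub>P\<^sub>2\<^esub>"
    and ex: "exact_pair S\<^sub>1 Q\<^sub>1 S\<^sub>2 t\<^sub>1 r\<^sub>1" "exact_pair Q\<^sub>0 S\<^sub>1 P\<^sub>2 r\<^sub>0 qt"
      "exact_pair S\<^sub>0 P\<^sub>1 Q\<^sub>1 qt' p\<^sub>1"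
  shows "exact_pair Q\<^sub>0 P\<^sub>1 S\<^sub>2 q\<^sub>0 rp"
proof (rule exact_pairI)
  interpret t0: abelian_group_hom S\<^sub>0 Q\<^sub>0 t\<^sub>0 by fact
  interpret q0: abelian_group_hom Q\<^sub>0 P\<^sub>1 q\<^sub>0 by fact
  interpret r0: abelian_group_hom Q\<^sub>0 S\<^sub>1 r\<^sub>0 by fact
  interpret p1: abelian_group_hom P\<^sub>1 Q\<^sub>1 p\<^sub>1 by fact
  show "q\<^sub>0 v \<in> carrier P\<^sub>1" if "v \<in> carrier Q\<^sub>0" for v using that by simp
  show "rp (q\<^sub>0 v) = \<zero>\<^bsub>S\<^sub>2\<^esub>" if "v \<in> carrier Q\<^sub>0" for v
    using that comp(1) square exact_pair_zero[OF ex(1)] by simp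
  fix w assume w: "w \<in> carrier P\<^sub>1" and rw: "rp w = \<zero>\<^bsub>S\<^sub>2\<^esub>"
  obtain y where y: "y \<in> carrier S\<^sub>1" "p\<^sub>1 w = t\<^sub>1 y"
    using exact_pair_lift[OF ex(1)] w rw comp(1) by (metis p1.hom_closed)
  have "qt y = \<zero>\<^bsub>P\<^sub>2\<^esub>" using y w complex comp(2) by metis
  then obtain u where u: "u \<in> carrier Q\<^sub>0" "y = r\<^sub>0 u"
    using exact_pair_lift[OF ex(2)] y by blast
  have eq: "p\<^sub>1 w = p\<^sub>1 (q\<^sub>0 u)" using y u square by simp
  obtain z where z: "z \<in> carrier S\<^sub>0" "w = q\<^sub>0 u \<oplus>\<^bsub>P\<^sub>1\<^esub> qt' z"
    using exact_pair_fibre[OF ex(3) p1.is_abelian_group_hom w _ eq] u comp(3) by auto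
  have "w = q\<^sub>0 (u \<oplus>\<^bsub>Q\<^sub>0\<^esub> t\<^sub>0 z)" using z u comp(3) by simp
  moreover have "u \<oplus>\<^bsub>Q\<^sub>0\<^esub> t\<^sub>0 z \<in> carrier Q\<^sub>0" using u(1) z(1) by simp
  ultimately show "\<exists>l\<in>carrier Q\<^sub>0. w = q\<^sub>0 l" by (rule bexI)
qed

lemma braid_exact_after_composite:
  assumes hom: "abelian_group_hom P\<^sub>1 Q\<^sub>1 p\<^sub>1" "abelian_group_hom S\<^sub>1 Q\<^sub>1 t\<^sub>1"
      "abelian_group_hom Q\<^sub>1 P\<^sub>2 q\<^sub>1" "abelian_group_hom Q\<^sub>1 S\<^sub>2 r\<^sub>1"
      "abelian_group_hom P\<^sub>2 Q\<^sub>2 p\<^sub>2" "abelian_group_hom S\<^sub>2 Q\<^sub>2 t\<^sub>2" "abelian_group_hom Q\<^sub>2 P\<^sub>3 q\<^sub>2"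
    and square: "\<And>v. v \<in> carrier Q\<^sub>1 \<Longrightarrow> p\<^sub>2 (q\<^sub>1 v) = t\<^sub>2 (r\<^sub>1 v)"
    and comp: "\<And>v. v \<in> carrier P\<^sub>1 \<Longrightarrow> rp v = r\<^sub>1 (p\<^sub>1 v)"
      "\<And>v. v \<in> carrier S\<^sub>1 \<Longrightarrow> qt v = q\<^sub>1 (t\<^sub>1 v)"
      "\<And>v. v \<in> carrier S\<^sub>2 \<Longrightarrow> qt' v = q\<^sub>2 (t\<^sub>2 v)"
    and complex: "\<And>v. v \<in> carrier S\<^sub>1 \<Longrightarrow> r\<^sub>1 (t\<^sub>1 v) = \<zero>\<^bsub>S\<^sub>2\<^esub>"
    and ex: "exact_pair Q\<^sub>1 S\<^sub>2 P\<^sub>3 r\<^sub>1 qt'" "exact_pair S\<^sub>1 P\<^sub>2 Q\<^sub>2 qt p\<^sub>2"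
      "exact_pair P\<^sub>1 Q\<^sub>1 P\<^sub>2 p\<^sub>1 q\<^sub>1"
  shows "exact_pair P\<^sub>1 S\<^sub>2 Q\<^sub>2 rp t\<^sub>2"
proof (rule exact_pairI)
  interpret p1: abelian_group_hom P\<^sub>1 Q\<^sub>1 p\<^sub>1 by fact
  interpret t1: abelian_group_hom S\<^sub>1 Q\<^sub>1 t\<^sub>1 by fact
  interpret q1: abelian_group_hom Q\<^sub>1 P\<^sub>2 q\<^sub>1 by fact
  interpret r1: abelian_group_hom Q\<^sub>1 S\<^sub>2 r\<^sub>1 by fact
  interpret p2: abelian_group_hom P\<^sub>2 Q\<^sub>2 p\<^sub>2 by fact
  interpret q2: abelian_group_hom Q\<^sub>2 P\<^sub>3 q\<^sub>2 by fact
  show "rp v \<in> carrier S\<^sub>2" if "v \<in> carrier P\<^sub>1" for v using that comp by simp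
  show "t\<^sub>2 (rp v) = \<zero>\<^bsub>Q\<^sub>2\<^esub>" if "v \<in> carrier P\<^sub>1" for v
    using that comp square[symmetric] exact_pair_zero[OF ex(3)] by simp
  fix v assume v: "v \<in> carrier S\<^sub>2" and tv: "t\<^sub>2 v = \<zero>\<^bsub>Q\<^sub>2\<^esub>"
  have "qt' v = \<zero>\<^bsub>P\<^sub>3\<^esub>" using v tv comp(3) by simp
  then obtain u where u: "u \<in> carrier Q\<^sub>1" "v = r\<^sub>1 u"
    using exact_pair_lift[OF ex(1)] v by blast
  have "p\<^sub>2 (q\<^sub>1 u) = \<zero>\<^bsub>Q\<^sub>2\<^esub>" using u tv square by simp
  then obtain z where z: "z \<in> carrier S\<^sub>1" "q\<^sub>1 u = q\<^sub>1 (t\<^sub>1 z)"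
    using exact_pair_lift[OF ex(2)] u comp(2) by (metis q1.hom_closed)
  obtain w where w: "w \<in> carrier P\<^sub>1" "u = t\<^sub>1 z \<oplus>\<^bsub>Q\<^sub>1\<^esub> p\<^sub>1 w"
    using exact_pair_fibre[OF ex(3) q1.is_abelian_group_hom u(1) _ z(2)] z(1) by auto
  have "v = rp w" using u w z complex comp(1) by simp
  then show "\<exists>l\<in>carrier P\<^sub>1. v = rp l" using w by blast
qed


section \<open>Arrows and biproducts\<close>

context linear_category
begin

text \<open>Membership in \<open>Mor \<C> A B\<close> is meaningful only for objects \<open>A\<close> and \<open>B\<close>; bundling the
  three conditions lets composability alone carry all side conditions.\<close>

definition arr :: "'m \<Rightarrow> 'o \<Rightarrow> 'o \<Rightarrow> bool" where
  "arr f A B \<longleftrightarrow> A \<in> Obj \<C> \<and> B \<in> Obj \<C> \<and> f \<in> Mor \<C> A B"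

lemma arrI: "A \<in> Obj \<C> \<Longrightarrow> B \<in> Obj \<C> \<Longrightarrow> f \<in> Mor \<C> A B \<Longrightarrow> arr f A B"
  by (simp add: arr_def)

lemma arr_obj: "arr f A B \<Longrightarrow> A \<in> Obj \<C>" "arr f A B \<Longrightarrow> B \<in> Obj \<C>"
  and arr_mor: "arr f A B \<Longrightarrow> f \<in> Mor \<C> A B"
  by (simp_all add: arr_def)

lemma arr_ident: "A \<in> Obj \<C> \<Longrightarrow> arr (ident \<C> A) A A"
  by (simp add: arr_def ident_closed)

lemma arr_comp: "arr g B D \<Longrightarrow> arr f A B \<Longrightarrow> arr (g \<cdot> f) A D"
  unfolding arr_def using comp_closed by blast

lemma assoc: "arr h D D' \<Longrightarrow> arr g B D \<Longrightarrow> arr f A B \<Longrightarrow> (h \<cdot> g) \<cdot> f = h \<cdot> (g \<cdot> f)"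
  unfolding arr_def using comp_assoc by blast

lemma ident_right: "arr f A B \<Longrightarrow> f \<cdot> ident \<C> A = f"
  and ident_left: "arr f A B \<Longrightarrow> ident \<C> B \<cdot> f = f"
  unfolding arr_def using comp_ident_right comp_ident_left by blast+

lemma Hom_abelian_group: "A \<in> Obj \<C> \<Longrightarrow> B \<in> Obj \<C> \<Longrightarrow> abelian_group (Hom \<C> A B)"
  using Hom_module module.axioms(2) by blast

lemma arr_zero: "A \<in> Obj \<C> \<Longrightarrow> B \<in> Obj \<C> \<Longrightarrow> arr \<zero>\<^bsub>Hom \<C> A B\<^esub> A B"
  by (simp add: arr_def abelian_monoid.zero_closed[OF abelian_group.axioms(1)[OF Hom_abelian_group]])

lemma arr_add: "arr f A B \<Longrightarrow> arr g A B \<Longrightarrow> arr (f \<oplus>\<^bsub>Hom \<C> A B\<^esub> g) A B"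
  by (simp add: arr_def abelian_monoid.a_closed[OF abelian_group.axioms(1)[OF Hom_abelian_group]])

lemma arr_neg: "arr f A B \<Longrightarrow> arr (\<ominus>\<^bsub>Hom \<C> A B\<^esub> f) A B"
  by (simp add: arr_def abelian_group.a_inv_closed[OF Hom_abelian_group])

lemma hom_comp_left:
  "arr f A B \<Longrightarrow> D \<in> Obj \<C> \<Longrightarrow> abelian_group_hom (Hom \<C> B D) (Hom \<C> A D) (\<lambda>g. g \<cdot> f)"
  unfolding arr_def
  by (blast intro: linear_map_abelian_group_hom Hom_module comp_linear_left)

lemma hom_comp_right:
  "arr g B D \<Longrightarrow> A \<in> Obj \<C> \<Longrightarrow> abelian_group_hom (Hom \<C> A B) (Hom \<C> A D) (\<lambda>f. g \<cdot> f)"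
  unfolding arr_def
  by (blast intro: linear_map_abelian_group_hom Hom_module comp_linear_right)

lemma comp_add_left:
  "arr g B D \<Longrightarrow> arr h B D \<Longrightarrow> arr f A B
    \<Longrightarrow> (g \<oplus>\<^bsub>Hom \<C> B D\<^esub> h) \<cdot> f = g \<cdot> f \<oplus>\<^bsub>Hom \<C> A D\<^esub> h \<cdot> f"
  by (rule abelian_group_hom.hom_add[OF hom_comp_left]) (simp_all add: arr_def)

lemma comp_add_right:
  "arr g B D \<Longrightarrow> arr f A B \<Longrightarrow> arr h A B
    \<Longrightarrow> g \<cdot> (f \<oplus>\<^bsub>Hom \<C> A B\<^esub> h) = g \<cdot> f \<oplus>\<^bsub>Hom \<C> A D\<^esub> g \<cdot> h"
  by (rule abelian_group_hom.hom_add[OF hom_comp_right]) (simp_all add: arr_def)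

lemma comp_zero_left: "arr f A B \<Longrightarrow> D \<in> Obj \<C> \<Longrightarrow> \<zero>\<^bsub>Hom \<C> B D\<^esub> \<cdot> f = \<zero>\<^bsub>Hom \<C> A D\<^esub>"
  using abelian_group_hom.hom_zero[OF hom_comp_left] by blast

lemma comp_zero_right: "arr g B D \<Longrightarrow> A \<in> Obj \<C> \<Longrightarrow> g \<cdot> \<zero>\<^bsub>Hom \<C> A B\<^esub> = \<zero>\<^bsub>Hom \<C> A D\<^esub>"
  using abelian_group_hom.hom_zero[OF hom_comp_right] by blast

lemma neg_neg: "arr f A B \<Longrightarrow> \<ominus>\<^bsub>Hom \<C> A B\<^esub> (\<ominus>\<^bsub>Hom \<C> A B\<^esub> f) = f"
  by (simp add: arr_def abelian_group.minus_minus[OF Hom_abelian_group])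

lemma add_zero:
  "arr f A B \<Longrightarrow> f \<oplus>\<^bsub>Hom \<C> A B\<^esub> \<zero>\<^bsub>Hom \<C> A B\<^esub> = f"
  "arr f A B \<Longrightarrow> \<zero>\<^bsub>Hom \<C> A B\<^esub> \<oplus>\<^bsub>Hom \<C> A B\<^esub> f = f"
  by (simp_all add: arr_def abelian_monoid.r_zero[OF abelian_group.axioms(1)[OF Hom_abelian_group]]
      abelian_monoid.l_zero[OF abelian_group.axioms(1)[OF Hom_abelian_group]])

lemma biproduct_arr:
  assumes "biproduct \<C> A B S i\<^sub>1 i\<^sub>2 p\<^sub>1 p\<^sub>2"
  shows "arr i\<^sub>1 A S" "arr i\<^sub>2 B S" "arr p\<^sub>1 S A" "arr p\<^sub>2 S B"
  using assms by (simp_all add: biproduct_def arr_def)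

lemma biproduct_swap:
  assumes "biproduct \<C> A B S i\<^sub>1 i\<^sub>2 p\<^sub>1 p\<^sub>2"
  shows "biproduct \<C> B A S i\<^sub>2 i\<^sub>1 p\<^sub>2 p\<^sub>1"
proof -
  note a = biproduct_arr[OF assms]
  have "(i\<^sub>2 \<cdot> p\<^sub>2) \<oplus>\<^bsub>Hom \<C> S S\<^esub> (i\<^sub>1 \<cdot> p\<^sub>1) = (i\<^sub>1 \<cdot> p\<^sub>1) \<oplus>\<^bsub>Hom \<C> S S\<^esub> (i\<^sub>2 \<cdot> p\<^sub>2)"
    using arr_comp[OF a(1,3)] arr_comp[OF a(2,4)]
      abelian_monoid.a_comm[OF abelian_group.axioms(1)[OF Hom_abelian_group]]
    by (simp add: arr_def)
  then show ?thesis using assms by (simp add: biproduct_def)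
qed

text \<open>The automorphism of \<open>A \<oplus> B\<close> with off-diagonal entry \<open>a\<close> carries one
  decomposition into another. It makes the graph of \<open>\<ominus> a\<close> a split monomorphism whose
  retraction is the old projection to \<open>A\<close> and whose cokernel map \<open>p\<close> restricts to \<open>a\<close> on
  the old copy of \<open>A\<close>.\<close>

lemma biproduct_shear:
  assumes bip: "biproduct \<C> A B S i\<^sub>1 i\<^sub>2 p\<^sub>1 p\<^sub>2" and a: "arr a A B"
  obtains i p where "biproduct \<C> A B S i i\<^sub>2 p\<^sub>1 p" "p\<^sub>2 \<cdot> i = \<ominus>\<^bsub>Hom \<C> A B\<^esub> a" "p \<cdot> i\<^sub>1 = a"
proof -
  define a' where "a' = \<ominus>\<^bsub>Hom \<C> A B\<^esub> a"
  note arrs = biproduct_arr[OF bip] and eqs = bip[unfolded biproduct_def]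
  note obj = arr_obj[OF a] arr_obj(2)[OF arrs(1)]
  have a': "arr a' A B" using arr_neg[OF a] by (simp add: a'_def)
  note c = arr_comp[OF arrs(2) a'] arr_comp[OF a arrs(3)]
  interpret SS: abelian_group "Hom \<C> S S" using Hom_abelian_group obj by blast
  interpret AB: abelian_group "Hom \<C> A B" using Hom_abelian_group obj by blast
  have neg: "a' \<oplus>\<^bsub>Hom \<C> A B\<^esub> a = \<zero>\<^bsub>Hom \<C> A B\<^esub>"
    using a by (simp add: a'_def AB.l_neg arr_def)
  have 1: "p\<^sub>1 \<cdot> (i\<^sub>1 \<oplus>\<^bsub>Hom \<C> A S\<^esub> i\<^sub>2 \<cdot> a') = ident \<C> A"
    using comp_add_right[OF arrs(3,1) c(1)] assoc[OF arrs(3,2) a'] comp_zero_left[OF a' obj(1)]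
      add_zero(1)[OF arr_ident[OF obj(1)]] eqs
    by simp
  have 2: "(p\<^sub>2 \<oplus>\<^bsub>Hom \<C> S B\<^esub> a \<cdot> p\<^sub>1) \<cdot> i\<^sub>2 = ident \<C> B"
    using comp_add_left[OF arrs(4) c(2) arrs(2)] assoc[OF a arrs(3,2)] comp_zero_right[OF a obj(2)]
      add_zero(1)[OF arr_ident[OF obj(2)]] eqs
    by simp
  have p2: "p\<^sub>2 \<cdot> (i\<^sub>1 \<oplus>\<^bsub>Hom \<C> A S\<^esub> i\<^sub>2 \<cdot> a') = a'"
    using comp_add_right[OF arrs(4,1) c(1)] assoc[OF arrs(4,2) a'] ident_left[OF a']
      add_zero(2)[OF a'] eqs
    by simp
  have 3: "(p\<^sub>2 \<oplus>\<^bsub>Hom \<C> S B\<^esub> a \<cdot> p\<^sub>1) \<cdot> (i\<^sub>1 \<oplus>\<^bsub>Hom \<C> A S\<^esub> i\<^sub>2 \<cdot> a') = \<zero>\<^bsub>Hom \<C> A B\<^esub>"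
    using comp_add_left[OF arrs(4) c(2) arr_add[OF arrs(1) c(1)]]
      assoc[OF a arrs(3) arr_add[OF arrs(1) c(1)]] 1 p2 ident_right[OF a] neg
    by simp
  have 4: "i\<^sub>2 \<cdot> (p\<^sub>2 \<oplus>\<^bsub>Hom \<C> S B\<^esub> a \<cdot> p\<^sub>1) = i\<^sub>2 \<cdot> p\<^sub>2 \<oplus>\<^bsub>Hom \<C> S S\<^esub> (i\<^sub>2 \<cdot> a) \<cdot> p\<^sub>1"
    using comp_add_right[OF arrs(2,4) c(2)] assoc[OF arrs(2) a arrs(3)] by simp
  have 5: "(i\<^sub>1 \<oplus>\<^bsub>Hom \<C> A S\<^esub> i\<^sub>2 \<cdot> a') \<cdot> p\<^sub>1 = i\<^sub>1 \<cdot> p\<^sub>1 \<oplus>\<^bsub>Hom \<C> S S\<^esub> (i\<^sub>2 \<cdot> a') \<cdot> p\<^sub>1"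
    using comp_add_left[OF arrs(1) c(1) arrs(3)] by simp
  have 6: "(i\<^sub>2 \<cdot> a') \<cdot> p\<^sub>1 \<oplus>\<^bsub>Hom \<C> S S\<^esub> (i\<^sub>2 \<cdot> a) \<cdot> p\<^sub>1 = \<zero>\<^bsub>Hom \<C> S S\<^esub>"
    using comp_add_left[OF c(1) arr_comp[OF arrs(2) a] arrs(3), symmetric]
      comp_add_right[OF arrs(2) a' a, symmetric] neg comp_zero_right[OF arrs(2) obj(1)]
      comp_zero_left[OF arrs(3) obj(3)]
    by simp
  have carr: "i\<^sub>1 \<cdot> p\<^sub>1 \<in> carrier (Hom \<C> S S)" "i\<^sub>2 \<cdot> p\<^sub>2 \<in> carrier (Hom \<C> S S)"
    "(i\<^sub>2 \<cdot> a) \<cdot> p\<^sub>1 \<in> carrier (Hom \<C> S S)" "(i\<^sub>2 \<cdot> a') \<cdot> p\<^sub>1 \<in> carrier (Hom \<C> S S)"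
    using arr_mor arr_comp arrs a a' c by blast+
  have 7: "((i\<^sub>1 \<oplus>\<^bsub>Hom \<C> A S\<^esub> i\<^sub>2 \<cdot> a') \<cdot> p\<^sub>1) \<oplus>\<^bsub>Hom \<C> S S\<^esub> (i\<^sub>2 \<cdot> (p\<^sub>2 \<oplus>\<^bsub>Hom \<C> S B\<^esub> a \<cdot> p\<^sub>1)) = ident \<C> S"
  proof -
    have "((i\<^sub>1 \<oplus>\<^bsub>Hom \<C> A S\<^esub> i\<^sub>2 \<cdot> a') \<cdot> p\<^sub>1) \<oplus>\<^bsub>Hom \<C> S S\<^esub> (i\<^sub>2 \<cdot> (p\<^sub>2 \<oplus>\<^bsub>Hom \<C> S B\<^esub> a \<cdot> p\<^sub>1))
        = (i\<^sub>1 \<cdot> p\<^sub>1 \<oplus>\<^bsub>Hom \<C> S S\<^esub> i\<^sub>2 \<cdot> p\<^sub>2)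
          \<oplus>\<^bsub>Hom \<C> S S\<^esub> ((i\<^sub>2 \<cdot> a') \<cdot> p\<^sub>1 \<oplus>\<^bsub>Hom \<C> S S\<^esub> (i\<^sub>2 \<cdot> a) \<cdot> p\<^sub>1)"
      unfolding 4 5 using carr by (simp add: SS.a_ac)
    then show ?thesis unfolding 6 using eqs add_zero(1)[OF arr_ident[OF obj(3)]] by simp
  qed
  have "arr (i\<^sub>1 \<oplus>\<^bsub>Hom \<C> A S\<^esub> i\<^sub>2 \<cdot> a') A S" "arr (p\<^sub>2 \<oplus>\<^bsub>Hom \<C> S B\<^esub> a \<cdot> p\<^sub>1) S B"
    using arr_add arrs c by blast+
  then have "biproduct \<C> A B S (i\<^sub>1 \<oplus>\<^bsub>Hom \<C> A S\<^esub> i\<^sub>2 \<cdot> a') i\<^sub>2 p\<^sub>1 (p\<^sub>2 \<oplus>\<^bsub>Hom \<C> S B\<^esub> a \<cdot> p\<^sub>1)"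
    unfolding biproduct_def using eqs 1 2 3 7 arrs by (simp add: arr_def)
  moreover have "(p\<^sub>2 \<oplus>\<^bsub>Hom \<C> S B\<^esub> a \<cdot> p\<^sub>1) \<cdot> i\<^sub>1 = a"
    using comp_add_left[OF arrs(4) c(2) arrs(1)] assoc[OF a arrs(3,1)] ident_right[OF a]
      add_zero(2)[OF a] eqs
    by simp
  ultimately show thesis using p2 that by (simp add: a'_def)
qed

end


section \<open>Pushforward and pullback\<close>

context bilinear_functor
begin

definition el :: "'v \<Rightarrow> 'o \<Rightarrow> 'o \<Rightarrow> bool" where
  "el v C A \<longleftrightarrow> C \<in> Obj \<C> \<and> A \<in> Obj \<C> \<and> v \<in> carrier (obj_map G C A)"

lemma elI: "C \<in> Obj \<C> \<Longrightarrow> A \<in> Obj \<C> \<Longrightarrow> v \<in> carrier (obj_map G C A) \<Longrightarrow> el v C A"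
  by (simp add: el_def)

lemma el_obj: "el v C A \<Longrightarrow> C \<in> Obj \<C>" "el v C A \<Longrightarrow> A \<in> Obj \<C>"
  and el_carrier: "el v C A \<Longrightarrow> v \<in> carrier (obj_map G C A)"
  by (simp_all add: el_def)

lemma obj_abelian_group: "C \<in> Obj \<C> \<Longrightarrow> A \<in> Obj \<C> \<Longrightarrow> abelian_group (obj_map G C A)"
  using obj_module module.axioms(2) by blast

lemma hom_mor:
  assumes "arr c C' C" "arr a A A'"
  shows "abelian_group_hom (obj_map G C A) (obj_map G C' A') (mor_map G c a)"
  using assms unfolding arr_def by (blast intro: linear_map_abelian_group_hom obj_module mor_linear)

lemma hom_push:
  assumes "arr a A A'" "C \<in> Obj \<C>"
  shows "abelian_group_hom (obj_map G C A) (obj_map G C A') (push \<C> G C a)"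
  unfolding push_def by (rule hom_mor[OF arr_ident[OF assms(2)] assms(1)])

lemma hom_pull:
  assumes "arr c C' C" "A \<in> Obj \<C>"
  shows "abelian_group_hom (obj_map G C A) (obj_map G C' A) (pull \<C> G A c)"
  unfolding pull_def by (rule hom_mor[OF assms(1) arr_ident[OF assms(2)]])

lemma el_mor: "el v C A \<Longrightarrow> arr c C' C \<Longrightarrow> arr a A A' \<Longrightarrow> el (mor_map G c a v) C' A'"
  using abelian_group_hom.hom_closed[OF hom_mor, of c C' C a A A' v] by (simp add: el_def arr_def)

lemma el_push: "el v C A \<Longrightarrow> arr a A A' \<Longrightarrow> el (push \<C> G C a v) C A'"
  unfolding push_def using el_mor arr_ident el_obj by blast

lemma el_pull: "el v C A \<Longrightarrow> arr c C' C \<Longrightarrow> el (pull \<C> G A c v) C' A"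
  unfolding pull_def using el_mor arr_ident el_obj by blast

lemma mor_mor:
  "el v C A \<Longrightarrow> arr c C' C \<Longrightarrow> arr a A A' \<Longrightarrow> arr c' C'' C' \<Longrightarrow> arr a' A' A''
    \<Longrightarrow> mor_map G c' a' (mor_map G c a v) = mor_map G (c \<cdot> c') (a' \<cdot> a) v"
  by (rule mor_comp[symmetric, of C C' C'' A A' A'']) (simp_all add: arr_def el_def)

lemma push_push:
  assumes "el v C A" "arr a A A'" "arr a' A' A''"
  shows "push \<C> G C a' (push \<C> G C a v) = push \<C> G C (a' \<cdot> a) v"
proof -
  have i: "arr (ident \<C> C) C C" using assms el_obj arr_ident by blast
  show ?thesis unfolding push_def using mor_mor[OF assms(1) i assms(2) i assms(3)] ident_left[OF i]
    by simp
qed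

lemma pull_pull:
  assumes "el v C A" "arr c C' C" "arr c' C'' C'"
  shows "pull \<C> G A c' (pull \<C> G A c v) = pull \<C> G A (c \<cdot> c') v"
proof -
  have i: "arr (ident \<C> A) A A" using assms el_obj arr_ident by blast
  show ?thesis unfolding pull_def using mor_mor[OF assms(1,2) i assms(3) i] ident_left[OF i]
    by simp
qed

lemma mor_map_push_pull:
  assumes "el v C A" "arr c C' C" "arr a A A'"
  shows "mor_map G c a v = push \<C> G C' a (pull \<C> G A c v)"
    and "mor_map G c a v = pull \<C> G A' c (push \<C> G C a v)"
proof -
  have i: "arr (ident \<C> A) A A" "arr (ident \<C> C') C' C'"
    "arr (ident \<C> C) C C" "arr (ident \<C> A') A' A'" using assms arr_obj arr_ident by blast+
  show "mor_map G c a v = push \<C> G C' a (pull \<C> G A c v)"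
    unfolding push_def pull_def using mor_mor[OF assms(1,2) i(1,2) assms(3)]
      ident_right[OF assms(2)] ident_right[OF assms(3)] by simp
  show "mor_map G c a v = pull \<C> G A' c (push \<C> G C a v)"
    unfolding push_def pull_def using mor_mor[OF assms(1) i(3) assms(3,2) i(4)]
      ident_left[OF assms(2)] ident_left[OF assms(3)] by simp
qed

lemma push_pull:
  assumes "el v C A" "arr c C' C" "arr a A A'"
  shows "push \<C> G C' a (pull \<C> G A c v) = pull \<C> G A' c (push \<C> G C a v)"
  using mor_map_push_pull[OF assms] by simp

lemma push_ident: "el v C A \<Longrightarrow> push \<C> G C (ident \<C> A) v = v"
  and pull_ident: "el v C A \<Longrightarrow> pull \<C> G A (ident \<C> C) v = v"
  unfolding push_def pull_def el_def using mor_ident by blast+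

lemma pull_add:
  "el v C A \<Longrightarrow> el w C A \<Longrightarrow> arr c C' C
    \<Longrightarrow> pull \<C> G A c (v \<oplus>\<^bsub>obj_map G C A\<^esub> w) = pull \<C> G A c v \<oplus>\<^bsub>obj_map G C' A\<^esub> pull \<C> G A c w"
  by (rule abelian_group_hom.hom_add[OF hom_pull]) (simp_all add: el_def)

lemma push_zero: "C \<in> Obj \<C> \<Longrightarrow> arr a A A' \<Longrightarrow> push \<C> G C a \<zero>\<^bsub>obj_map G C A\<^esub> = \<zero>\<^bsub>obj_map G C A'\<^esub>"
  and pull_zero: "A \<in> Obj \<C> \<Longrightarrow> arr c C' C \<Longrightarrow> pull \<C> G A c \<zero>\<^bsub>obj_map G C A\<^esub> = \<zero>\<^bsub>obj_map G C' A\<^esub>"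
  using abelian_group_hom.hom_zero[OF hom_push] abelian_group_hom.hom_zero[OF hom_pull] by blast+

lemma el_zero: "C \<in> Obj \<C> \<Longrightarrow> A \<in> Obj \<C> \<Longrightarrow> el \<zero>\<^bsub>obj_map G C A\<^esub> C A"
  by (simp add: el_def abelian_monoid.zero_closed[OF abelian_group.axioms(1)[OF obj_abelian_group]])

lemma hom_push_arg:
  assumes "el v C A" "A' \<in> Obj \<C>"
  shows "abelian_group_hom (Hom \<C> A A') (obj_map G C A') (\<lambda>a. push \<C> G C a v)"
proof (rule linear_map_abelian_group_hom)
  note obj = el_obj[OF assms(1)]
  show "module R (Hom \<C> A A')" "module R (obj_map G C A')"
    using obj assms(2) by (simp_all add: Hom_module obj_module)
  show "linear_map R (Hom \<C> A A') (obj_map G C A') (\<lambda>a. push \<C> G C a v)"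
    unfolding push_def
    by (rule linear_co[OF obj(1,1,2) assms(2) ident_closed[OF obj(1)] el_carrier[OF assms(1)]])
qed

lemma hom_pull_arg:
  assumes "el v C A" "C' \<in> Obj \<C>"
  shows "abelian_group_hom (Hom \<C> C' C) (obj_map G C' A) (\<lambda>c. pull \<C> G A c v)"
proof (rule linear_map_abelian_group_hom)
  note obj = el_obj[OF assms(1)]
  show "module R (Hom \<C> C' C)" "module R (obj_map G C' A)"
    using obj assms(2) by (simp_all add: Hom_module obj_module)
  show "linear_map R (Hom \<C> C' C) (obj_map G C' A) (\<lambda>c. pull \<C> G A c v)"
    unfolding pull_def
    by (rule linear_contra[OF obj(1) assms(2) obj(2,2) ident_closed[OF obj(2)] el_carrier[OF assms(1)]])
qed

lemma push_add_arg:
  "el v C A \<Longrightarrow> arr a A A' \<Longrightarrow> arr b A A'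
    \<Longrightarrow> push \<C> G C (a \<oplus>\<^bsub>Hom \<C> A A'\<^esub> b) v = push \<C> G C a v \<oplus>\<^bsub>obj_map G C A'\<^esub> push \<C> G C b v"
  by (rule abelian_group_hom.hom_add[OF hom_push_arg]) (simp_all add: arr_def)

lemma pull_add_arg:
  "el v C A \<Longrightarrow> arr c C' C \<Longrightarrow> arr d C' C
    \<Longrightarrow> pull \<C> G A (c \<oplus>\<^bsub>Hom \<C> C' C\<^esub> d) v = pull \<C> G A c v \<oplus>\<^bsub>obj_map G C' A\<^esub> pull \<C> G A d v"
  by (rule abelian_group_hom.hom_add[OF hom_pull_arg]) (simp_all add: arr_def)

lemma push_zero_arg:
  "el v C A \<Longrightarrow> A' \<in> Obj \<C> \<Longrightarrow> push \<C> G C \<zero>\<^bsub>Hom \<C> A A'\<^esub> v = \<zero>\<^bsub>obj_map G C A'\<^esub>"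
  and pull_zero_arg:
  "el v C A \<Longrightarrow> C' \<in> Obj \<C> \<Longrightarrow> pull \<C> G A \<zero>\<^bsub>Hom \<C> C' C\<^esub> v = \<zero>\<^bsub>obj_map G C' A\<^esub>"
  using abelian_group_hom.hom_zero[OF hom_push_arg] abelian_group_hom.hom_zero[OF hom_pull_arg]
  by blast+

lemma push_smult_arg:
  assumes "el v C A" "r \<in> carrier R" "arr a A A'"
  shows "push \<C> G C (r \<odot>\<^bsub>Hom \<C> A A'\<^esub> a) v = r \<odot>\<^bsub>obj_map G C A'\<^esub> push \<C> G C a v"
proof -
  note obj = el_obj[OF assms(1)]
  have "linear_map R (Hom \<C> A A') (obj_map G C A') (\<lambda>a. mor_map G (ident \<C> C) a v)"
    by (rule linear_co[OF obj(1,1,2) arr_obj(2)[OF assms(3)] ident_closed[OF obj(1)]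
          el_carrier[OF assms(1)]])
  then show ?thesis using assms by (simp add: linear_map_def push_def arr_def)
qed

end


section \<open>Triangles\<close>

context extriangulated_category
begin

abbreviation tri :: "'o \<Rightarrow> 'o \<Rightarrow> 'o \<Rightarrow> 'm \<Rightarrow> 'm \<Rightarrow> 'e \<Rightarrow> bool" where
  "tri A B C x y \<delta> \<equiv> s_triangle \<C> E s A B C x y \<delta>"

lemma seq_class_refl:
  assumes "arr x A B" "arr y B C"
  shows "(B, x, y) \<in> seq_class \<C> A C (B, x, y)"
proof -
  have "iso_mor \<C> B B (ident \<C> B)"
    unfolding iso_mor_def using assms arr_ident ident_left arr_mor arr_obj by metis
  then show ?thesis
    unfolding seq_class_def sequences_def
    using assms ident_left[OF assms(1)] ident_right[OF assms(2)] by (auto simp: arr_def)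
qed

lemma triI:
  assumes "s C A \<delta> = seq_class \<C> A C (B, x, y)" "el \<delta> C A" "arr x A B" "arr y B C"
  shows "tri A B C x y \<delta>"
  using assms seq_class_refl[OF assms(3,4)] unfolding s_triangle_def el_def by simp

lemma tri_ext: "tri A B C x y \<delta> \<Longrightarrow> el \<delta> C A"
  by (simp add: s_triangle_def el_def)

lemma tri_arr:
  assumes "tri A B C x y \<delta>"
  shows "arr x A B" "arr y B C"
proof -
  have "A \<in> Obj \<C>" "C \<in> Obj \<C>" "\<delta> \<in> carrier (obj_map E C A)" "(B, x, y) \<in> s C A \<delta>"
    using assms by (simp_all add: s_triangle_def)
  moreover from realization_class[OF this(1-3)] have "s C A \<delta> \<subseteq> sequences \<C> A C"
    by (auto simp: seq_class_def)
  ultimately show "arr x A B" "arr y B C" by (auto simp: sequences_def arr_def)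
qed

lemma tri_exists:
  assumes "el \<delta> C A"
  obtains B x y where "tri A B C x y \<delta>"
proof -
  obtain B x y where t: "(B, x, y) \<in> sequences \<C> A C" "s C A \<delta> = seq_class \<C> A C (B, x, y)"
    using realization_class[of A C \<delta>] assms by (auto simp: el_def)
  have "arr x A B" "arr y B C" using t assms by (auto simp: sequences_def arr_def el_def)
  then show thesis using triI[OF t(2) assms] that by blast
qed

lemma tri_iso:
  assumes "tri A B C x y \<delta>" "tri A B' C x' y' \<delta>"
  obtains b b' where "arr b B B'" "arr b' B' B" "b' \<cdot> b = ident \<C> B" "b \<cdot> b' = ident \<C> B'"
    "b \<cdot> x = x'" "y' \<cdot> b = y"
proof -
  obtain D u v where t: "(D, u, v) \<in> sequences \<C> A C" "s C A \<delta> = seq_class \<C> A C (D, u, v)"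
    using realization_class[of A C \<delta>] assms(1) by (auto simp: s_triangle_def)
  have mem: "(B, x, y) \<in> seq_class \<C> A C (D, u, v)" "(B', x', y') \<in> seq_class \<C> A C (D, u, v)"
    using assms t(2) by (auto simp: s_triangle_def)
  have A: "A \<in> Obj \<C>" "C \<in> Obj \<C>" using assms by (auto simp: s_triangle_def)
  then have uv: "arr u A D" "arr v D C" using t by (auto simp: sequences_def arr_def)
  note xy = tri_arr[OF assms(1)] tri_arr[OF assms(2)]
  have BD: "B \<in> Obj \<C>" "B' \<in> Obj \<C>" "D \<in> Obj \<C>" using xy uv by (auto simp: arr_def)
  obtain f g where f: "arr f D B" "arr g B D" "g \<cdot> f = ident \<C> D" "f \<cdot> g = ident \<C> B"
    "f \<cdot> u = x" "y \<cdot> f = v"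
    using mem(1) BD by (auto simp: seq_class_def iso_mor_def arr_def)
  obtain f' g' where f': "arr f' D B'" "arr g' B' D" "g' \<cdot> f' = ident \<C> D" "f' \<cdot> g' = ident \<C> B'"
    "f' \<cdot> u = x'" "y' \<cdot> f' = v"
    using mem(2) BD by (auto simp: seq_class_def iso_mor_def arr_def)
  show thesis
  proof (rule that[of "f' \<cdot> g" "f \<cdot> g'"])
    show "arr (f' \<cdot> g) B B'" "arr (f \<cdot> g') B' B" using f f' arr_comp by blast+
    show "(f \<cdot> g') \<cdot> (f' \<cdot> g) = ident \<C> B"
      using assoc[OF f(1) f'(2) arr_comp[OF f'(1) f(2)]] assoc[OF f'(2,1) f(2)] f'(3) f(4)
        ident_left[OF f(2)] by simp
    show "(f' \<cdot> g) \<cdot> (f \<cdot> g') = ident \<C> B'"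
      using assoc[OF f'(1) f(2) arr_comp[OF f(1) f'(2)]] assoc[OF f(2,1) f'(2)] f(3) f'(4)
        ident_left[OF f'(2)] by simp
    have "g \<cdot> x = u" using assoc[OF f(2,1) uv(1)] f(3,5) ident_left[OF uv(1)] by simp
    then show "(f' \<cdot> g) \<cdot> x = x'" using assoc[OF f'(1) f(2) xy(1)] f'(5) by simp
    have "v \<cdot> g = y" using assoc[OF xy(2) f(1,2)] f(4,6) ident_right[OF xy(2)] by simp
    then show "y' \<cdot> (f' \<cdot> g) = y" using assoc[OF xy(4) f'(1) f(2)] f'(6) by simp
  qed
qed

lemma tri_fill_middle:
  assumes "tri A B C x y \<delta>" "tri A' B' C' x' y' \<delta>'" "arr a A A'" "arr c C C'"
    and "push \<C> E C a \<delta> = pull \<C> E A' c \<delta>'"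
  obtains b where "arr b B B'" "b \<cdot> x = x' \<cdot> a" "y' \<cdot> b = c \<cdot> y"
proof -
  have "ext_morphism \<C> E C A \<delta> C' A' \<delta>' a c"
    using assms by (simp add: ext_morphism_def arr_def)
  then obtain b where "b \<in> Mor \<C> B B'" "b \<cdot> x = x' \<cdot> a" "y' \<cdot> b = c \<cdot> y"
    using realization_morphism[OF assms(1,2)] by blast
  then show thesis using that tri_arr[OF assms(1)] tri_arr[OF assms(2)] by (auto simp: arr_def)
qed

lemma tri_fill_right:
  assumes "tri A B C x y \<delta>" "tri A' B' C' x' y' \<delta>'" "arr a A A'" "arr b B B'"
    and "b \<cdot> x = x' \<cdot> a"
  obtains c where "arr c C C'" "c \<cdot> y = y' \<cdot> b" "push \<C> E C a \<delta> = pull \<C> E A' c \<delta>'"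
  using ET3[OF assms(1,2) arr_mor[OF assms(3)] arr_mor[OF assms(4)] assms(5)]
    tri_ext[OF assms(1)] tri_ext[OF assms(2)] that by (auto simp: arr_def el_def)

lemma tri_fill_left:
  assumes "tri A B C x y \<delta>" "tri A' B' C' x' y' \<delta>'" "arr b B B'" "arr c C C'"
    and "c \<cdot> y = y' \<cdot> b"
  obtains a where "arr a A A'" "b \<cdot> x = x' \<cdot> a" "push \<C> E C a \<delta> = pull \<C> E A' c \<delta>'"
  using ET3_op[OF assms(1,2) arr_mor[OF assms(3)] arr_mor[OF assms(4)] assms(5)]
    tri_ext[OF assms(1)] tri_ext[OF assms(2)] that by (auto simp: arr_def el_def)

lemma split_tri:
  assumes "biproduct \<C> A C S i\<^sub>1 i\<^sub>2 p\<^sub>1 p\<^sub>2"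
  shows "tri A S C i\<^sub>1 p\<^sub>2 \<zero>\<^bsub>obj_map E C A\<^esub>"
proof (rule triI[OF realization_zero[OF assms]])
  note a = biproduct_arr[OF assms]
  show "arr i\<^sub>1 A S" "arr p\<^sub>2 S C" by (fact a)+
  show "el \<zero>\<^bsub>obj_map E C A\<^esub> C A" using a by (auto simp: arr_def intro: el_zero)
qed

definition null :: 'o where
  "null = (SOME Z. zero_object \<C> Z)"

lemma zero_object_null: "zero_object \<C> null"
  unfolding null_def using ex_zero_object by (rule someI_ex)

lemma null_obj: "null \<in> Obj \<C>"
  using zero_object_null by (simp add: zero_object_def)

lemma arr_null_unique:
  "arr f null A \<Longrightarrow> arr g null A \<Longrightarrow> f = g"
  "arr f A null \<Longrightarrow> arr g A null \<Longrightarrow> f = g"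
  using zero_object_null unfolding zero_object_def arr_def by blast+

lemma biproduct_null:
  assumes "A \<in> Obj \<C>"
  shows "biproduct \<C> A null A (ident \<C> A) \<zero>\<^bsub>Hom \<C> null A\<^esub> (ident \<C> A) \<zero>\<^bsub>Hom \<C> A null\<^esub>"
proof -
  note z = arr_zero[OF null_obj assms] arr_zero[OF assms null_obj] arr_ident[OF assms]
    arr_ident[OF null_obj]
  show ?thesis
    unfolding biproduct_def
    using assms null_obj z arr_null_unique(1)[OF arr_comp[OF z(2,1)] z(4)]
      ident_left[OF z(3)] ident_right[OF z(2)] ident_left[OF z(1)]
      comp_zero_left[OF z(2) assms] add_zero(1)[OF z(3)]
    by (simp add: arr_def)
qed

lemma tri_ident_left:
  "A \<in> Obj \<C> \<Longrightarrow> tri A A null (ident \<C> A) \<zero>\<^bsub>Hom \<C> A null\<^esub> \<zero>\<^bsub>obj_map E null A\<^esub>"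
  by (rule split_tri[OF biproduct_null])

lemma tri_ident_right:
  "A \<in> Obj \<C> \<Longrightarrow> tri null A A \<zero>\<^bsub>Hom \<C> null A\<^esub> (ident \<C> A) \<zero>\<^bsub>obj_map E A null\<^esub>"
  by (rule split_tri[OF biproduct_swap[OF biproduct_null]])

text \<open>The three vanishing statements below come from comparing a triangle with the trivial ones
  \<open>A \<rightarrow> A \<rightarrow> 0\<close> and \<open>0 \<rightarrow> A \<rightarrow> A\<close>, whose extensions live in groups at the zero object and are zero.\<close>

lemma tri_comp_zero:
  assumes "tri A B C x y \<delta>"
  shows "y \<cdot> x = \<zero>\<^bsub>Hom \<C> A C\<^esub>"
proof -
  note a = tri_arr[OF assms] and obj = el_obj[OF tri_ext[OF assms]]
  obtain c where c: "arr c null C" "c \<cdot> \<zero>\<^bsub>Hom \<C> A null\<^esub> = y \<cdot> x"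
    using tri_fill_right[OF tri_ident_left[OF obj(2)] assms arr_ident[OF obj(2)] a(1)] by blast
  then show ?thesis using comp_zero_right[OF c(1) obj(2)] by simp
qed

lemma tri_push_zero:
  assumes "tri A B C x y \<delta>"
  shows "push \<C> E C x \<delta> = \<zero>\<^bsub>obj_map E C B\<^esub>"
proof -
  note a = tri_arr[OF assms] and B = arr_obj(2)[OF tri_arr(1)[OF assms]]
  obtain c where "arr c C null" "push \<C> E C x \<delta> = pull \<C> E B c \<zero>\<^bsub>obj_map E null B\<^esub>"
    using tri_fill_right[OF assms tri_ident_left[OF B] a(1) arr_ident[OF B]] by blast
  then show ?thesis using pull_zero B by simp
qed

lemma tri_pull_zero:
  assumes "tri A B C x y \<delta>"
  shows "pull \<C> E A y \<delta> = \<zero>\<^bsub>obj_map E B A\<^esub>"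
proof -
  note a = tri_arr[OF assms] and B = arr_obj(2)[OF tri_arr(1)[OF assms]]
  have "y \<cdot> ident \<C> B = y \<cdot> ident \<C> B" ..
  then obtain k where "arr k null A" "push \<C> E B k \<zero>\<^bsub>obj_map E B null\<^esub> = pull \<C> E A y \<delta>"
    using tri_fill_left[OF tri_ident_right[OF B] assms arr_ident[OF B] a(2)] by blast
  then show ?thesis using push_zero B by metis
qed

text \<open>Exactness of \<open>\<C>(Y, C) \<rightarrow> E(Y, A) \<rightarrow> E(Y, B)\<close>. If \<open>x\<^sub>* \<epsilon> = 0\<close>, then \<open>x\<close> extends
  along the inflation of a realization of \<open>\<epsilon>\<close>, and \<open>c\<close> is the induced map of cokernels.\<close>

lemma tri_pull_lift:
  assumes \<delta>: "tri A B C x y \<delta>" and \<epsilon>: "el \<epsilon> Y A" "push \<C> E Y x \<epsilon> = \<zero>\<^bsub>obj_map E Y B\<^esub>"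
  obtains c where "arr c Y C" "\<epsilon> = pull \<C> E A c \<delta>"
proof -
  note x = tri_arr(1)[OF \<delta>] and obj = arr_obj[OF tri_arr(1)[OF \<delta>]]
  obtain M m m' where M: "tri A M Y m m' \<epsilon>" using tri_exists[OF \<epsilon>(1)] .
  have z: "arr \<zero>\<^bsub>Hom \<C> Y null\<^esub> Y null" using arr_zero el_obj[OF \<epsilon>(1)] null_obj by blast
  obtain b where b: "arr b M B" "b \<cdot> m = ident \<C> B \<cdot> x"
    using tri_fill_middle[OF M tri_ident_left[OF obj(2)] x z] \<epsilon>(2) pull_zero[OF obj(2) z] by metis
  then have "b \<cdot> m = x \<cdot> ident \<C> A" using ident_left[OF x] ident_right[OF x] by simp
  then obtain c where "arr c Y C" "push \<C> E Y (ident \<C> A) \<epsilon> = pull \<C> E A c \<delta>"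
    using tri_fill_right[OF M \<delta> arr_ident[OF obj(1)] b(1)] by blast
  then show thesis using that push_ident[OF \<epsilon>(1)] by simp
qed

lemma tri_push_lift:
  assumes \<delta>: "tri A B C x y \<delta>" and \<epsilon>: "el \<epsilon> C Y" "pull \<C> E Y y \<epsilon> = \<zero>\<^bsub>obj_map E B Y\<^esub>"
  obtains k where "arr k A Y" "\<epsilon> = push \<C> E C k \<delta>"
proof -
  note y = tri_arr(2)[OF \<delta>] and obj = arr_obj[OF tri_arr(2)[OF \<delta>]]
  obtain M m m' where M: "tri Y M C m m' \<epsilon>" using tri_exists[OF \<epsilon>(1)] .
  have z: "arr \<zero>\<^bsub>Hom \<C> null Y\<^esub> null Y" using arr_zero el_obj[OF \<epsilon>(1)] null_obj by blast
  obtain b where b: "arr b B M" "m' \<cdot> b = y \<cdot> ident \<C> B"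
    using tri_fill_middle[OF tri_ident_right[OF obj(1)] M z y] \<epsilon>(2) push_zero[OF obj(1) z] by metis
  then have "ident \<C> C \<cdot> y = m' \<cdot> b" using ident_left[OF y] ident_right[OF y] by simp
  then obtain k where "arr k A Y" "push \<C> E C k \<delta> = pull \<C> E Y (ident \<C> C) \<epsilon>"
    using tri_fill_left[OF \<delta> M b(1) arr_ident[OF obj(2)]] by blast
  then show thesis using that pull_ident[OF \<epsilon>(1)] by simp
qed

lemma tri_pull_fibre:
  assumes \<delta>: "tri A B C x y \<delta>" and v: "el v Y A" and w: "el w Y A"
    and eq: "push \<C> E Y x v = push \<C> E Y x w"
  obtains c where "arr c Y C" "v = w \<oplus>\<^bsub>obj_map E Y A\<^esub> pull \<C> E A c \<delta>"
proof -
  note x = tri_arr(1)[OF \<delta>] and Y = el_obj(1)[OF v]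
  have "exact_pair (Hom \<C> Y C) (obj_map E Y A) (obj_map E Y B) (\<lambda>c. pull \<C> E A c \<delta>) (push \<C> E Y x)"
  proof (rule exact_pairI)
    fix c assume "c \<in> Mor \<C> Y C"
    then have c: "arr c Y C" using Y tri_arr[OF \<delta>] by (simp add: arr_def)
    show "pull \<C> E A c \<delta> \<in> carrier (obj_map E Y A)" using el_pull[OF tri_ext[OF \<delta>] c] by (rule el_carrier)
    show "push \<C> E Y x (pull \<C> E A c \<delta>) = \<zero>\<^bsub>obj_map E Y B\<^esub>"
      using push_pull[OF tri_ext[OF \<delta>] c x] tri_push_zero[OF \<delta>] pull_zero[OF arr_obj(2)[OF x] c] by simp
  next
    fix u assume "u \<in> carrier (obj_map E Y A)" and u: "push \<C> E Y x u = \<zero>\<^bsub>obj_map E Y B\<^esub>"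
    then have "el u Y A" using Y x by (simp add: el_def arr_def)
    then show "\<exists>c\<in>Mor \<C> Y C. u = pull \<C> E A c \<delta>"
      using tri_pull_lift[OF \<delta> _ u] arr_mor by metis
  qed
  moreover have "pull \<C> E A c \<delta> \<in> carrier (obj_map E Y A)" if "c \<in> Mor \<C> Y C" for c
    using el_pull[OF tri_ext[OF \<delta>]] that Y tri_arr[OF \<delta>] by (simp add: arr_def el_def)
  ultimately obtain c where "c \<in> Mor \<C> Y C" "v = w \<oplus>\<^bsub>obj_map E Y A\<^esub> pull \<C> E A c \<delta>"
    using exact_pair_fibre[OF _ hom_push[OF x Y] el_carrier[OF v] el_carrier[OF w] eq] by metis
  then show thesis using that Y tri_arr[OF \<delta>] by (simp add: arr_def)
qed

lemma tri_push_fibre: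
  assumes \<delta>: "tri A B C x y \<delta>" and v: "el v C Y" and w: "el w C Y"
    and eq: "pull \<C> E Y y v = pull \<C> E Y y w"
  obtains k where "arr k A Y" "v = w \<oplus>\<^bsub>obj_map E C Y\<^esub> push \<C> E C k \<delta>"
proof -
  note y = tri_arr(2)[OF \<delta>] and Y = el_obj(2)[OF v]
  have "exact_pair (Hom \<C> A Y) (obj_map E C Y) (obj_map E B Y) (\<lambda>k. push \<C> E C k \<delta>) (pull \<C> E Y y)"
  proof (rule exact_pairI)
    fix k assume "k \<in> Mor \<C> A Y"
    then have k: "arr k A Y" using Y tri_arr[OF \<delta>] by (simp add: arr_def)
    show "push \<C> E C k \<delta> \<in> carrier (obj_map E C Y)" using el_push[OF tri_ext[OF \<delta>] k] by (rule el_carrier)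
    show "pull \<C> E Y y (push \<C> E C k \<delta>) = \<zero>\<^bsub>obj_map E B Y\<^esub>"
      using push_pull[OF tri_ext[OF \<delta>] y k] tri_pull_zero[OF \<delta>] push_zero[OF arr_obj(1)[OF y] k] by simp
  next
    fix u assume "u \<in> carrier (obj_map E C Y)" and u: "pull \<C> E Y y u = \<zero>\<^bsub>obj_map E B Y\<^esub>"
    then have "el u C Y" using Y y by (simp add: el_def arr_def)
    then show "\<exists>k\<in>Mor \<C> A Y. u = push \<C> E C k \<delta>"
      using tri_push_lift[OF \<delta> _ u] arr_mor by metis
  qed
  moreover have "push \<C> E C k \<delta> \<in> carrier (obj_map E C Y)" if "k \<in> Mor \<C> A Y" for k
    using el_push[OF tri_ext[OF \<delta>]] that Y tri_arr[OF \<delta>] by (simp add: arr_def el_def)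
  ultimately obtain k where "k \<in> Mor \<C> A Y" "v = w \<oplus>\<^bsub>obj_map E C Y\<^esub> push \<C> E C k \<delta>"
    using exact_pair_fibre[OF _ hom_pull[OF y Y] el_carrier[OF v] el_carrier[OF w] eq] by metis
  then show thesis using that Y tri_arr[OF \<delta>] by (simp add: arr_def)
qed


section \<open>Octahedra\<close>

text \<open>The data of the octahedral axiom: four triangles \<open>A \<rightarrow> B \<rightarrow> D\<close>, \<open>B \<rightarrow> C \<rightarrow> G\<close>,
  \<open>A \<rightarrow> C \<rightarrow> X\<close>, \<open>D \<rightarrow> X \<rightarrow> G\<close>, with the compatibilities of \<open>ET4\<close>. Read from the deflations
  \<open>h': C \<rightarrow> X\<close> and \<open>e: X \<rightarrow> G\<close> these are the compatibilities of its dual, so that the same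
  predicate serves both axioms.\<close>

definition octahedron ::
    "'o \<Rightarrow> 'o \<Rightarrow> 'o \<Rightarrow> 'o \<Rightarrow> 'o \<Rightarrow> 'o \<Rightarrow> 'm \<Rightarrow> 'm \<Rightarrow> 'e \<Rightarrow> 'm \<Rightarrow> 'm \<Rightarrow> 'e \<Rightarrow> 'm \<Rightarrow> 'm \<Rightarrow> 'm \<Rightarrow> 'e \<Rightarrow> bool" where
  "octahedron A B C D X G f f' \<delta> g g' \<delta>' d e h' \<delta>'' \<longleftrightarrow>
     tri A B D f f' \<delta> \<and> tri B C G g g' \<delta>' \<and> tri A C X (g \<cdot> f) h' \<delta>'' \<and>
     tri D X G d e (push \<C> E G f' \<delta>') \<and> h' \<cdot> g = d \<cdot> f' \<and> e \<cdot> h' = g' \<and>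
     pull \<C> E A d \<delta>'' = \<delta> \<and> push \<C> E X f \<delta>'' = pull \<C> E B e \<delta>'"

lemma octahedron_of_inflations:
  assumes "tri A B D f f' \<delta>" "tri B C G g g' \<delta>'"
  obtains X d e h' \<delta>'' where "octahedron A B C D X G f f' \<delta> g g' \<delta>' d e h' \<delta>''"
  using ET4[OF assms] assms unfolding octahedron_def by blast

lemma octahedron_of_deflations:
  assumes "tri A C X h h' \<delta>''" "tri D X G d e \<epsilon>"
  obtains B f f' g \<delta>' where "octahedron A B C D X G f f' (pull \<C> E A d \<delta>'') g (e \<cdot> h') \<delta>' d e h' \<delta>''"
    "push \<C> E G f' \<delta>' = \<epsilon>" "g \<cdot> f = h"
  using ET4_op[OF assms(2,1)] assms unfolding octahedron_def by metis


lemma inflation_comp: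
  assumes "inflation \<C> E s A B x" "inflation \<C> E s B D y"
  shows "inflation \<C> E s A D (y \<cdot> x)"
proof -
  obtain C G u v \<delta> \<epsilon> where "tri A B C x u \<delta>" "tri B D G y v \<epsilon>"
    using assms unfolding inflation_def by blast
  then obtain X d e h \<eta> where "octahedron A B D C X G x u \<delta> y v \<epsilon> d e h \<eta>"
    using octahedron_of_inflations by blast
  then show ?thesis unfolding octahedron_def inflation_def by blast
qed

lemma deflation_comp:
  assumes "deflation \<C> E s C X y" "deflation \<C> E s X G z"
  shows "deflation \<C> E s C G (z \<cdot> y)"
proof -
  obtain A D u v \<delta> \<epsilon> where t: "tri A C X u y \<delta>" "tri D X G v z \<epsilon>"
    using assms unfolding deflation_def by blast
  obtain B f f' g \<eta> where
    "octahedron A B C D X G f f' (pull \<C> E A v \<delta>) g (z \<cdot> y) \<eta> v z y \<delta>"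
    by (rule octahedron_of_deflations[OF t])
  then show ?thesis unfolding octahedron_def deflation_def by blast
qed

lemma inflation_arr: "inflation \<C> E s A B x \<Longrightarrow> arr x A B"
  and deflation_arr: "deflation \<C> E s B C y \<Longrightarrow> arr y B C"
  using tri_arr unfolding inflation_def deflation_def by blast+

lemma inflation_ident: "A \<in> Obj \<C> \<Longrightarrow> inflation \<C> E s A A (ident \<C> A)"
  and deflation_ident: "A \<in> Obj \<C> \<Longrightarrow> deflation \<C> E s A A (ident \<C> A)"
  using tri_ident_left tri_ident_right unfolding inflation_def deflation_def by blast+

end


section \<open>Closed sub-bifunctors\<close>

lemma linear_map_restrict:
  assumes "linear_map R M N f" "H \<subseteq> carrier M" "\<And>x. x \<in> H \<Longrightarrow> f x \<in> H'"
  shows "linear_map R (M\<lparr>carrier := H\<rparr>) (N\<lparr>carrier := H'\<rparr>) f"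
  using assms by (auto simp: linear_map_def hom_def Pi_def subset_iff)

context extriangulated_category
begin

lemma restrict_triangle_iff:
  assumes "sub_bifunctor R \<C> E H"
  shows "s_triangle \<C> (restrict_bifunctor E H) s A B C x y \<delta> \<longleftrightarrow> tri A B C x y \<delta> \<and> \<delta> \<in> H C A"
proof -
  have "H C A \<subseteq> carrier (obj_map E C A)" if "C \<in> Obj \<C>" "A \<in> Obj \<C>"
    using assms that module.submoduleE(1)[OF obj_module[OF that]] unfolding sub_bifunctor_def by blast
  then show ?thesis by (auto simp: s_triangle_def restrict_bifunctor_def)
qed

lemma restrict_push: "push \<C> (restrict_bifunctor E H) = push \<C> E"
  and restrict_pull: "pull \<C> (restrict_bifunctor E H) = pull \<C> E"
  by (auto simp: fun_eq_iff push_def pull_def restrict_bifunctor_def)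

lemma restrict_ext_morphism: "ext_morphism \<C> (restrict_bifunctor E H) = ext_morphism \<C> E"
  by (auto simp: fun_eq_iff ext_morphism_def restrict_push restrict_pull)

lemma restrict_bilinear:
  assumes H: "sub_bifunctor R \<C> E H"
  shows "bilinear_functor R \<C> (restrict_bifunctor E H)"
proof -
  have sub: "submodule (H C A) R (obj_map E C A)" if "C \<in> Obj \<C>" "A \<in> Obj \<C>" for C A
    using H that unfolding sub_bifunctor_def by blast
  have carr: "H C A \<subseteq> carrier (obj_map E C A)" if "C \<in> Obj \<C>" "A \<in> Obj \<C>" for C A
    using module.submoduleE(1)[OF obj_module[OF that] sub[OF that]] .
  have mor: "mor_map E c a \<delta> \<in> H C' A'"
    if "C \<in> Obj \<C>" "C' \<in> Obj \<C>" "A \<in> Obj \<C>" "A' \<in> Obj \<C>" "c \<in> Mor \<C> C' C" "a \<in> Mor \<C> A A'" "\<delta> \<in> H C A"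
    for C C' A A' c a \<delta>
    using H that unfolding sub_bifunctor_def by blast
  have Hom_carrier: "(Hom \<C> A B)\<lparr>carrier := carrier (Hom \<C> A B)\<rparr> = Hom \<C> A B" for A B by simp
  show ?thesis
  proof (intro bilinear_functor.intro bilinear_functor_axioms.intro linear_category_axioms)
    fix C A assume CA: "C \<in> Obj \<C>" "A \<in> Obj \<C>"
    show "module R (obj_map (restrict_bifunctor E H) C A)"
      using submodule.submodule_is_module[OF sub[OF CA] obj_module[OF CA]]
      by (simp add: restrict_bifunctor_def)
  next
    fix C A v assume CA: "C \<in> Obj \<C>" "A \<in> Obj \<C>" "v \<in> carrier (obj_map (restrict_bifunctor E H) C A)"
    then show "mor_map (restrict_bifunctor E H) (ident \<C> C) (ident \<C> A) v = v"
      using carr[OF CA(1,2)] mor_ident by (auto simp: restrict_bifunctor_def)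
  next
    fix C C' A A' c a
    assume a: "C \<in> Obj \<C>" "C' \<in> Obj \<C>" "A \<in> Obj \<C>" "A' \<in> Obj \<C>" "c \<in> Mor \<C> C' C" "a \<in> Mor \<C> A A'"
    show "linear_map R (obj_map (restrict_bifunctor E H) C A) (obj_map (restrict_bifunctor E H) C' A')
        (mor_map (restrict_bifunctor E H) c a)"
      unfolding restrict_bifunctor_def bifunctor.simps
      by (rule linear_map_restrict[OF mor_linear[OF a] carr[OF a(1,3)] mor[OF a]])
  next
    fix C C' C'' A A' A'' c c' a a' v
    assume a: "C \<in> Obj \<C>" "C' \<in> Obj \<C>" "C'' \<in> Obj \<C>" "A \<in> Obj \<C>" "A' \<in> Obj \<C>" "A'' \<in> Obj \<C>"
      "c \<in> Mor \<C> C' C" "c' \<in> Mor \<C> C'' C'" "a \<in> Mor \<C> A A'" "a' \<in> Mor \<C> A' A''"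
    assume "v \<in> carrier (obj_map (restrict_bifunctor E H) C A)"
    then have "v \<in> carrier (obj_map E C A)" using carr[OF a(1,4)] by (auto simp: restrict_bifunctor_def)
    then show "mor_map (restrict_bifunctor E H) (c \<cdot> c') (a' \<cdot> a) v
        = mor_map (restrict_bifunctor E H) c' a' (mor_map (restrict_bifunctor E H) c a v)"
      using mor_comp[OF a] by (simp add: restrict_bifunctor_def)
  next
    fix C C' A A' a v
    assume a: "C \<in> Obj \<C>" "C' \<in> Obj \<C>" "A \<in> Obj \<C>" "A' \<in> Obj \<C>" "a \<in> Mor \<C> A A'"
    assume "v \<in> carrier (obj_map (restrict_bifunctor E H) C A)"
    then have v: "v \<in> H C A" by (simp add: restrict_bifunctor_def)
    show "linear_map R (Hom \<C> C' C) (obj_map (restrict_bifunctor E H) C' A')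
        (\<lambda>c. mor_map (restrict_bifunctor E H) c a v)"
      unfolding restrict_bifunctor_def bifunctor.simps
      using linear_map_restrict[OF linear_contra[OF a] order_refl mor[OF a(1-4) _ a(5) v]] carr[OF a(1,3)] v
      unfolding Hom_carrier by blast
  next
    fix C C' A A' c v
    assume a: "C \<in> Obj \<C>" "C' \<in> Obj \<C>" "A \<in> Obj \<C>" "A' \<in> Obj \<C>" "c \<in> Mor \<C> C' C"
    assume "v \<in> carrier (obj_map (restrict_bifunctor E H) C A)"
    then have v: "v \<in> H C A" by (simp add: restrict_bifunctor_def)
    show "linear_map R (Hom \<C> A A') (obj_map (restrict_bifunctor E H) C' A')
        (\<lambda>a. mor_map (restrict_bifunctor E H) c a v)"
      unfolding restrict_bifunctor_def bifunctor.simps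
      using linear_map_restrict[OF linear_co[OF a] order_refl mor[OF a(1-5) _ v]] carr[OF a(1,3)] v
      unfolding Hom_carrier by blast
  qed
qed

text \<open>A restriction inherits every axiom except the octahedral ones, where the extension
  that the axiom produces may fail to lie in the sub-bifunctor. For \<open>ET4\<close> this extension is the one of
  the composite inflation, for its dual it is the one whose deflation is the composite \<open>e \<cdot> h'\<close>; the
  remaining triangle is a pushforward or a pullback.\<close>

lemma closed_sub_bifunctorI:
  assumes H: "sub_bifunctor R \<C> E H"
    and composite: "\<And>A B C D X G f f' \<delta> g g' \<delta>' d e h' \<delta>''.
      \<lbrakk>octahedron A B C D X G f f' \<delta> g g' \<delta>' d e h' \<delta>''; \<delta> \<in> H D A; \<delta>' \<in> H G B\<rbrakk> \<Longrightarrow> \<delta>'' \<in> H X A"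
    and quotient: "\<And>A B C D X G f f' \<delta> g g' \<delta>' d e h' \<delta>''.
      \<lbrakk>octahedron A B C D X G f f' \<delta> g g' \<delta>' d e h' \<delta>''; \<delta>'' \<in> H X A; push \<C> E G f' \<delta>' \<in> H G D\<rbrakk>
        \<Longrightarrow> \<delta>' \<in> H G B"
  shows "closed_sub_bifunctor R \<C> E s H"
proof -
  let ?E = "restrict_bifunctor E H"
  note tri_iff = restrict_triangle_iff[OF H] and rest = restrict_push restrict_pull restrict_ext_morphism
  have carr: "carrier (obj_map ?E C A) = H C A" for C A by (simp add: restrict_bifunctor_def)
  have zero: "\<zero>\<^bsub>obj_map ?E C A\<^esub> = \<zero>\<^bsub>obj_map E C A\<^esub>" for C A by (simp add: restrict_bifunctor_def)
  have sub: "H C A \<subseteq> carrier (obj_map E C A)" if "C \<in> Obj \<C>" "A \<in> Obj \<C>" for C A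
    using H that module.submoduleE(1)[OF obj_module[OF that]] unfolding sub_bifunctor_def by blast
  have push_mem: "push \<C> E C a \<delta> \<in> H C A'" if "\<delta> \<in> H C A" "arr a A A'" "C \<in> Obj \<C>" for C A A' a \<delta>
    using H that ident_closed unfolding sub_bifunctor_def push_def arr_def by blast
  have pull_mem: "pull \<C> E A c \<delta> \<in> H C' A" if "\<delta> \<in> H C A" "arr c C' C" "A \<in> Obj \<C>" for C C' A c \<delta>
    using H that ident_closed unfolding sub_bifunctor_def pull_def arr_def by blast
  have real: "additive_realization R \<C> ?E s"
  proof (intro additive_realization.intro additive_realization_axioms.intro)
    show "additive_category R \<C>" by unfold_locales
    show "bilinear_functor R \<C> ?E" by (rule restrict_bilinear[OF H])
    show "\<exists>t\<in>sequences \<C> A C. s C A \<delta> = seq_class \<C> A C t"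
      if "A \<in> Obj \<C>" "C \<in> Obj \<C>" "\<delta> \<in> carrier (obj_map ?E C A)" for A C \<delta>
      using realization_class[OF that(1,2)] sub[OF that(2,1)] that(3) by (auto simp: carr)
    show "\<exists>b\<in>Mor \<C> B B'. b \<cdot> x = x' \<cdot> a \<and> y' \<cdot> b = c \<cdot> y"
      if "s_triangle \<C> ?E s A B C x y \<delta>" "s_triangle \<C> ?E s A' B' C' x' y' \<delta>'"
        "ext_morphism \<C> ?E C A \<delta> C' A' \<delta>' a c" for A B C x y \<delta> A' B' C' x' y' \<delta>' a c
      using that realization_morphism unfolding tri_iff rest by blast
    show "s C A \<zero>\<^bsub>obj_map ?E C A\<^esub> = seq_class \<C> A C (S, i\<^sub>1, p\<^sub>2)"
      if "biproduct \<C> A C S i\<^sub>1 i\<^sub>2 p\<^sub>1 p\<^sub>2" for A C S i\<^sub>1 i\<^sub>2 p\<^sub>1 p\<^sub>2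
      unfolding zero by (rule realization_zero[OF that])
  next
    fix A B C x y \<delta> A' B' C' x' y' \<delta>' SA iA iA' pA pA' SB iB iB' pB pB' SC iC iC' pC pC' \<epsilon>
    assume t: "s_triangle \<C> ?E s A B C x y \<delta>" "s_triangle \<C> ?E s A' B' C' x' y' \<delta>'"
      and b: "biproduct \<C> A A' SA iA iA' pA pA'" "biproduct \<C> B B' SB iB iB' pB pB'"
        "biproduct \<C> C C' SC iC iC' pC pC'"
      and e: "ext_sum ?E C A \<delta> C' A' \<delta>' SC iC iC' SA pA pA' \<epsilon>"
    have "SC \<in> Obj \<C>" "SA \<in> Obj \<C>" using b by (simp_all add: biproduct_def)
    then have "ext_sum E C A \<delta> C' A' \<delta>' SC iC iC' SA pA pA' \<epsilon>"
      using e sub[of SC SA] unfolding ext_sum_def carr zero by (auto simp: restrict_bifunctor_def)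
    then show "s SC SA \<epsilon> = seq_class \<C> SA SC
              (SB, (iB \<cdot> x \<cdot> pA) \<oplus>\<^bsub>Hom \<C> SA SB\<^esub> (iB' \<cdot> x' \<cdot> pA'),
                   (iC \<cdot> y \<cdot> pB) \<oplus>\<^bsub>Hom \<C> SB SC\<^esub> (iC' \<cdot> y' \<cdot> pB'))"
      using realization_sum[OF _ _ b] t unfolding tri_iff by blast
  qed
  have "extriangulated_category R \<C> ?E s"
  proof (intro extriangulated_category.intro extriangulated_category_axioms.intro real)
    show "\<exists>c\<in>Mor \<C> C C'. c \<cdot> y = y' \<cdot> b \<and> push \<C> ?E C a \<delta> = pull \<C> ?E A' c \<delta>'"
      if "s_triangle \<C> ?E s A B C x y \<delta>" "s_triangle \<C> ?E s A' B' C' x' y' \<delta>'"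
        "a \<in> Mor \<C> A A'" "b \<in> Mor \<C> B B'" "b \<cdot> x = x' \<cdot> a"
      for A B C x y \<delta> A' B' C' x' y' \<delta>' a b
      using that ET3 unfolding tri_iff rest by blast
    show "\<exists>a\<in>Mor \<C> A A'. b \<cdot> x = x' \<cdot> a \<and> push \<C> ?E C a \<delta> = pull \<C> ?E A' c \<delta>'"
      if "s_triangle \<C> ?E s A B C x y \<delta>" "s_triangle \<C> ?E s A' B' C' x' y' \<delta>'"
        "b \<in> Mor \<C> B B'" "c \<in> Mor \<C> C C'" "c \<cdot> y = y' \<cdot> b"
      for A B C x y \<delta> A' B' C' x' y' \<delta>' b c
      using that ET3_op unfolding tri_iff rest by blast
  next
    fix A B D f f' \<delta> C G g g' \<delta>'
    assume "s_triangle \<C> ?E s A B D f f' \<delta>" "s_triangle \<C> ?E s B C G g g' \<delta>'"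
    then have t: "tri A B D f f' \<delta>" "tri B C G g g' \<delta>'" and mem: "\<delta> \<in> H D A" "\<delta>' \<in> H G B"
      unfolding tri_iff by blast+
    obtain X d e h' \<delta>'' where oct: "octahedron A B C D X G f f' \<delta> g g' \<delta>' d e h' \<delta>''"
      by (rule octahedron_of_inflations[OF t])
    note o = oct[unfolded octahedron_def]
    have "arr d D X" "arr e X G" "arr h' C X" using o tri_arr by blast+
    moreover have "\<delta>'' \<in> H X A" by (rule composite[OF oct mem])
    moreover have "push \<C> E G f' \<delta>' \<in> H G D"
      using push_mem[OF mem(2) tri_arr(2)[OF t(1)]] arr_obj[OF tri_arr(2)[OF t(2)]] by blast
    ultimately show "\<exists>X\<in>Obj \<C>. \<exists>d\<in>Mor \<C> D X. \<exists>e\<in>Mor \<C> X G. \<exists>h'\<in>Mor \<C> C X.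
              \<exists>\<delta>''\<in>carrier (obj_map ?E X A).
                h' \<cdot> g = d \<cdot> f' \<and> e \<cdot> h' = g' \<and>
                s_triangle \<C> ?E s A C X (g \<cdot> f) h' \<delta>'' \<and>
                s_triangle \<C> ?E s D X G d e (push \<C> ?E G f' \<delta>') \<and>
                pull \<C> ?E A d \<delta>'' = \<delta> \<and> push \<C> ?E X f \<delta>'' = pull \<C> ?E B e \<delta>'"
      using o unfolding tri_iff rest carr arr_def by blast
  next
    fix D B A f' f \<delta> G C g' g \<delta>'
    assume "s_triangle \<C> ?E s D B A f' f \<delta>" "s_triangle \<C> ?E s G C B g' g \<delta>'"
    then have t: "tri D B A f' f \<delta>" "tri G C B g' g \<delta>'" and mem: "\<delta> \<in> H A D" "\<delta>' \<in> H B G"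
      unfolding tri_iff by blast+
    obtain X e d h' \<delta>'' where oct: "octahedron G X C D B A e d (pull \<C> E G f' \<delta>') h' (f \<cdot> g) \<delta>'' f' f g \<delta>'"
      and o': "push \<C> E A d \<delta>'' = \<delta>" "h' \<cdot> e = g'"
      by (rule octahedron_of_deflations[OF t(2,1)])
    note o = oct[unfolded octahedron_def]
    have "arr d X D" "arr e G X" "arr h' X C" using o tri_arr by blast+
    moreover have "\<delta>'' \<in> H A X" using quotient[OF oct mem(2)] o'(1) mem(1) by simp
    moreover have "pull \<C> E G f' \<delta>' \<in> H D G"
      using pull_mem[OF mem(2) tri_arr(1)[OF t(1)]] arr_obj[OF tri_arr(1)[OF t(2)]] by blast
    ultimately show "\<exists>X\<in>Obj \<C>. \<exists>d\<in>Mor \<C> X D. \<exists>e\<in>Mor \<C> G X. \<exists>h'\<in>Mor \<C> X C.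
              \<exists>\<delta>''\<in>carrier (obj_map ?E A X).
                g \<cdot> h' = f' \<cdot> d \<and> h' \<cdot> e = g' \<and>
                s_triangle \<C> ?E s X C A h' (f \<cdot> g) \<delta>'' \<and>
                s_triangle \<C> ?E s G X D e d (pull \<C> ?E G f' \<delta>') \<and>
                push \<C> ?E A d \<delta>'' = \<delta> \<and> pull \<C> ?E X f \<delta>'' = push \<C> ?E B e \<delta>'"
      using o o' unfolding tri_iff rest carr arr_def by metis
  qed
  then show ?thesis using H by (simp add: closed_sub_bifunctor_def)
qed

end


section \<open>The core of a class of extensions\<close>

text \<open>The class of acyclic extensions enters only through two properties: it contains the split
  extensions, and if three triangles of an octahedron belong to it then so does the fourth.\<close>

locale octahedral_class = extriangulated_category R \<C> E s
  for R :: "'r ring" and \<C> :: "('r, 'o, 'm) lin_category" (structure)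
    and E :: "('r, 'o, 'm, 'e) bifunctor" and s :: "('o, 'm, 'e) realization" +
  fixes K :: "'o \<Rightarrow> 'o \<Rightarrow> 'e \<Rightarrow> bool"
  assumes zero_mem: "\<lbrakk>C \<in> Obj \<C>; A \<in> Obj \<C>\<rbrakk> \<Longrightarrow> K C A \<zero>\<^bsub>obj_map E C A\<^esub>"
    and octahedron_mem:
      "\<lbrakk>octahedron A B C D X G f f' \<delta> g g' \<delta>' d e h' \<delta>''; K G B \<delta>'; K X A \<delta>''; K G D (push \<C> E G f' \<delta>')\<rbrakk>
        \<Longrightarrow> K D A \<delta>"
      "\<lbrakk>octahedron A B C D X G f f' \<delta> g g' \<delta>' d e h' \<delta>''; K D A \<delta>; K X A \<delta>''; K G D (push \<C> E G f' \<delta>')\<rbrakk>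
        \<Longrightarrow> K G B \<delta>'"
      "\<lbrakk>octahedron A B C D X G f f' \<delta> g g' \<delta>' d e h' \<delta>''; K D A \<delta>; K G B \<delta>'; K G D (push \<C> E G f' \<delta>')\<rbrakk>
        \<Longrightarrow> K X A \<delta>''"
      "\<lbrakk>octahedron A B C D X G f f' \<delta> g g' \<delta>' d e h' \<delta>''; K D A \<delta>; K G B \<delta>'; K X A \<delta>''\<rbrakk>
        \<Longrightarrow> K G D (push \<C> E G f' \<delta>')"
begin

text \<open>Adding a trivial triangle \<open>D \<rightarrow> D \<rightarrow> 0\<close> to \<open>\<delta>\<close> stays in the class: in the
  octahedron of \<open>D \<rightarrow> A \<oplus> D\<close> followed by the inflation of \<open>i\<^sub>* \<delta>\<close>, two of the other triangles are split
  and the last one realizes \<open>p\<^sub>* i\<^sub>* \<delta> = \<delta>\<close>.\<close>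

lemma push_inclusion_mem:
  assumes \<delta>: "el \<delta> C A" "K C A \<delta>" and bip: "biproduct \<C> A D S i j p q"
  shows "K C S (push \<C> E C i \<delta>)"
proof -
  note a = biproduct_arr[OF bip] and eqs = bip[unfolded biproduct_def]
  have el: "el (push \<C> E C i \<delta>) C S" using el_push[OF \<delta>(1) a(1)] .
  obtain T u v where T: "tri S T C u v (push \<C> E C i \<delta>)" using tri_exists[OF el] .
  obtain X d e h \<eta> where oct: "octahedron D S T A X C j p \<zero>\<^bsub>obj_map E A D\<^esub> u v
      (push \<C> E C i \<delta>) d e h \<eta>"
    by (rule octahedron_of_inflations[OF split_tri[OF biproduct_swap[OF bip]] T])
  note o = oct[unfolded octahedron_def]
  have \<eta>: "el \<eta> X D" and e: "arr e X C" using o tri_ext tri_arr by blast+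
  have "\<eta> = push \<C> E X q (push \<C> E X j \<eta>)"
    using push_push[OF \<eta> a(2,4)] push_ident[OF \<eta>] eqs by simp
  also have "\<dots> = pull \<C> E D e (push \<C> E C q (push \<C> E C i \<delta>))"
    using o push_pull[OF el e a(4)] by simp
  also have "\<dots> = \<zero>\<^bsub>obj_map E X D\<^esub>"
    using push_push[OF \<delta>(1) a(1,4)] eqs push_zero_arg[OF \<delta>(1)] pull_zero[OF _ e] by simp
  finally have "K X D \<eta>" using zero_mem el_obj[OF \<eta>] by simp
  moreover have "K A D \<zero>\<^bsub>obj_map E A D\<^esub>" using eqs zero_mem by blast
  moreover have "push \<C> E C p (push \<C> E C i \<delta>) = \<delta>"
    using push_push[OF \<delta>(1) a(1,3)] eqs push_ident[OF \<delta>(1)] by simp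
  ultimately show ?thesis using octahedron_mem(2)[OF oct] \<delta>(2) by simp
qed

lemma pull_projection_mem:
  assumes \<delta>: "el \<delta> C A" "K C A \<delta>" and bip: "biproduct \<C> C D S i j p q"
  shows "K S A (pull \<C> E A p \<delta>)"
proof -
  note a = biproduct_arr[OF bip] and eqs = bip[unfolded biproduct_def]
  have el: "el (pull \<C> E A p \<delta>) S A" using el_pull[OF \<delta>(1) a(3)] .
  obtain T u v where T: "tri A T S u v (pull \<C> E A p \<delta>)" using tri_exists[OF el] .
  obtain B f f' g \<eta> where oct: "octahedron A B T C S D f f' (pull \<C> E A i (pull \<C> E A p \<delta>)) g (q \<cdot> v) \<eta> i q v
      (pull \<C> E A p \<delta>)" and \<epsilon>: "push \<C> E D f' \<eta> = \<zero>\<^bsub>obj_map E D C\<^esub>"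
    by (rule octahedron_of_deflations[OF T split_tri[OF bip]])
  note o = oct[unfolded octahedron_def]
  have \<eta>: "el \<eta> D B" and f: "arr f A B" using o tri_ext tri_arr by blast+
  have "\<eta> = pull \<C> E B j (pull \<C> E B q \<eta>)"
    using pull_pull[OF \<eta> a(4,2)] pull_ident[OF \<eta>] eqs by simp
  also have "\<dots> = push \<C> E D f (pull \<C> E A j (pull \<C> E A p \<delta>))"
    using o push_pull[OF el a(2) f] by simp
  also have "\<dots> = \<zero>\<^bsub>obj_map E D B\<^esub>"
    using pull_pull[OF \<delta>(1) a(3,2)] eqs pull_zero_arg[OF \<delta>(1)] push_zero[OF _ f] by simp
  finally have "K D B \<eta>" using zero_mem el_obj[OF \<eta>] by simp
  moreover have "K D C (push \<C> E D f' \<eta>)" unfolding \<epsilon> using eqs zero_mem by blast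
  moreover have "pull \<C> E A i (pull \<C> E A p \<delta>) = \<delta>"
    using pull_pull[OF \<delta>(1) a(3,1)] eqs pull_ident[OF \<delta>(1)] by simp
  ultimately show ?thesis using octahedron_mem(3)[OF oct] \<delta>(2) by simp
qed

text \<open>For a realization \<open>D \<rightarrow> X \<rightarrow> C\<close> of \<open>a\<^sub>* \<delta>\<close> there is a homotopy pushout triangle
  \<open>A \<rightarrow> B \<oplus> D \<rightarrow> X\<close> with extension \<open>e\<^sup>* \<delta>\<close>. Both are faces of the octahedron of the graph
  \<open>A \<rightarrow> A \<oplus> D\<close> of \<open>\<ominus> a\<close> followed by the inflation \<open>A \<oplus> D \<rightarrow> B \<oplus> D\<close>; its other faces
  are split and \<open>i\<^sub>* \<delta>\<close>. So the deflation \<open>e\<close> controls the pushforward.\<close>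

lemma push_mem:
  assumes \<delta>: "el \<delta> C A" "K C A \<delta>" and a: "arr a A D"
    and def: "\<And>X e. deflation \<C> E s X C e \<Longrightarrow> K X A (pull \<C> E A e \<delta>)"
  shows "K C D (push \<C> E C a \<delta>)"
proof -
  obtain S i j p q where bip: "biproduct \<C> A D S i j p q"
    using ex_biproduct arr_obj[OF a] by blast
  obtain i' q' where bip': "biproduct \<C> A D S i' j p q'" and "q' \<cdot> i = a"
    using biproduct_shear[OF bip a] by blast
  note arrs = biproduct_arr[OF bip] biproduct_arr[OF bip']
  have el: "el (push \<C> E C i \<delta>) C S" using el_push[OF \<delta>(1) arrs(1)] .
  obtain T u v where T: "tri S T C u v (push \<C> E C i \<delta>)" using tri_exists[OF el] .
  obtain X d e h \<eta> where oct: "octahedron A S T D X C i' q' \<zero>\<^bsub>obj_map E D A\<^esub> u v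
      (push \<C> E C i \<delta>) d e h \<eta>"
    by (rule octahedron_of_inflations[OF split_tri[OF bip'] T])
  note o = oct[unfolded octahedron_def]
  have \<eta>: "el \<eta> X A" and e: "arr e X C" using o tri_ext tri_arr by blast+
  have "\<eta> = push \<C> E X p (push \<C> E X i' \<eta>)"
    using push_push[OF \<eta> arrs(5,3)] push_ident[OF \<eta>] bip' by (simp add: biproduct_def)
  also have "\<dots> = pull \<C> E A e (push \<C> E C p (push \<C> E C i \<delta>))"
    using o push_pull[OF el e arrs(3)] by simp
  also have "push \<C> E C p (push \<C> E C i \<delta>) = \<delta>"
    using push_push[OF \<delta>(1) arrs(1,3)] push_ident[OF \<delta>(1)] bip by (simp add: biproduct_def)
  finally have "K X A \<eta>" using def o unfolding deflation_def by blast
  moreover have "K D A \<zero>\<^bsub>obj_map E D A\<^esub>" using zero_mem arr_obj[OF a] by blast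
  moreover have "K C S (push \<C> E C i \<delta>)" using push_inclusion_mem[OF \<delta> bip] .
  moreover have "push \<C> E C q' (push \<C> E C i \<delta>) = push \<C> E C a \<delta>"
    using push_push[OF \<delta>(1) arrs(1,8)] \<open>q' \<cdot> i = a\<close> by simp
  ultimately show ?thesis using octahedron_mem(4)[OF oct] by simp
qed

text \<open>The dual argument, with the homotopy pullback triangle \<open>A' \<rightarrow> B \<oplus> D \<rightarrow> C\<close> whose extension is
  \<open>f\<^sub>* \<delta>\<close> for the inflation \<open>f: A \<rightarrow> A'\<close> of \<open>c\<^sup>* \<delta>\<close>.\<close>

lemma pull_mem:
  assumes \<delta>: "el \<delta> C A" "K C A \<delta>" and c: "arr c D C"
    and infl: "\<And>X f. inflation \<C> E s A X f \<Longrightarrow> K C X (push \<C> E C f \<delta>)"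
  shows "K D A (pull \<C> E A c \<delta>)"
proof -
  obtain S i j p q where bip: "biproduct \<C> C D S i j p q"
    using ex_biproduct arr_obj[OF c] by blast
  obtain j' p' where bip': "biproduct \<C> D C S j' i q p'"
    and "p \<cdot> j' = \<ominus>\<^bsub>Hom \<C> D C\<^esub> (\<ominus>\<^bsub>Hom \<C> D C\<^esub> c)"
    using biproduct_shear[OF biproduct_swap[OF bip] arr_neg[OF c]] by blast
  \<comment> \<open>The shear is taken along \<open>\<ominus> c\<close>, so that its graph component is \<open>c\<close> itself.\<close>
  then have pj: "p \<cdot> j' = c" using neg_neg[OF c] by simp
  note arrs = biproduct_arr[OF bip] biproduct_arr[OF bip']
  have el: "el (pull \<C> E A p \<delta>) S A" using el_pull[OF \<delta>(1) arrs(3)] .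
  obtain T u v where T: "tri A T S u v (pull \<C> E A p \<delta>)" using tri_exists[OF el] .
  obtain B f f' g \<eta> where oct: "octahedron A B T D S C f f' (pull \<C> E A j' (pull \<C> E A p \<delta>)) g (p' \<cdot> v) \<eta> j' p' v
      (pull \<C> E A p \<delta>)" and \<epsilon>: "push \<C> E C f' \<eta> = \<zero>\<^bsub>obj_map E C D\<^esub>"
    by (rule octahedron_of_deflations[OF T split_tri[OF bip']])
  note o = oct[unfolded octahedron_def]
  have \<eta>: "el \<eta> C B" and f: "arr f A B" using o tri_ext tri_arr by blast+
  have "\<eta> = pull \<C> E B i (pull \<C> E B p' \<eta>)"
    using pull_pull[OF \<eta> arrs(8,1)] pull_ident[OF \<eta>] bip' by (simp add: biproduct_def)
  also have "\<dots> = push \<C> E C f (pull \<C> E A i (pull \<C> E A p \<delta>))"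
    using o push_pull[OF el arrs(1) f] by simp
  also have "pull \<C> E A i (pull \<C> E A p \<delta>) = \<delta>"
    using pull_pull[OF \<delta>(1) arrs(3,1)] pull_ident[OF \<delta>(1)] bip by (simp add: biproduct_def)
  finally have "K C B \<eta>" using infl o unfolding inflation_def by blast
  moreover have "K C D (push \<C> E C f' \<eta>)" unfolding \<epsilon> using zero_mem arr_obj[OF c] by blast
  moreover have "K S A (pull \<C> E A p \<delta>)" using pull_projection_mem[OF \<delta> bip] .
  ultimately have "K D A (pull \<C> E A j' (pull \<C> E A p \<delta>))" using octahedron_mem(1)[OF oct] by simp
  then show ?thesis using pull_pull[OF \<delta>(1) arrs(3,5)] pj by simp
qed

text \<open>The largest sub-bifunctor whose extensions all lie in the class, once it is known to be
  closed under addition; stability under all morphisms is built in.\<close>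

definition core :: "'o \<Rightarrow> 'o \<Rightarrow> 'e set" where
  "core C A = {\<delta>. el \<delta> C A \<and>
     (\<forall>C' A' c a. arr c C' C \<longrightarrow> arr a A A' \<longrightarrow> K C' A' (mor_map E c a \<delta>))}"

lemma core_el: "\<delta> \<in> core C A \<Longrightarrow> el \<delta> C A"
  by (simp add: core_def)

lemma core_mor:
  assumes "\<delta> \<in> core C A" "arr c C' C" "arr a A A'"
  shows "mor_map E c a \<delta> \<in> core C' A'"
proof -
  note el = core_el[OF assms(1)]
  have "K C'' A'' (mor_map E c' a' (mor_map E c a \<delta>))" if "arr c' C'' C'" "arr a' A' A''" for C'' A'' c' a'
    using assms(1) mor_mor[OF el assms(2,3) that] arr_comp[OF assms(2) that(1)]
      arr_comp[OF that(2) assms(3)] by (simp add: core_def)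
  then show ?thesis using el_mor[OF el assms(2,3)] by (simp add: core_def)
qed

lemma core_push: "\<delta> \<in> core C A \<Longrightarrow> arr a A A' \<Longrightarrow> push \<C> E C a \<delta> \<in> core C A'"
  and core_pull: "\<delta> \<in> core C A \<Longrightarrow> arr c C' C \<Longrightarrow> pull \<C> E A c \<delta> \<in> core C' A"
  unfolding push_def pull_def using core_mor core_el el_obj arr_ident by blast+

lemma core_mem: "\<delta> \<in> core C A \<Longrightarrow> K C A \<delta>"
proof -
  assume \<delta>: "\<delta> \<in> core C A"
  note el = core_el[OF \<delta>]
  have "K C A (mor_map E (ident \<C> C) (ident \<C> A) \<delta>)"
    using \<delta> el_obj[OF el] arr_ident by (simp add: core_def)
  then show ?thesis using mor_ident el by (simp add: el_def)
qed

text \<open>The two criteria of membership below make the core computable from inflations alone or from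
  deflations alone. With control over the inflations out of \<open>A\<close>, \<open>pull_mem\<close> handles all pullbacks, since
  inflations compose; with all pullbacks available, \<open>push_mem\<close> handles all pushforwards.\<close>

lemma core_of_inflations:
  assumes el: "el \<delta> C A"
    and infl: "\<And>A' x. inflation \<C> E s A A' x \<Longrightarrow> K C A' (push \<C> E C x \<delta>)"
  shows "\<delta> \<in> core C A"
proof -
  have push_inflation: "K C' A' (push \<C> E C' x (pull \<C> E A c \<delta>))"
    if c: "arr c C' C" and x: "inflation \<C> E s A A' x" for C' A' c x
  proof -
    note x' = inflation_arr[OF x]
    have "K C' A' (pull \<C> E A' c (push \<C> E C x \<delta>))"
    proof (rule pull_mem[OF el_push[OF el x'] infl[OF x] c])
      fix X f assume f: "inflation \<C> E s A' X f"
      show "K C X (push \<C> E C f (push \<C> E C x \<delta>))"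
        using infl[OF inflation_comp[OF x f]] push_push[OF el x' inflation_arr[OF f]] by simp
    qed
    then show ?thesis using push_pull[OF el c x'] by simp
  qed
  have pull: "K C' A (pull \<C> E A c \<delta>)" if "arr c C' C" for C' c
    using push_inflation[OF that inflation_ident] push_ident[OF el_pull[OF el that]] el_obj[OF el]
    by simp
  have "K C' A' (mor_map E c a \<delta>)" if c: "arr c C' C" and a: "arr a A A'" for C' A' c a
  proof -
    have "K C' A' (push \<C> E C' a (pull \<C> E A c \<delta>))"
    proof (rule push_mem[OF el_pull[OF el c] pull[OF c] a])
      fix X e assume e: "deflation \<C> E s X C' e"
      show "K X A (pull \<C> E A e (pull \<C> E A c \<delta>))"
        using pull[OF arr_comp[OF c deflation_arr[OF e]]] pull_pull[OF el c deflation_arr[OF e]]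
        by simp
    qed
    then show ?thesis using mor_map_push_pull(1)[OF el c a] by simp
  qed
  then show ?thesis using el by (simp add: core_def)
qed

lemma core_of_deflations:
  assumes el: "el \<delta> C A"
    and defl: "\<And>C' y. deflation \<C> E s C' C y \<Longrightarrow> K C' A (pull \<C> E A y \<delta>)"
  shows "\<delta> \<in> core C A"
proof -
  have pull_deflation: "K C' A' (pull \<C> E A' y (push \<C> E C a \<delta>))"
    if a: "arr a A A'" and y: "deflation \<C> E s C' C y" for C' A' a y
  proof -
    note y' = deflation_arr[OF y]
    have "K C' A' (push \<C> E C' a (pull \<C> E A y \<delta>))"
    proof (rule push_mem[OF el_pull[OF el y'] defl[OF y] a])
      fix X f assume f: "deflation \<C> E s X C' f"
      show "K X A (pull \<C> E A f (pull \<C> E A y \<delta>))"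
        using defl[OF deflation_comp[OF f y]] pull_pull[OF el y' deflation_arr[OF f]] by simp
    qed
    then show ?thesis using push_pull[OF el y' a] by simp
  qed
  have push: "K C A' (push \<C> E C a \<delta>)" if "arr a A A'" for A' a
    using pull_deflation[OF that deflation_ident] pull_ident[OF el_push[OF el that]] el_obj[OF el]
    by simp
  have "K C' A' (mor_map E c a \<delta>)" if c: "arr c C' C" and a: "arr a A A'" for C' A' c a
  proof -
    have "K C' A' (pull \<C> E A' c (push \<C> E C a \<delta>))"
    proof (rule pull_mem[OF el_push[OF el a] push[OF a] c])
      fix X e assume e: "inflation \<C> E s A' X e"
      show "K C X (push \<C> E C e (push \<C> E C a \<delta>))"
        using push[OF arr_comp[OF inflation_arr[OF e] a]] push_push[OF el a inflation_arr[OF e]]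
        by simp
    qed
    then show ?thesis using mor_map_push_pull(2)[OF el c a] by simp
  qed
  then show ?thesis using el by (simp add: core_def)
qed


text \<open>The composite of two inflations of the core. Pushing \<open>\<delta>''\<close> along \<open>a\<close> gives \<open>\<eta>\<close>, which
  lies over the same \<open>D \<rightarrow> X \<rightarrow> G\<close>; the dual octahedral axiom completes it to a new octahedron. Three of its
  faces must lie in the class. Two are pushforwards of the given extensions. The third, \<open>\<kappa>\<close>,
  agrees with \<open>b\<^sub>* \<delta>'\<close> after pullback to \<open>X\<close>, so the two differ by a pushforward of the extension
  \<open>f'\<^sub>* \<delta>'\<close> of \<open>D \<rightarrow> X \<rightarrow> G\<close>, and \<open>\<kappa>\<close> is again a pushforward of \<open>\<delta>'\<close>.\<close>

lemma core_octahedron_composite: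
  assumes oct: "octahedron A B C D X G f f' \<delta> g g' \<delta>' d e h' \<delta>''"
    and \<delta>: "\<delta> \<in> core D A" and \<delta>': "\<delta>' \<in> core G B"
  shows "\<delta>'' \<in> core X A"
proof -
  note o = oct[unfolded octahedron_def]
  have t: "tri A B D f f' \<delta>" "tri A C X (g \<cdot> f) h' \<delta>''" "tri D X G d e (push \<C> E G f' \<delta>')"
    using o by blast+
  have f: "arr f A B" "arr f' B D" and de: "arr d D X" "arr e X G"
    using tri_arr[OF t(1)] tri_arr[OF t(3)] by blast+
  note el'' = tri_ext[OF t(2)] and el' = core_el[OF \<delta>']
  show ?thesis
  proof (rule core_of_inflations[OF el''])
    fix A' a assume "inflation \<C> E s A A' a"
    then have a: "arr a A A'" by (rule inflation_arr)
    define \<eta> where "\<eta> = push \<C> E X a \<delta>''"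
    have \<eta>: "el \<eta> X A'" unfolding \<eta>_def by (rule el_push[OF el'' a])
    obtain M m m' where M: "tri A' M X m m' \<eta>" using tri_exists[OF \<eta>] .
    obtain B\<^sub>1 f\<^sub>1 f\<^sub>1' g\<^sub>1 \<kappa> where oct\<^sub>1: "octahedron A' B\<^sub>1 M D X G f\<^sub>1 f\<^sub>1' (pull \<C> E A' d \<eta>) g\<^sub>1 (e \<cdot> m') \<kappa> d e m' \<eta>"
      and \<kappa>: "push \<C> E G f\<^sub>1' \<kappa> = push \<C> E G f' \<delta>'"
      by (rule octahedron_of_deflations[OF M t(3)])
    note o\<^sub>1 = oct\<^sub>1[unfolded octahedron_def]
    have t\<^sub>1: "tri A' B\<^sub>1 D f\<^sub>1 f\<^sub>1' (pull \<C> E A' d \<eta>)" using o\<^sub>1 by blast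
    have el\<kappa>: "el \<kappa> G B\<^sub>1" using o\<^sub>1 tri_ext by blast
    note f\<^sub>1 = tri_arr[OF t\<^sub>1]
    have d\<eta>: "pull \<C> E A' d \<eta> = push \<C> E D a \<delta>"
      using push_pull[OF el'' de(1) a] o by (simp add: \<eta>_def)
    obtain b where b: "arr b B B\<^sub>1" "b \<cdot> f = f\<^sub>1 \<cdot> a"
      using tri_fill_middle[OF t(1) t\<^sub>1 a arr_ident] el_obj(1)[OF tri_ext[OF t(1)]]
        pull_ident[OF tri_ext[OF t\<^sub>1]] d\<eta> by metis
    have "pull \<C> E B\<^sub>1 e \<kappa> = push \<C> E X f\<^sub>1 \<eta>" using o\<^sub>1 by simp
    also have "\<dots> = push \<C> E X (b \<cdot> f) \<delta>''"
      unfolding \<eta>_def b(2) by (rule push_push[OF el'' a f\<^sub>1(1)])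
    also have "\<dots> = push \<C> E X b (pull \<C> E B e \<delta>')"
      using push_push[OF el'' f(1) b(1)] o by simp
    also have "\<dots> = pull \<C> E B\<^sub>1 e (push \<C> E G b \<delta>')" by (rule push_pull[OF el' de(2) b(1)])
    finally obtain k where k: "arr k D B\<^sub>1"
      "\<kappa> = push \<C> E G b \<delta>' \<oplus>\<^bsub>obj_map E G B\<^sub>1\<^esub> push \<C> E G k (push \<C> E G f' \<delta>')"
      using tri_push_fibre[OF t(3) el\<kappa> el_push[OF el' b(1)]] by blast
    have "\<kappa> = push \<C> E G (b \<oplus>\<^bsub>Hom \<C> B B\<^sub>1\<^esub> k \<cdot> f') \<delta>'"
      using k(2) push_push[OF el' f(2) k(1)] push_add_arg[OF el' b(1) arr_comp[OF k(1) f(2)]] by simp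
    then have "K G B\<^sub>1 \<kappa>"
      using core_mem[OF core_push[OF \<delta>' arr_add[OF b(1) arr_comp[OF k(1) f(2)]]]] by simp
    moreover have "K D A' (pull \<C> E A' d \<eta>)"
      unfolding d\<eta> by (rule core_mem[OF core_push[OF \<delta> a]])
    moreover have "K G D (push \<C> E G f\<^sub>1' \<kappa>)"
      unfolding \<kappa> by (rule core_mem[OF core_push[OF \<delta>' f(2)]])
    ultimately show "K X A' (push \<C> E X a \<delta>'')"
      using octahedron_mem(3)[OF oct\<^sub>1] by (simp add: \<eta>_def)
  qed
qed

text \<open>The dual statement for composites of deflations: \<open>\<eta>\<close> is now a pullback of \<open>\<delta>'\<close>, and the
  unknown face of the new octahedron is a pullback of \<open>\<delta>''\<close>.\<close>

lemma core_octahedron_quotient: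
  assumes oct: "octahedron A B C D X G f f' \<delta> g g' \<delta>' d e h' \<delta>''"
    and \<delta>'': "\<delta>'' \<in> core X A" and \<epsilon>: "push \<C> E G f' \<delta>' \<in> core G D"
  shows "\<delta>' \<in> core G B"
proof -
  note o = oct[unfolded octahedron_def]
  have t: "tri A B D f f' \<delta>" "tri B C G g g' \<delta>'" "tri D X G d e (push \<C> E G f' \<delta>')"
    using o by blast+
  have f: "arr f A B" "arr f' B D" and de: "arr d D X" "arr e X G"
    using tri_arr[OF t(1)] tri_arr[OF t(3)] by blast+
  note el' = tri_ext[OF t(2)] and el'' = core_el[OF \<delta>''] and D = arr_obj(1)[OF de(1)]
  have \<delta>: "pull \<C> E A d \<delta>'' = \<delta>" using o by blast
  show ?thesis
  proof (rule core_of_deflations[OF el'])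
    fix G' c assume "deflation \<C> E s G' G c"
    then have c: "arr c G' G" by (rule deflation_arr)
    define \<eta> where "\<eta> = pull \<C> E B c \<delta>'"
    have \<eta>: "el \<eta> G' B" unfolding \<eta>_def by (rule el_pull[OF el' c])
    obtain M m m' where M: "tri B M G' m m' \<eta>" using tri_exists[OF \<eta>] .
    obtain X\<^sub>1 d\<^sub>1 e\<^sub>1 h\<^sub>1 \<kappa> where oct\<^sub>1: "octahedron A B M D X\<^sub>1 G' f f' \<delta> m m' \<eta> d\<^sub>1 e\<^sub>1 h\<^sub>1 \<kappa>"
      by (rule octahedron_of_inflations[OF t(1) M])
    note o\<^sub>1 = oct\<^sub>1[unfolded octahedron_def]
    have t\<^sub>1: "tri D X\<^sub>1 G' d\<^sub>1 e\<^sub>1 (push \<C> E G' f' \<eta>)" using o\<^sub>1 by blast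
    have el\<kappa>: "el \<kappa> X\<^sub>1 A" using o\<^sub>1 tri_ext by blast
    note de\<^sub>1 = tri_arr[OF t\<^sub>1]
    have f\<eta>: "push \<C> E G' f' \<eta> = pull \<C> E D c (push \<C> E G f' \<delta>')"
      unfolding \<eta>_def by (rule push_pull[OF el' c f(2)])
    obtain b where b: "arr b X\<^sub>1 X" "e \<cdot> b = c \<cdot> e\<^sub>1"
      using tri_fill_middle[OF t\<^sub>1 t(3) arr_ident[OF D] c] push_ident[OF tri_ext[OF t\<^sub>1]] f\<eta> by metis
    have "push \<C> E X\<^sub>1 f \<kappa> = pull \<C> E B e\<^sub>1 \<eta>" using o\<^sub>1 by simp
    also have "\<dots> = pull \<C> E B (e \<cdot> b) \<delta>'"
      unfolding \<eta>_def b(2) by (rule pull_pull[OF el' c de\<^sub>1(2)])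
    also have "\<dots> = pull \<C> E B b (push \<C> E X f \<delta>'')"
      using pull_pull[OF el' de(2) b(1)] o by simp
    also have "\<dots> = push \<C> E X\<^sub>1 f (pull \<C> E A b \<delta>'')" by (rule push_pull[OF el'' b(1) f(1), symmetric])
    finally obtain k where k: "arr k X\<^sub>1 D"
      "\<kappa> = pull \<C> E A b \<delta>'' \<oplus>\<^bsub>obj_map E X\<^sub>1 A\<^esub> pull \<C> E A k (pull \<C> E A d \<delta>'')"
      using tri_pull_fibre[OF t(1) el\<kappa> el_pull[OF el'' b(1)]] unfolding \<delta> by blast
    have "\<kappa> = pull \<C> E A (b \<oplus>\<^bsub>Hom \<C> X\<^sub>1 X\<^esub> d \<cdot> k) \<delta>''"
      using k(2) pull_pull[OF el'' de(1) k(1)] pull_add_arg[OF el'' b(1) arr_comp[OF de(1) k(1)]] by simp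
    then have "K X\<^sub>1 A \<kappa>"
      using core_mem[OF core_pull[OF \<delta>'' arr_add[OF b(1) arr_comp[OF de(1) k(1)]]]] by simp
    moreover have "K D A \<delta>"
      unfolding \<delta>[symmetric] by (rule core_mem[OF core_pull[OF \<delta>'' de(1)]])
    moreover have "K G' D (push \<C> E G' f' \<eta>)"
      unfolding f\<eta> by (rule core_mem[OF core_pull[OF \<epsilon> c]])
    ultimately show "K G' B (pull \<C> E B c \<delta>')"
      using octahedron_mem(2)[OF oct\<^sub>1] by (simp add: \<eta>_def)
  qed
qed

lemma core_zero:
  assumes "C \<in> Obj \<C>" "A \<in> Obj \<C>"
  shows "\<zero>\<^bsub>obj_map E C A\<^esub> \<in> core C A"
  using el_zero[OF assms] zero_mem abelian_group_hom.hom_zero[OF hom_mor] arr_obj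
  by (simp add: core_def)

text \<open>The sum is obtained as a pullback of one extension of the core. Realize \<open>\<delta>\<close> by
  \<open>A \<rightarrow> B \<rightarrow> C\<close> and compose its inflation with that of \<open>x\<^sub>* \<epsilon>\<close>. As \<open>y \<cdot> x = 0\<close>, the resulting
  triangle \<open>C \<rightarrow> X \<rightarrow> C\<close> splits, and the extension \<open>\<eta>\<close> on \<open>X\<close> of the composite restricts to \<open>\<delta>\<close> along
  \<open>d\<close> and equals \<open>e\<^sup>* \<epsilon> + c\<^sup>* \<delta>\<close> for some \<open>c\<close>. Pulling \<open>\<eta>\<close> back along a section \<open>j\<close>
  of \<open>e\<close> gives \<open>\<epsilon> + (cj)\<^sup>* \<delta>\<close>; the correction \<open>d(1 - cj)\<close> turns this into \<open>\<delta> + \<epsilon>\<close>.\<close>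

lemma core_add:
  assumes \<delta>: "\<delta> \<in> core C A" and \<epsilon>: "\<epsilon> \<in> core C A"
  shows "\<delta> \<oplus>\<^bsub>obj_map E C A\<^esub> \<epsilon> \<in> core C A"
proof -
  note el = core_el[OF \<delta>] core_el[OF \<epsilon>] and obj = el_obj[OF core_el[OF \<delta>]]
  obtain B x y where t: "tri A B C x y \<delta>" using tri_exists[OF el(1)] .
  note xy = tri_arr[OF t]
  obtain T u v where t': "tri B T C u v (push \<C> E C x \<epsilon>)" using tri_exists[OF el_push[OF el(2) xy(1)]] .
  obtain X d e h \<eta> where oct: "octahedron A B T C X C x y \<delta> u v (push \<C> E C x \<epsilon>) d e h \<eta>"
    by (rule octahedron_of_inflations[OF t t'])
  note o = oct[unfolded octahedron_def]
  have \<eta>: "\<eta> \<in> core X A"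
    by (rule core_octahedron_composite[OF oct \<delta> core_push[OF \<epsilon> xy(1)]])
  note el\<eta> = core_el[OF \<eta>]
  have "push \<C> E C y (push \<C> E C x \<epsilon>) = \<zero>\<^bsub>obj_map E C C\<^esub>"
    using push_push[OF el(2) xy] tri_comp_zero[OF t] push_zero_arg[OF el(2) obj(1)] by simp
  then have split: "tri C X C d e \<zero>\<^bsub>obj_map E C C\<^esub>" using o by simp
  note de = tri_arr[OF split]
  obtain S i\<^sub>1 i\<^sub>2 p\<^sub>1 p\<^sub>2 where bip: "biproduct \<C> C C S i\<^sub>1 i\<^sub>2 p\<^sub>1 p\<^sub>2" using ex_biproduct obj by blast
  note i = biproduct_arr[OF bip] and I = arr_ident[OF obj(1)]
  obtain b where b: "arr b S X" "e \<cdot> b = ident \<C> C \<cdot> p\<^sub>2"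
    using tri_fill_middle[OF split_tri[OF bip] split I I] push_ident pull_ident el_zero[OF obj(1,1)]
    by metis
  \<comment> \<open>Comparing the direct sum with \<open>X\<close>, two realizations of zero, gives the section.\<close>
  define j where "j = b \<cdot> i\<^sub>2"
  have j: "arr j C X" "e \<cdot> j = ident \<C> C"
    using arr_comp[OF b(1) i(2)] assoc[OF de(2) b(1) i(2)] b(2) ident_left[OF i(4)] bip
    by (simp_all add: j_def biproduct_def)
  have "push \<C> E X x \<eta> = push \<C> E X x (pull \<C> E A e \<epsilon>)"
    using o push_pull[OF el(2) de(2) xy(1)] by simp
  then obtain c where c: "arr c X C" "\<eta> = pull \<C> E A e \<epsilon> \<oplus>\<^bsub>obj_map E X A\<^esub> pull \<C> E A c \<delta>"
    using tri_pull_fibre[OF t el\<eta> el_pull[OF el(2) de(2)]] by blast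
  define n where "n = \<ominus>\<^bsub>Hom \<C> C C\<^esub> (c \<cdot> j)"
  note cj = arr_comp[OF c(1) j(1)]
  have n: "arr n C C" unfolding n_def by (rule arr_neg[OF cj])
  \<comment> \<open>\<open>m = 1 - cj\<close>\<close>
  define m where "m = ident \<C> C \<oplus>\<^bsub>Hom \<C> C C\<^esub> n"
  have m: "arr m C C" unfolding m_def by (rule arr_add[OF I n])
  interpret EE: abelian_group "obj_map E C A" by (rule obj_abelian_group[OF obj])
  interpret H: abelian_group_hom "Hom \<C> C C" "obj_map E C A" "\<lambda>c. pull \<C> E A c \<delta>"
    by (rule hom_pull_arg[OF el(1) obj(1)])
  have 1: "pull \<C> E A j \<eta> = \<epsilon> \<oplus>\<^bsub>obj_map E C A\<^esub> pull \<C> E A (c \<cdot> j) \<delta>"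
    unfolding c(2) using pull_add[OF el_pull[OF el(2) de(2)] el_pull[OF el(1) c(1)] j(1)]
      pull_pull[OF el(2) de(2) j(1)] pull_pull[OF el(1) c(1) j(1)] j(2) pull_ident[OF el(2)] by simp
  have "pull \<C> E A (d \<cdot> m) \<eta> = pull \<C> E A m \<delta>"
    using pull_pull[OF el\<eta> de(1) m] o by simp
  also have "\<dots> = \<delta> \<oplus>\<^bsub>obj_map E C A\<^esub> \<ominus>\<^bsub>obj_map E C A\<^esub> pull \<C> E A (c \<cdot> j) \<delta>"
    unfolding m_def using pull_add_arg[OF el(1) I n] pull_ident[OF el(1)] H.hom_a_inv[OF arr_mor[OF cj]]
    by (simp add: n_def)
  finally have 2: "pull \<C> E A (d \<cdot> m) \<eta> = \<delta> \<oplus>\<^bsub>obj_map E C A\<^esub> \<ominus>\<^bsub>obj_map E C A\<^esub> pull \<C> E A (c \<cdot> j) \<delta>" .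
  have carr: "\<delta> \<in> carrier (obj_map E C A)" "\<epsilon> \<in> carrier (obj_map E C A)"
    "pull \<C> E A (c \<cdot> j) \<delta> \<in> carrier (obj_map E C A)"
    using el el_pull[OF el(1) cj] by (simp_all add: el_def)
  have "pull \<C> E A (j \<oplus>\<^bsub>Hom \<C> C X\<^esub> d \<cdot> m) \<eta> = \<delta> \<oplus>\<^bsub>obj_map E C A\<^esub> \<epsilon>"
    using pull_add_arg[OF el\<eta> j(1) arr_comp[OF de(1) m]] carr
    unfolding 1 2 by (simp add: EE.a_ac EE.r_neg)
  then show ?thesis
    using core_pull[OF \<eta> arr_add[OF j(1) arr_comp[OF de(1) m]]] by simp
qed

lemma core_smult:
  assumes "\<delta> \<in> core C A" "r \<in> carrier R"
  shows "r \<odot>\<^bsub>obj_map E C A\<^esub> \<delta> \<in> core C A"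
proof -
  note el = core_el[OF assms(1)]
  note A = el_obj(2)[OF el]
  have a: "arr (r \<odot>\<^bsub>Hom \<C> A A\<^esub> ident \<C> A) A A"
    using module.smult_closed[OF Hom_module[OF A A] assms(2) ident_closed[OF A]] A by (simp add: arr_def)
  show ?thesis
    using core_push[OF assms(1) a] push_smult_arg[OF el assms(2) arr_ident[OF A]] push_ident[OF el]
    by simp
qed

lemma core_submodule:
  assumes "C \<in> Obj \<C>" "A \<in> Obj \<C>"
  shows "submodule (core C A) R (obj_map E C A)"
proof -
  interpret M: module R "obj_map E C A" by (rule obj_module[OF assms])
  show ?thesis
  proof (rule M.submoduleI)
    show "core C A \<subseteq> carrier (obj_map E C A)" using core_el el_carrier by blast
    show "\<zero>\<^bsub>obj_map E C A\<^esub> \<in> core C A" by (rule core_zero[OF assms])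
    show "\<ominus>\<^bsub>obj_map E C A\<^esub> \<delta> \<in> core C A" if "\<delta> \<in> core C A" for \<delta>
      using core_smult[OF that, of "\<ominus>\<^bsub>R\<^esub> \<one>\<^bsub>R\<^esub>"] M.smult_l_minus[of "\<one>\<^bsub>R\<^esub>" \<delta>] el_carrier[OF core_el[OF that]]
      by simp
    show "\<delta> \<oplus>\<^bsub>obj_map E C A\<^esub> \<epsilon> \<in> core C A" if "\<delta> \<in> core C A" "\<epsilon> \<in> core C A" for \<delta> \<epsilon>
      by (rule core_add[OF that])
    show "r \<odot>\<^bsub>obj_map E C A\<^esub> \<delta> \<in> core C A" if "r \<in> carrier R" "\<delta> \<in> core C A" for r \<delta>
      by (rule core_smult[OF that(2,1)])
  qed
qed

lemma core_sub_bifunctor: "sub_bifunctor R \<C> E core"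
  unfolding sub_bifunctor_def using core_submodule core_mor arrI by auto


end


section \<open>Acyclic extensions\<close>

locale connected_sequence_on_extriangulated =
  extriangulated_category R \<C> E s + connected_sequence R \<C> E F conn
  for R :: "'r ring" and \<C> :: "('r, 'o, 'm) lin_category" (structure)
    and E :: "('r, 'o, 'm, 'e) bifunctor" and s :: "('o, 'm, 'e) realization"
    and F :: "int \<Rightarrow> ('r, 'o, 'm, 'v) bifunctor" and conn :: "('o, 'e, 'v) connecting"
begin

sublocale F: bilinear_functor R \<C> "F n" for n
  by (rule F_bilinear)

abbreviation val :: "int \<Rightarrow> 'o \<Rightarrow> 'o \<Rightarrow> ('r, 'v) module" where
  "val n Y A \<equiv> obj_map (F n) Y A"

abbreviation act :: "int \<Rightarrow> 'o \<Rightarrow> 'm \<Rightarrow> 'v \<Rightarrow> 'v" where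
  "act n Y a \<equiv> push \<C> (F n) Y a"

lemma hom_act: "arr a A B \<Longrightarrow> Y \<in> Obj \<C> \<Longrightarrow> abelian_group_hom (val n Y A) (val n Y B) (act n Y a)"
  by (rule F.hom_push)

lemma hom_conn:
  assumes "el \<delta> C A" "Y \<in> Obj \<C>"
  shows "abelian_group_hom (val n Y C) (val (n + 1) Y A) (conn n C A \<delta> Y)"
  using assms unfolding el_def
  by (intro linear_map_abelian_group_hom[OF F.obj_module F.obj_module conn_linear]) simp_all

lemma act_closed:
  "arr a A B \<Longrightarrow> Y \<in> Obj \<C> \<Longrightarrow> v \<in> carrier (val n Y A) \<Longrightarrow> act n Y a v \<in> carrier (val n Y B)"
  by (rule abelian_group_hom.hom_closed[OF hom_act])

lemma conn_closed:
  "el \<delta> C A \<Longrightarrow> Y \<in> Obj \<C> \<Longrightarrow> v \<in> carrier (val n Y C)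
    \<Longrightarrow> conn n C A \<delta> Y v \<in> carrier (val (n + 1) Y A)"
  by (rule abelian_group_hom.hom_closed[OF hom_conn])

lemma act_comp:
  assumes "arr b B D" "arr a A B" "Y \<in> Obj \<C>" "v \<in> carrier (val n Y A)"
  shows "act n Y (b \<cdot> a) v = act n Y b (act n Y a v)"
  using F.push_push[OF F.elI[OF assms(3) arr_obj(1)[OF assms(2)] assms(4)] assms(2,1)] by simp

lemma act_ident:
  assumes "A \<in> Obj \<C>" "Y \<in> Obj \<C>" "v \<in> carrier (val n Y A)"
  shows "act n Y (ident \<C> A) v = v"
  by (rule F.push_ident[OF F.elI[OF assms(2,1,3)]])

lemma act_zero:
  assumes "A \<in> Obj \<C>" "B \<in> Obj \<C>" "Y \<in> Obj \<C>" "v \<in> carrier (val n Y A)"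
  shows "act n Y \<zero>\<^bsub>Hom \<C> A B\<^esub> v = \<zero>\<^bsub>val n Y B\<^esub>"
  by (rule F.push_zero_arg[OF F.elI[OF assms(3,1,4)] assms(2)])

lemma conn_push:
  assumes "el \<delta> C A" "arr a A A'" "Y \<in> Obj \<C>" "v \<in> carrier (val n Y C)"
  shows "conn n C A' (push \<C> E C a \<delta>) Y v = act (n + 1) Y a (conn n C A \<delta> Y v)"
proof -
  note el' = el_push[OF assms(1,2)] and C = el_obj(1)[OF assms(1)]
  have "ext_morphism \<C> E C A \<delta> C A' (push \<C> E C a \<delta>) a (ident \<C> C)"
    using pull_ident[OF el'] arr_mor[OF assms(2)] ident_closed[OF C] by (simp add: ext_morphism_def)
  from conn_ext_morphism[OF _ _ _ _ _ _ _ this assms(4)] show ?thesis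
    using assms el' act_ident[OF C assms(3,4)] by (simp add: el_def)
qed

lemma conn_pull:
  assumes "el \<delta> C A" "arr c C' C" "Y \<in> Obj \<C>" "v \<in> carrier (val n Y C')"
  shows "conn n C' A (pull \<C> E A c \<delta>) Y v = conn n C A \<delta> Y (act n Y c v)"
proof -
  note el' = el_pull[OF assms(1,2)] and A = el_obj(2)[OF assms(1)]
  have "ext_morphism \<C> E C' A (pull \<C> E A c \<delta>) C A \<delta> (ident \<C> A) c"
    using push_ident[OF el'] arr_mor[OF assms(2)] ident_closed[OF A] by (simp add: ext_morphism_def)
  from conn_ext_morphism[OF _ _ _ _ _ _ _ this assms(4)] show ?thesis
    using assms el' act_ident[OF A assms(3) conn_closed[OF el' assms(3,4)]] by (simp add: el_def)
qed

lemma conn_zero: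
  assumes "C \<in> Obj \<C>" "A \<in> Obj \<C>" "Y \<in> Obj \<C>" "v \<in> carrier (val n Y C)"
  shows "conn n C A \<zero>\<^bsub>obj_map E C A\<^esub> Y v = \<zero>\<^bsub>val (n + 1) Y A\<^esub>"
proof -
  note z = arr_zero[OF assms(2,2)] and el = el_zero[OF assms(1,2)]
  show ?thesis
    using conn_push[OF el z assms(3,4)] push_zero[OF assms(1) z]
      act_zero[OF assms(2,2,3) conn_closed[OF el assms(3,4)]] by simp
qed

definition exact_triangle :: "'o \<Rightarrow> 'o \<Rightarrow> 'o \<Rightarrow> 'm \<Rightarrow> 'm \<Rightarrow> 'e \<Rightarrow> bool" where
  "exact_triangle A B C x y \<delta> \<longleftrightarrow> (\<forall>Y\<in>Obj \<C>. \<forall>n.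
     exact_pair (val n Y A) (val n Y B) (val n Y C) (act n Y x) (act n Y y) \<and>
     exact_pair (val n Y B) (val n Y C) (val (n + 1) Y A) (act n Y y) (conn n C A \<delta> Y) \<and>
     exact_pair (val n Y C) (val (n + 1) Y A) (val (n + 1) Y B) (conn n C A \<delta> Y) (act (n + 1) Y x))"

lemma exact_triangle_iff:
  "exact_triangle A B C x y \<delta> \<longleftrightarrow> exact_in_degrees \<C> F conn UNIV A B C x y \<delta>"
  by (simp add: exact_triangle_def exact_in_degrees_def exact_pair_def)

lemma exact_triangleD:
  assumes "exact_triangle A B C x y \<delta>" "Y \<in> Obj \<C>"
  shows "exact_pair (val n Y A) (val n Y B) (val n Y C) (act n Y x) (act n Y y)"
    and "exact_pair (val n Y B) (val n Y C) (val (n + 1) Y A) (act n Y y) (conn n C A \<delta> Y)"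
    and "exact_pair (val n Y C) (val (n + 1) Y A) (val (n + 1) Y B) (conn n C A \<delta> Y) (act (n + 1) Y x)"
  using assms by (simp_all add: exact_triangle_def)

text \<open>The two terms in degree \<open>n\<close> are treated in degree \<open>n + 1\<close>, because the braid of an
  octahedron reaches back from them to the preceding degree.\<close>

lemma exact_triangleI:
  assumes B: "\<And>Y n. Y \<in> Obj \<C> \<Longrightarrow>
      exact_pair (val (n + 1) Y A) (val (n + 1) Y B) (val (n + 1) Y C) (act (n + 1) Y x) (act (n + 1) Y y)"
    and C: "\<And>Y n. Y \<in> Obj \<C> \<Longrightarrow>
      exact_pair (val (n + 1) Y B) (val (n + 1) Y C) (val (n + 1 + 1) Y A) (act (n + 1) Y y) (conn (n + 1) C A \<delta> Y)"
    and A: "\<And>Y n. Y \<in> Obj \<C> \<Longrightarrow>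
      exact_pair (val n Y C) (val (n + 1) Y A) (val (n + 1) Y B) (conn n C A \<delta> Y) (act (n + 1) Y x)"
  shows "exact_triangle A B C x y \<delta>"
  unfolding exact_triangle_def
proof (intro ballI allI conjI)
  fix Y n assume Y: "Y \<in> Obj \<C>"
  show "exact_pair (val n Y A) (val n Y B) (val n Y C) (act n Y x) (act n Y y)"
    using B[OF Y, of "n - 1"] by simp
  show "exact_pair (val n Y B) (val n Y C) (val (n + 1) Y A) (act n Y y) (conn n C A \<delta> Y)"
    using C[OF Y, of "n - 1"] by simp
  show "exact_pair (val n Y C) (val (n + 1) Y A) (val (n + 1) Y B) (conn n C A \<delta> Y) (act (n + 1) Y x)"
    using A[OF Y] .
qed

lemma tri_complex:
  assumes t: "tri A B C x y \<delta>" and Y: "Y \<in> Obj \<C>"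
  shows "v \<in> carrier (val n Y A) \<Longrightarrow> act n Y y (act n Y x v) = \<zero>\<^bsub>val n Y C\<^esub>"
    and "v \<in> carrier (val n Y B) \<Longrightarrow> conn n C A \<delta> Y (act n Y y v) = \<zero>\<^bsub>val (n + 1) Y A\<^esub>"
    and "v \<in> carrier (val n Y C) \<Longrightarrow> act (n + 1) Y x (conn n C A \<delta> Y v) = \<zero>\<^bsub>val (n + 1) Y B\<^esub>"
proof -
  note xy = tri_arr[OF t] and el = tri_ext[OF t]
  show "act n Y y (act n Y x v) = \<zero>\<^bsub>val n Y C\<^esub>" if v: "v \<in> carrier (val n Y A)"
    using act_comp[OF xy(2,1) Y v] tri_comp_zero[OF t] act_zero[OF _ _ Y v] el by (simp add: el_def)
  show "conn n C A \<delta> Y (act n Y y v) = \<zero>\<^bsub>val (n + 1) Y A\<^esub>" if v: "v \<in> carrier (val n Y B)"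
    using conn_pull[OF el xy(2) Y v] tri_pull_zero[OF t] conn_zero[OF _ _ Y v] xy by (simp add: arr_def)
  show "act (n + 1) Y x (conn n C A \<delta> Y v) = \<zero>\<^bsub>val (n + 1) Y B\<^esub>" if v: "v \<in> carrier (val n Y C)"
    using conn_push[OF el xy(1) Y v] tri_push_zero[OF t] conn_zero[OF _ _ Y v] xy by (simp add: arr_def)
qed

text \<open>Acyclicity refers to all realizations of an extension; they are isomorphic, so one is enough.\<close>

lemma exact_triangle_iso:
  assumes t: "tri A B C x y \<delta>" and t': "tri A B' C x' y' \<delta>" and ex: "exact_triangle A B C x y \<delta>"
  shows "exact_triangle A B' C x' y' \<delta>"
proof -
  note xy = tri_arr[OF t] tri_arr[OF t'] and el = tri_ext[OF t]
  obtain b b' where b: "arr b B B'" "arr b' B' B" "b' \<cdot> b = ident \<C> B" "b \<cdot> b' = ident \<C> B'"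
    "b \<cdot> x = x'" "y' \<cdot> b = y"
    by (rule tri_iso[OF t t'])
  have yb': "y \<cdot> b' = y'"
    using assoc[OF xy(4) b(1,2)] b(4,6) ident_right[OF xy(4)] by simp
  have bx': "b' \<cdot> x' = x"
    using assoc[OF b(2,1) xy(1)] b(3,5) ident_left[OF xy(1)] by simp
  show ?thesis
    unfolding exact_triangle_def
  proof (intro ballI allI conjI)
    fix Y n assume Y: "Y \<in> Obj \<C>"
    note ex' = exact_triangleD[OF ex Y] and cl = act_closed[OF _ Y] and cp = act_comp[OF _ _ Y]
    show "exact_pair (val n Y A) (val n Y B') (val n Y C) (act n Y x') (act n Y y')"
    proof (rule exact_pairI)
      fix u assume u: "u \<in> carrier (val n Y B')" "act n Y y' u = \<zero>\<^bsub>val n Y C\<^esub>"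
      have "act n Y y (act n Y b' u) = \<zero>\<^bsub>val n Y C\<^esub>"
        using cp[OF xy(2) b(2) u(1)] u(2) yb' by simp
      then obtain v where v: "v \<in> carrier (val n Y A)" "act n Y b' u = act n Y x v"
        using exact_pair_lift[OF ex'(1) cl[OF b(2) u(1)]] by blast
      have "u = act n Y b (act n Y b' u)"
        using cp[OF b(1,2) u(1)] b(4) act_ident[OF arr_obj(2)[OF b(1)] Y u(1)] by simp
      also have "\<dots> = act n Y x' v" using cp[OF b(1) xy(1) v(1)] b(5) v(2) by simp
      finally show "\<exists>v\<in>carrier (val n Y A). u = act n Y x' v" using v(1) by blast
    qed (use cl[OF xy(3)] tri_complex[OF t' Y] in simp_all)
    show "exact_pair (val n Y B') (val n Y C) (val (n + 1) Y A) (act n Y y') (conn n C A \<delta> Y)"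
    proof (rule exact_pairI)
      fix w assume w: "w \<in> carrier (val n Y C)" "conn n C A \<delta> Y w = \<zero>\<^bsub>val (n + 1) Y A\<^esub>"
      obtain u where u: "u \<in> carrier (val n Y B)" "w = act n Y y u"
        using exact_pair_lift[OF ex'(2) w] .
      then have "w = act n Y y' (act n Y b u)" using cp[OF xy(4) b(1) u(1)] b(6) by simp
      then show "\<exists>u\<in>carrier (val n Y B'). w = act n Y y' u" using cl[OF b(1) u(1)] by blast
    qed (use cl[OF xy(4)] tri_complex[OF t' Y] in simp_all)
    show "exact_pair (val n Y C) (val (n + 1) Y A) (val (n + 1) Y B') (conn n C A \<delta> Y) (act (n + 1) Y x')"
    proof (rule exact_pairI)
      fix v assume v: "v \<in> carrier (val (n + 1) Y A)" "act (n + 1) Y x' v = \<zero>\<^bsub>val (n + 1) Y B'\<^esub>"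
      have "act (n + 1) Y x v = act (n + 1) Y b' (act (n + 1) Y x' v)"
        using cp[OF b(2) xy(3) v(1)] bx' by simp
      also have "\<dots> = \<zero>\<^bsub>val (n + 1) Y B\<^esub>"
        unfolding v(2) by (rule abelian_group_hom.hom_zero[OF hom_act[OF b(2) Y]])
      finally show "\<exists>w\<in>carrier (val n Y C). v = conn n C A \<delta> Y w"
        using exact_pair_lift[OF ex'(3) v(1)] by blast
    qed (use conn_closed[OF el Y] tri_complex[OF t' Y] in simp_all)
  qed
qed

lemma acyclic_ext_iff:
  assumes "tri A B C x y \<delta>"
  shows "acyclic_ext \<C> E s F conn C A \<delta> \<longleftrightarrow> exact_triangle A B C x y \<delta>"
  using assms exact_triangle_iso unfolding acyclic_ext_def exact_triangle_iff[symmetric] by blast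

lemma split_acyclic:
  assumes C: "C \<in> Obj \<C>" and A: "A \<in> Obj \<C>"
  shows "acyclic_ext \<C> E s F conn C A \<zero>\<^bsub>obj_map E C A\<^esub>"
proof -
  obtain S i j p q where bip: "biproduct \<C> A C S i j p q" using ex_biproduct[OF A C] by blast
  note t = split_tri[OF bip] and a = biproduct_arr[OF bip] and eqs = bip[unfolded biproduct_def]
  have "exact_triangle A S C i q \<zero>\<^bsub>obj_map E C A\<^esub>"
    unfolding exact_triangle_def
  proof (intro ballI allI conjI)
    fix Y n assume Y: "Y \<in> Obj \<C>"
    note cl = act_closed[OF _ Y] and cp = act_comp[OF _ _ Y] and cx = tri_complex[OF t Y]
    have S: "S \<in> Obj \<C>" using eqs by blast
    show "exact_pair (val n Y A) (val n Y S) (val n Y C) (act n Y i) (act n Y q)"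
    proof (rule exact_pairI)
      fix u assume u: "u \<in> carrier (val n Y S)" "act n Y q u = \<zero>\<^bsub>val n Y C\<^esub>"
      interpret j: abelian_group_hom "val n Y C" "val n Y S" "act n Y j" by (rule hom_act[OF a(2) Y])
      have "u = act n Y ((i \<cdot> p) \<oplus>\<^bsub>Hom \<C> S S\<^esub> (j \<cdot> q)) u"
        using eqs act_ident[OF S Y u(1)] by simp
      also have "\<dots> = act n Y i (act n Y p u) \<oplus>\<^bsub>val n Y S\<^esub> act n Y j (act n Y q u)"
        using F.push_add_arg[OF F.elI[OF Y S u(1)] arr_comp[OF a(1,3)] arr_comp[OF a(2,4)]]
          cp[OF a(1,3) u(1)] cp[OF a(2,4) u(1)] by simp
      also have "\<dots> = act n Y i (act n Y p u)"
        using u(2) cl[OF a(1) cl[OF a(3) u(1)]] by simp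
      finally show "\<exists>v\<in>carrier (val n Y A). u = act n Y i v" using cl[OF a(3) u(1)] by blast
    qed (use cl[OF a(1)] cx in simp_all)
    show "exact_pair (val n Y S) (val n Y C) (val (n + 1) Y A) (act n Y q) (conn n C A \<zero>\<^bsub>obj_map E C A\<^esub> Y)"
    proof (rule exact_pairI)
      fix w assume w: "w \<in> carrier (val n Y C)"
      have "w = act n Y q (act n Y j w)" using cp[OF a(4,2) w] eqs act_ident[OF C Y w] by simp
      then show "\<exists>u\<in>carrier (val n Y S). w = act n Y q u" using cl[OF a(2) w] by blast
    qed (use cl[OF a(4)] cx in simp_all)
    show "exact_pair (val n Y C) (val (n + 1) Y A) (val (n + 1) Y S) (conn n C A \<zero>\<^bsub>obj_map E C A\<^esub> Y)
        (act (n + 1) Y i)"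
    proof (rule exact_pairI)
      interpret conn: abelian_group_hom "val n Y C" "val (n + 1) Y A" "conn n C A \<zero>\<^bsub>obj_map E C A\<^esub> Y"
        by (rule hom_conn[OF el_zero[OF C A] Y])
      fix v assume v: "v \<in> carrier (val (n + 1) Y A)" "act (n + 1) Y i v = \<zero>\<^bsub>val (n + 1) Y S\<^esub>"
      have "v = act (n + 1) Y p (act (n + 1) Y i v)" using cp[OF a(3,1) v(1)] eqs act_ident[OF A Y v(1)] by simp
      also have "\<dots> = \<zero>\<^bsub>val (n + 1) Y A\<^esub>"
        unfolding v(2) by (rule abelian_group_hom.hom_zero[OF hom_act[OF a(3) Y]])
      also have "\<dots> = conn n C A \<zero>\<^bsub>obj_map E C A\<^esub> Y \<zero>\<^bsub>val n Y C\<^esub>" by simp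
      finally show "\<exists>w\<in>carrier (val n Y C). v = conn n C A \<zero>\<^bsub>obj_map E C A\<^esub> Y w" by blast
    qed (use conn_closed[OF el_zero[OF C A] Y] cx in simp_all)
  qed
  then show ?thesis using acyclic_ext_iff[OF t] by blast
qed

text \<open>The long sequences of the four triangles of an octahedron form a braid: its groups \<open>Q\<^sub>i\<close> are
  alternately the values of \<open>F\<^sup>n\<close> at \<open>B\<close> and at \<open>X\<close>; between \<open>F\<^sup>n(B)\<close> and \<open>F\<^sup>n(X)\<close> lie those at \<open>D\<close> and
  \<open>C\<close>, and between \<open>F\<^sup>n(X)\<close> and \<open>F\<^sup>n\<^sup>+\<^sup>1(B)\<close> lie \<open>F\<^sup>n(G)\<close> and \<open>F\<^sup>n\<^sup>+\<^sup>1(A)\<close>. The squares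
  commute by \<open>h' \<cdot> g = d \<cdot> f'\<close> and \<open>f\<^sub>* \<delta>'' = e\<^sup>* \<delta>'\<close>, and the four composites
  are \<open>g \<cdot> f\<close>, \<open>e \<cdot> h' = g'\<close> and the connecting maps of \<open>d\<^sup>* \<delta>'' = \<delta>\<close> and of \<open>f'\<^sub>* \<delta>'\<close>.\<close>

lemma octahedron_exact:
  assumes oct: "octahedron A B C D X G f f' \<delta> g g' \<delta>' d e h' \<delta>''"
  defines "h \<equiv> g \<cdot> f" and "\<epsilon> \<equiv> push \<C> E G f' \<delta>'"
  shows "exact_triangle B C G g g' \<delta>' \<Longrightarrow> exact_triangle A C X h h' \<delta>'' \<Longrightarrow> exact_triangle D X G d e \<epsilon>
      \<Longrightarrow> exact_triangle A B D f f' \<delta>"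
    and "exact_triangle A B D f f' \<delta> \<Longrightarrow> exact_triangle A C X h h' \<delta>'' \<Longrightarrow> exact_triangle D X G d e \<epsilon>
      \<Longrightarrow> exact_triangle B C G g g' \<delta>'"
    and "exact_triangle A B D f f' \<delta> \<Longrightarrow> exact_triangle B C G g g' \<delta>' \<Longrightarrow> exact_triangle D X G d e \<epsilon>
      \<Longrightarrow> exact_triangle A C X h h' \<delta>''"
    and "exact_triangle A B D f f' \<delta> \<Longrightarrow> exact_triangle B C G g g' \<delta>' \<Longrightarrow> exact_triangle A C X h h' \<delta>''
      \<Longrightarrow> exact_triangle D X G d e \<epsilon>"
proof -
  note o = oct[unfolded octahedron_def]
  have t: "tri A B D f f' \<delta>" "tri B C G g g' \<delta>'" "tri A C X h h' \<delta>''" "tri D X G d e \<epsilon>"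
    using o by (simp_all add: h_def \<epsilon>_def)
  note a = tri_arr[OF t(1)] tri_arr[OF t(2)] tri_arr[OF t(3)] tri_arr[OF t(4)]
  note el = tri_ext[OF t(1)] tri_ext[OF t(2)] tri_ext[OF t(3)] tri_ext[OF t(4)]
  have square_X: "act n Y d (act n Y f' v) = act n Y h' (act n Y g v)"
    if "Y \<in> Obj \<C>" "v \<in> carrier (val n Y B)" for n Y v
    using act_comp[OF a(7,2) that] act_comp[OF a(6,3) that] o by simp
  have square_B: "act (n + 1) Y f (conn n X A \<delta>'' Y v) = conn n G B \<delta>' Y (act n Y e v)"
    if "Y \<in> Obj \<C>" "v \<in> carrier (val n Y X)" for n Y v
    using conn_push[OF el(3) a(1) that] conn_pull[OF el(2) a(8) that] o by simp
  have comp_h: "act n Y h v = act n Y g (act n Y f v)"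
    if "Y \<in> Obj \<C>" "v \<in> carrier (val n Y A)" for n Y v
    unfolding h_def by (rule act_comp[OF a(3,1) that])
  have comp_g': "act n Y g' v = act n Y e (act n Y h' v)"
    if "Y \<in> Obj \<C>" "v \<in> carrier (val n Y C)" for n Y v
    using act_comp[OF a(8,6) that] o by simp
  have comp_\<delta>: "conn n D A \<delta> Y v = conn n X A \<delta>'' Y (act n Y d v)"
    if "Y \<in> Obj \<C>" "v \<in> carrier (val n Y D)" for n Y v
    using conn_pull[OF el(3) a(7) that] o by simp
  have comp_\<epsilon>: "conn n G D \<epsilon> Y v = act (n + 1) Y f' (conn n G B \<delta>' Y v)"
    if "Y \<in> Obj \<C>" "v \<in> carrier (val n Y G)" for n Y v
    unfolding \<epsilon>_def by (rule conn_push[OF el(2) a(2) that])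
  note hom = hom_act[OF a(1)] hom_act[OF a(2)] hom_act[OF a(3)] hom_act[OF a(7)] hom_act[OF a(8)]
    hom_act[OF a(6)] hom_conn[OF el(2)] hom_conn[OF el(3)]
  note cx = tri_complex[OF t(1)] tri_complex[OF t(2)] tri_complex[OF t(3)] tri_complex[OF t(4)]
  note ex_at = exact_triangleD
  show "exact_triangle A B D f f' \<delta>"
    if ex: "exact_triangle B C G g g' \<delta>'" "exact_triangle A C X h h' \<delta>''" "exact_triangle D X G d e \<epsilon>"
  proof (rule exact_triangleI)
    fix Y n assume Y: "Y \<in> Obj \<C>"
    note e2 = ex_at[OF ex(1) Y] and e3 = ex_at[OF ex(2) Y] and e4 = ex_at[OF ex(3) Y] and hom = hom[OF Y]
      and sq = square_X[OF Y] square_B[OF Y]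
      and comp = comp_h[OF Y] comp_g'[OF Y] comp_\<delta>[OF Y] comp_\<epsilon>[OF Y] and cx = cx[OF Y]
    show "exact_pair (val (n + 1) Y A) (val (n + 1) Y B) (val (n + 1) Y D) (act (n + 1) Y f) (act (n + 1) Y f')"
      by (rule braid_exact_at_crossing[OF hom(5,7,8,1,2,3,4,6) sq(2,1) comp(1,4) cx(1) e3(1) e2(3) e4(2)])
    show "exact_pair (val (n + 1) Y B) (val (n + 1) Y D) (val (n + 1 + 1) Y A) (act (n + 1) Y f')
        (conn (n + 1) D A \<delta> Y)"
      by (rule braid_exact_before_composite[OF hom(7,2,3,4,6,5,8) sq(1) comp(3,2,4) cx(10) e3(2) e2(1) e4(3)])
    show "exact_pair (val n Y D) (val (n + 1) Y A) (val (n + 1) Y B) (conn n D A \<delta> Y) (act (n + 1) Y f)"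
      by (rule braid_exact_after_composite[OF hom(4,6,5,8,7,1,3) sq(2)[symmetric] comp(3,2,1) cx(8) e3(3) e2(2) e4(1)])
  qed
  show "exact_triangle B C G g g' \<delta>'"
    if ex: "exact_triangle A B D f f' \<delta>" "exact_triangle A C X h h' \<delta>''" "exact_triangle D X G d e \<epsilon>"
  proof (rule exact_triangleI)
    fix Y n assume Y: "Y \<in> Obj \<C>"
    note e1 = ex_at[OF ex(1) Y] and e3 = ex_at[OF ex(2) Y] and e4 = ex_at[OF ex(3) Y] and hom = hom[OF Y]
      and sq = square_X[OF Y] square_B[OF Y]
      and comp = comp_h[OF Y] comp_g'[OF Y] comp_\<delta>[OF Y] comp_\<epsilon>[OF Y] and cx = cx[OF Y]
    show "exact_pair (val (n + 1) Y B) (val (n + 1) Y C) (val (n + 1) Y G) (act (n + 1) Y g) (act (n + 1) Y g')"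
      by (rule braid_exact_before_composite[OF hom(1,3,2,6,4,8,5) sq(1)[symmetric] comp(2,3,1) cx(8) e4(1) e1(2) e3(1)])
    show "exact_pair (val (n + 1) Y C) (val (n + 1) Y G) (val (n + 1 + 1) Y B) (act (n + 1) Y g')
        (conn (n + 1) G B \<delta>' Y)"
      by (rule braid_exact_after_composite[OF hom(6,4,8,5,1,7,2) sq(2) comp(2,3,4) cx(10) e4(2) e1(3) e3(2)])
    show "exact_pair (val n Y G) (val (n + 1) Y B) (val (n + 1) Y C) (conn n G B \<delta>' Y) (act (n + 1) Y g)"
      by (rule braid_exact_at_crossing[OF hom(8,1,5,7,3,2,6,4) sq(2)[symmetric] sq(1)[symmetric] comp(4,1) cx(6) e4(3) e1(1) e3(3)])
  qed
  show "exact_triangle A C X h h' \<delta>''"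
    if ex: "exact_triangle A B D f f' \<delta>" "exact_triangle B C G g g' \<delta>'" "exact_triangle D X G d e \<epsilon>"
  proof (rule exact_triangleI)
    fix Y n assume Y: "Y \<in> Obj \<C>"
    note e1 = ex_at[OF ex(1) Y] and e2 = ex_at[OF ex(2) Y] and e4 = ex_at[OF ex(3) Y] and hom = hom[OF Y]
      and sq = square_X[OF Y] square_B[OF Y]
      and comp = comp_h[OF Y] comp_g'[OF Y] comp_\<delta>[OF Y] comp_\<epsilon>[OF Y] and cx = cx[OF Y]
    show "exact_pair (val (n + 1) Y A) (val (n + 1) Y C) (val (n + 1) Y X) (act (n + 1) Y h) (act (n + 1) Y h')"
      by (rule braid_exact_after_composite[OF hom(1,7,2,3,4,6,5) sq(1) comp(1,4,2) cx(6) e2(1) e4(3) e1(1)])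
    show "exact_pair (val (n + 1) Y C) (val (n + 1) Y X) (val (n + 1 + 1) Y A) (act (n + 1) Y h')
        (conn (n + 1) X A \<delta>'' Y)"
      by (rule braid_exact_at_crossing[OF hom(2,4,3,6,8,5,1,7) sq(1)[symmetric] sq(2) comp(2,3) cx(8) e2(2) e4(1) e1(2)])
    show "exact_pair (val n Y X) (val (n + 1) Y A) (val (n + 1) Y C) (conn n X A \<delta>'' Y) (act (n + 1) Y h)"
      by (rule braid_exact_before_composite[OF hom(4,8,5,1,7,2,3) sq(2) comp(1,4,3) cx(1) e2(3) e4(2) e1(3)])
  qed
  show "exact_triangle D X G d e \<epsilon>"
    if ex: "exact_triangle A B D f f' \<delta>" "exact_triangle B C G g g' \<delta>'" "exact_triangle A C X h h' \<delta>''"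
  proof (rule exact_triangleI)
    fix Y n assume Y: "Y \<in> Obj \<C>"
    note e1 = ex_at[OF ex(1) Y] and e2 = ex_at[OF ex(2) Y] and e3 = ex_at[OF ex(3) Y] and hom = hom[OF Y]
      and sq = square_X[OF Y] square_B[OF Y]
      and comp = comp_h[OF Y] comp_g'[OF Y] comp_\<delta>[OF Y] comp_\<epsilon>[OF Y] and cx = cx[OF Y]
    show "exact_pair (val (n + 1) Y D) (val (n + 1) Y X) (val (n + 1) Y G) (act (n + 1) Y d) (act (n + 1) Y e)"
      by (rule braid_exact_at_crossing[OF hom(3,6,2,4,5,8,7,1) sq(1) sq(2)[symmetric] comp(3,2) cx(10) e1(3) e3(2) e2(1)])
    show "exact_pair (val (n + 1) Y X) (val (n + 1) Y G) (val (n + 1 + 1) Y D) (act (n + 1) Y e)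
        (conn (n + 1) G D \<epsilon> Y)"
      by (rule braid_exact_before_composite[OF hom(6,5,8,7,1,3,2) sq(2)[symmetric] comp(4,1,2) cx(6) e1(1) e3(3) e2(2)])
    show "exact_pair (val n Y G) (val (n + 1) Y D) (val (n + 1) Y X) (conn n G D \<epsilon> Y) (act (n + 1) Y d)"
      by (rule braid_exact_after_composite[OF hom(7,1,3,2,6,4,8) sq(1)[symmetric] comp(4,1,3) cx(1) e1(2) e3(1) e2(3)])
  qed
qed

sublocale acyclic: octahedral_class R \<C> E s "acyclic_ext \<C> E s F conn"
proof
  show "acyclic_ext \<C> E s F conn C A \<zero>\<^bsub>obj_map E C A\<^esub>" if "C \<in> Obj \<C>" "A \<in> Obj \<C>" for C A
    using that by (rule split_acyclic)
  fix A B C D X G f f' \<delta> g g' \<delta>' d e h' \<delta>''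
  assume oct: "octahedron A B C D X G f f' \<delta> g g' \<delta>' d e h' \<delta>''"
  then have t: "tri A B D f f' \<delta>" "tri B C G g g' \<delta>'" "tri A C X (g \<cdot> f) h' \<delta>''"
    "tri D X G d e (push \<C> E G f' \<delta>')"
    unfolding octahedron_def by blast+
  note iff = acyclic_ext_iff[OF t(1)] acyclic_ext_iff[OF t(2)] acyclic_ext_iff[OF t(3)]
    acyclic_ext_iff[OF t(4)]
  let ?K = "acyclic_ext \<C> E s F conn"
  show "?K G B \<delta>' \<Longrightarrow> ?K X A \<delta>'' \<Longrightarrow> ?K G D (push \<C> E G f' \<delta>') \<Longrightarrow> ?K D A \<delta>"
    unfolding iff by (rule octahedron_exact(1)[OF oct])
  show "?K D A \<delta> \<Longrightarrow> ?K X A \<delta>'' \<Longrightarrow> ?K G D (push \<C> E G f' \<delta>') \<Longrightarrow> ?K G B \<delta>'"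
    unfolding iff by (rule octahedron_exact(2)[OF oct])
  show "?K D A \<delta> \<Longrightarrow> ?K G B \<delta>' \<Longrightarrow> ?K G D (push \<C> E G f' \<delta>') \<Longrightarrow> ?K X A \<delta>''"
    unfolding iff by (rule octahedron_exact(3)[OF oct])
  show "?K D A \<delta> \<Longrightarrow> ?K G B \<delta>' \<Longrightarrow> ?K X A \<delta>'' \<Longrightarrow> ?K G D (push \<C> E G f' \<delta>')"
    unfolding iff by (rule octahedron_exact(4)[OF oct])
qed

lemma inflation_acyclic_eq_core: "inflation_acyclic \<C> E s F conn C A = acyclic.core C A"
  if "C \<in> Obj \<C>" "A \<in> Obj \<C>"
proof
  show "inflation_acyclic \<C> E s F conn C A \<subseteq> acyclic.core C A"
    using that acyclic.core_of_inflations by (auto simp: inflation_acyclic_def el_def)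
  show "acyclic.core C A \<subseteq> inflation_acyclic \<C> E s F conn C A"
    using acyclic.core_mem[OF acyclic.core_push] acyclic.core_el inflation_arr
    by (auto simp: inflation_acyclic_def intro: el_carrier)
qed

lemma deflation_acyclic_eq_core: "deflation_acyclic \<C> E s F conn C A = acyclic.core C A"
  if "C \<in> Obj \<C>" "A \<in> Obj \<C>"
proof
  show "deflation_acyclic \<C> E s F conn C A \<subseteq> acyclic.core C A"
    using that acyclic.core_of_deflations by (auto simp: deflation_acyclic_def el_def)
  show "acyclic.core C A \<subseteq> deflation_acyclic \<C> E s F conn C A"
    using acyclic.core_mem[OF acyclic.core_pull] acyclic.core_el deflation_arr
    by (auto simp: deflation_acyclic_def intro: el_carrier)
qed

lemma restrict_connected_sequence:
  assumes "sub_bifunctor R \<C> E H"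
  shows "connected_sequence R \<C> (restrict_bifunctor E H) F conn"
proof -
  have sub: "H C A \<subseteq> carrier (obj_map E C A)" if "C \<in> Obj \<C>" "A \<in> Obj \<C>" for C A
    using assms that module.submoduleE(1)[OF obj_module[OF that]] unfolding sub_bifunctor_def by blast
  have mem: "\<delta> \<in> carrier (obj_map E C A)"
    if "C \<in> Obj \<C>" "A \<in> Obj \<C>" "\<delta> \<in> carrier (obj_map (restrict_bifunctor E H) C A)" for C A \<delta>
    using sub that by (auto simp: restrict_bifunctor_def)
  show ?thesis
    by unfold_locales
      (simp_all only: F_bilinear conn_linear conn_natural mem restrict_ext_morphism,
        blast intro: conn_ext_morphism mem)
qed

lemma restrict_acyclic:
  assumes "sub_bifunctor R \<C> E H" "\<delta> \<in> H C A"
  shows "acyclic_ext \<C> (restrict_bifunctor E H) s F conn C A \<delta> \<longleftrightarrow> acyclic_ext \<C> E s F conn C A \<delta>"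
  unfolding acyclic_ext_def restrict_triangle_iff[OF assms(1)] using assms(2) by blast

lemma delta_functor_restrict_iff:
  assumes "sub_bifunctor R \<C> E H"
  shows "delta_functor R \<C> (restrict_bifunctor E H) s F conn \<longleftrightarrow>
    (\<forall>C\<in>Obj \<C>. \<forall>A\<in>Obj \<C>. \<forall>\<delta>\<in>H C A. acyclic_ext \<C> E s F conn C A \<delta>)"
  using restrict_connected_sequence[OF assms] restrict_acyclic[OF assms]
  by (simp add: delta_functor_def restrict_bifunctor_def)

lemma inflation_acyclic_sub_bifunctor: "sub_bifunctor R \<C> E (inflation_acyclic \<C> E s F conn)"
  using acyclic.core_sub_bifunctor by (simp add: sub_bifunctor_def inflation_acyclic_eq_core)

lemma inflation_acyclic_closed: "closed_sub_bifunctor R \<C> E s (inflation_acyclic \<C> E s F conn)"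
proof (rule closed_sub_bifunctorI[OF inflation_acyclic_sub_bifunctor])
  fix A B C D X G f f' \<delta> g g' \<delta>' d e h' \<delta>''
  assume oct: "octahedron A B C D X G f f' \<delta> g g' \<delta>' d e h' \<delta>''"
  then have obj: "A \<in> Obj \<C>" "B \<in> Obj \<C>" "D \<in> Obj \<C>" "X \<in> Obj \<C>" "G \<in> Obj \<C>"
    unfolding octahedron_def s_triangle_def by blast+
  note eq = inflation_acyclic_eq_core[OF obj(3,1)] inflation_acyclic_eq_core[OF obj(5,2)]
    inflation_acyclic_eq_core[OF obj(4,1)] inflation_acyclic_eq_core[OF obj(5,3)]
  let ?H = "inflation_acyclic \<C> E s F conn"
  show "\<delta> \<in> ?H D A \<Longrightarrow> \<delta>' \<in> ?H G B \<Longrightarrow> \<delta>'' \<in> ?H X A"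
    unfolding eq by (rule acyclic.core_octahedron_composite[OF oct])
  show "\<delta>'' \<in> ?H X A \<Longrightarrow> push \<C> E G f' \<delta>' \<in> ?H G D \<Longrightarrow> \<delta>' \<in> ?H G B"
    unfolding eq by (rule acyclic.core_octahedron_quotient[OF oct])
qed

lemma inflation_acyclic_largest:
  assumes H: "sub_bifunctor R \<C> E H" and delta: "delta_functor R \<C> (restrict_bifunctor E H) s F conn"
    and obj: "C \<in> Obj \<C>" "A \<in> Obj \<C>"
  shows "H C A \<subseteq> inflation_acyclic \<C> E s F conn C A"
proof
  fix \<delta> assume \<delta>: "\<delta> \<in> H C A"
  have "\<delta> \<in> carrier (obj_map E C A)"
    using \<delta> H obj module.submoduleE(1)[OF obj_module[OF obj]] unfolding sub_bifunctor_def by blast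
  moreover have "acyclic_ext \<C> E s F conn C A' (push \<C> E C x \<delta>)" if "inflation \<C> E s A A' x" for A' x
  proof -
    note x = inflation_arr[OF that]
    have "push \<C> E C x \<delta> \<in> H C A'"
      using H obj \<delta> arr_obj(2)[OF x] arr_mor[OF x] ident_closed[OF obj(1)]
      unfolding sub_bifunctor_def push_def by blast
    then show ?thesis using delta obj(1) arr_obj(2)[OF x] unfolding delta_functor_restrict_iff[OF H] by blast
  qed
  ultimately show "\<delta> \<in> inflation_acyclic \<C> E s F conn C A" by (simp add: inflation_acyclic_def)
qed

end


section \<open>The largest relative theory\<close>

theorem corollary4p23:
  fixes R :: "'r ring"
    and \<C> :: "('r, 'o, 'm) lin_category"
    and E :: "('r, 'o, 'm, 'e) bifunctor"
    and s :: "('o, 'm, 'e) realization"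
    and F :: "int \<Rightarrow> ('r, 'o, 'm, 'v) bifunctor"
    and conn :: "('o, 'e, 'v) connecting"
  assumes "extriangulated_category R \<C> E s"
    and "connected_sequence R \<C> E F conn"
    and "\<exists>m. partial_delta_functor \<C> E s F conn {m<..} \<or> partial_delta_functor \<C> E s F conn {..<m}"
  defines "\<F> \<equiv> inflation_acyclic \<C> E s F conn"
  shows "(\<forall>C\<in>Obj \<C>. \<forall>A\<in>Obj \<C>. \<F> C A = deflation_acyclic \<C> E s F conn C A) \<and>
    closed_sub_bifunctor R \<C> E s \<F> \<and>
    delta_functor R \<C> (restrict_bifunctor E \<F>) s F conn \<and>
    (\<forall>\<F>'. closed_sub_bifunctor R \<C> E s \<F>' \<and>
       delta_functor R \<C> (restrict_bifunctor E \<F>') s F conn \<longrightarrow>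
       (\<forall>C\<in>Obj \<C>. \<forall>A\<in>Obj \<C>. \<F>' C A \<subseteq> \<F> C A))"
proof -
  interpret connected_sequence_on_extriangulated R \<C> E s F conn
    using assms(1,2) by (rule connected_sequence_on_extriangulated.intro)
  have "\<forall>C\<in>Obj \<C>. \<forall>A\<in>Obj \<C>. \<F> C A = deflation_acyclic \<C> E s F conn C A"
    by (simp add: \<F>_def inflation_acyclic_eq_core deflation_acyclic_eq_core)
  moreover have "closed_sub_bifunctor R \<C> E s \<F>"
    unfolding \<F>_def by (rule inflation_acyclic_closed)
  moreover have "delta_functor R \<C> (restrict_bifunctor E \<F>) s F conn"
    unfolding \<F>_def delta_functor_restrict_iff[OF inflation_acyclic_sub_bifunctor]
    using acyclic.core_mem by (simp add: inflation_acyclic_eq_core)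
  moreover have "\<F>' C A \<subseteq> \<F> C A"
    if "closed_sub_bifunctor R \<C> E s \<F>'" "delta_functor R \<C> (restrict_bifunctor E \<F>') s F conn"
      "C \<in> Obj \<C>" "A \<in> Obj \<C>" for \<F>' C A
    using that inflation_acyclic_largest unfolding \<F>_def closed_sub_bifunctor_def by blast
  ultimately show ?thesis by blast
qed

end
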